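(* (Existence.) Let $V$ be a vector superspace, $|0\rangle\in V$ an even vector, $T$ an even endomorphism of $V$ and $S^i$, $i=1,\dots,N$, odd endomorphisms of $V$, pairwise anticommuting between themselves and commuting with $T$. Suppose moreover that $T|0\rangle=S^i|0\rangle=0$. Let $\mathcal F$ be a family of $\mathrm{End}(V)$-valued fields $$a^\alpha(Z)=\sum_{j\in\mathbb Z,J}Z^{-1-j|N\setminus J}a^\alpha_{(j|J)}$$ indexed by $\alpha\in A$, such that (1) $a^\alpha(Z)|0\rangle\big|_{Z=0}=a^\alpha\in V$ (in particular $a^\alpha(Z)|0\rangle\in V[[Z]]$); (2) $[T,a^\alpha(Z)]=\partial_za^\alpha(Z)$ and $[S^i,a^\alpha(Z)]=\partial_{\theta^i}a^\alpha(Z)$; (3) all pairs $(a^\alpha(Z),a^\beta(Z))$ are local; (4) the vectors $a^{\alpha_s}_{(j_s|J_s)}\cdots a^{\alpha_1}_{(j_1|J_1)}|0\rangle$ span $V$. Then the formula $$Y\bigl(a^{\alpha_s}_{(j_s|J_s)}\cdots a^{\alpha_1}_{(j_1|J_1)}|0\rangle,Z\bigr)=\prod_i\sigma(J_i)\;a^{\alpha_s}(Z)_{(j_s|J_s)}\Bigl(\cdots a^{\alpha_2}(Z)_{(j_2|J_2)}\bigl(a^{\alpha_1}(Z)_{(j_1|J_1)}\mathrm{Id}\bigr)\cdots\Bigr)$$ gives a well defined structure of an $N_W=N$ SUSY vertex algebra on $V$, with vacuum vector $|0\rangle$, translation operators $T,S^i$, and such that $Y(a^\alpha,Z)=a^\alpha(Z)$.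 Such a structure is unique.
   Context: Ground field $\mathbb C$; $N\ge0$ a fixed integer. $Z=(z,\theta^1,\dots,\theta^N)$, $W=(w,\zeta^1,\dots,\zeta^N)$, $z,w$ even, $\theta^i,\zeta^i$ odd; odd variables anticommute with each other and supercommute with elements of superspaces; $[\ ,\ ]$ is the supercommutator. For $J=\{j_1<\dots<j_k\}\subset\{1,\dots,N\}$, $\theta^J=\theta^{j_1}\cdots\theta^{j_k}$, $Z^{j|J}=z^j\theta^J$, $N\setminus J=\{1,\dots,N\}\setminus J$; $\sigma(J)=\pm1$ is defined by $\theta^J\theta^{N\setminus J}=\sigma(J)\theta^1\cdots\theta^N$. $V[[Z]]=V[[z]][\theta^1,\dots,\theta^N]$, $V((Z))=V((z))[\theta^1,\dots,\theta^N]$. An $\mathrm{End}(V)$-valued field is a formal sum $a(Z)=\sum_{n\in\mathbb Z,I}Z^{n|I}a_{n|I}$, $a_{n|I}\in\mathrm{End}(V)$, with $a(Z)v\in V((Z))$ for all $v$; fields are homogeneous: parity $p(a)$ means $a_{n|I}$ has parity $p(a)+\#I$. A pair $(a(Z),b(Z))$ is local if $(z-w)^n[a(Z),b(W)]=0$ for some $n\in\mathbb Z_{\ge0}$. $\mathrm{res}_Z$ is the coefficient of $z^{-1}\theta^1\cdots\theta^N$ (written to the right of it). For fields and all $j\in\mathbb Z$, $J\subset\{1,\dots,N\}$, the $(j|J)$-product is $$a(W)_{(j|J)}b(W)=\mathrm{res}_Z\bigl(i_{z,w}(Z-W)^{j|J}a(Z)b(W)-(-1)^{p(a)p(b)}i_{w,z}(Z-W)^{j|J}b(W)a(Z)\bigr),$$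 where $(Z-W)^{j|J}=(z-w)^j\prod_{i\in J}(\theta^i-\zeta^i)$ (increasing order) and $i_{z,w}$, $i_{w,z}$ are the expansions in the domains $|z|>|w|$, $|w|>|z|$. An $N_W=N$ SUSY vertex algebra is a vector superspace $V$ with an even vector $|0\rangle$, an even operator $T$, odd operators $S^1,\dots,S^N$, and a parity preserving linear map $a\mapsto Y(a,Z)$ from $V$ to $\mathrm{End}(V)$-valued fields such that: $Y(a,Z)|0\rangle\in V[[Z]]$ has value $a$ at $Z=0$, $T|0\rangle=S^i|0\rangle=0$; $[T,Y(a,Z)]=\partial_zY(a,Z)$, $[S^i,Y(a,Z)]=\partial_{\theta^i}Y(a,Z)$; every pair $(Y(a,Z),Y(b,Z))$ is local. *)

theory Defs
  imports Complex_Main "HOL-Library.Z2" "HOL-Library.Groups_Big_Fun"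
begin

section \<open>Vector superspaces over the complex numbers\<close>

class complex_superspace = ab_group_add +
  fixes scaleC :: "complex \<Rightarrow> 'a \<Rightarrow> 'a" (infixr \<open>*\<^sub>C\<close> 75)
    and grade :: "bit \<Rightarrow> 'a set"
  assumes scaleC_add_right: "c *\<^sub>C (x + y) = c *\<^sub>C x + c *\<^sub>C y"
    and scaleC_add_left: "(c + d) *\<^sub>C x = c *\<^sub>C x + d *\<^sub>C x"
    and scaleC_scaleC: "c *\<^sub>C (d *\<^sub>C x) = (c * d) *\<^sub>C x"
    and scaleC_one: "1 *\<^sub>C x = x"
    and grade_zero: "0 \<in> grade p"
    and grade_add: "x \<in> grade p \<Longrightarrow> y \<in> grade p \<Longrightarrow> x + y \<in> grade p"
    and grade_scaleC: "x \<in> grade p \<Longrightarrow> c *\<^sub>C x \<in> grade p"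
    and grade_Int: "grade 0 \<inter> grade 1 = {0}"
    and grade_sum: "\<exists>y\<in>grade 0. \<exists>z\<in>grade 1. x = y + z"

interpretation complex_vector:
  vector_space "scaleC :: complex \<Rightarrow> 'a \<Rightarrow> 'a::complex_superspace"
  by unfold_locales
    (simp_all add: scaleC_add_right scaleC_add_left scaleC_scaleC scaleC_one)

definition endo :: "('v::complex_superspace \<Rightarrow> 'v) \<Rightarrow> bool" where
  "endo f \<longleftrightarrow> Vector_Spaces.linear scaleC scaleC f"

definition endo_parity :: "bit \<Rightarrow> ('v::complex_superspace \<Rightarrow> 'v) \<Rightarrow> bool" where
  "endo_parity p f \<longleftrightarrow> (\<forall>q. \<forall>v\<in>grade q. f v \<in> grade (q + p))"


section \<open>Signs\<close>

definition koszul :: "bit \<Rightarrow> complex" where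
  "koszul p = (if p = 0 then 1 else - 1)"

definition par :: "nat set \<Rightarrow> bit" where
  "par I = of_nat (card I)"

text \<open>The product \<open>\<theta>\<^sup>I \<theta>\<^sup>K\<close> equals \<open>eps I K\<close> times \<open>\<theta>\<close> to the power \<open>I \<union> K\<close>.\<close>

definition eps :: "nat set \<Rightarrow> nat set \<Rightarrow> complex" where
  "eps I K = (if I \<inter> K = {} then (- 1) ^ card {(i, k). i \<in> I \<and> k \<in> K \<and> k < i} else 0)"

definition sigma :: "nat \<Rightarrow> nat set \<Rightarrow> complex" where
  "sigma N J = eps J ({1..N} - J)"

text \<open>The sign in
  \<open>(\<theta>\<^sup>I \<zeta>\<^sup>K) (\<theta>\<^sup>I' \<zeta>\<^sup>K')\<close>, when written as a multiple of the monomial in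
  which all \<open>\<theta>\<close> precede all \<open>\<zeta>\<close>.\<close>

definition eps2 :: "nat set \<Rightarrow> nat set \<Rightarrow> nat set \<Rightarrow> nat set \<Rightarrow> complex" where
  "eps2 I K I' K' = koszul (par K * par I') * eps I I' * eps K K'"


section \<open>Fields\<close>

text \<open>A formal sum \<open>a(Z)\<close> over \<open>n\<close>, \<open>I\<close> of \<open>Z\<close>-monomials \<open>z\<^sup>n \<theta>\<^sup>I\<close> with coefficients
  written to the right of them is represented by the function \<open>n, I \<mapsto> a n I\<close>, extended by
  zero to the index sets \<open>I\<close> not contained in \<open>{1..N}\<close>.\<close>

type_synonym 'v series = "int \<Rightarrow> nat set \<Rightarrow> 'v \<Rightarrow> 'v"

definition sfield :: "nat \<Rightarrow> 'v::complex_superspace series \<Rightarrow> bool" where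
  "sfield N a \<longleftrightarrow>
     (\<forall>n I. endo (a n I)) \<and>
     (\<forall>n I. \<not> I \<subseteq> {1..N} \<longrightarrow> a n I = (\<lambda>_. 0)) \<and>
     (\<forall>v I. \<exists>m. \<forall>n<m. a n I v = 0)"

definition series_parity :: "nat \<Rightarrow> bit \<Rightarrow> 'v::complex_superspace series \<Rightarrow> bool" where
  "series_parity N p a \<longleftrightarrow> (\<forall>n I. I \<subseteq> {1..N} \<longrightarrow> endo_parity (p + par I) (a n I))"

text \<open>The parity \<open>p(a)\<close> of a homogeneous field. It is unique unless the field is zero, in
  which case the value is irrelevant; on inhomogeneous fields it has no meaning and it is not used.\<close>

definition parity_of :: "nat \<Rightarrow> 'v::complex_superspace series \<Rightarrow> bit" where
  "parity_of N a = (if series_parity N 0 a then 0 else 1)"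

definition mode :: "nat \<Rightarrow> 'v series \<Rightarrow> int \<Rightarrow> nat set \<Rightarrow> 'v \<Rightarrow> 'v" where
  "mode N a j J = a (- 1 - j) ({1..N} - J)"

definition id_series :: "'v::complex_superspace series" where
  "id_series n I v = (if n = 0 \<and> I = {} then v else 0)"

definition d_even :: "'v::complex_superspace series \<Rightarrow> 'v series" where
  "d_even a n I v = of_int (n + 1) *\<^sub>C a (n + 1) I v"

text \<open>The left derivative with respect to \<open>\<theta>\<^sup>i\<close>.\<close>

definition d_odd :: "nat \<Rightarrow> 'v::complex_superspace series \<Rightarrow> 'v series" where
  "d_odd i a n I v = (if i \<in> I then 0 else eps {i} I *\<^sub>C a n (insert i I) v)"

text \<open>The supercommutator \<open>[A, a(Z)]\<close> of an endomorphism \<open>A\<close> of parity \<open>q\<close> with a homogeneous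
  field; the first sign comes from moving \<open>A\<close> past \<open>\<theta>\<^sup>I\<close>.\<close>

definition bracket :: "nat \<Rightarrow> bit \<Rightarrow> ('v \<Rightarrow> 'v) \<Rightarrow> 'v::complex_superspace series \<Rightarrow> 'v series" where
  "bracket N q A a n I v =
     koszul (q * par I) *\<^sub>C A (a n I v) - koszul (q * parity_of N a) *\<^sub>C a n I (A v)"

text \<open>\<open>a(Z)|0\<rangle>\<close> is a power series whose value at \<open>Z = 0\<close> is \<open>v\<close>.\<close>

definition creates :: "'v \<Rightarrow> 'v::complex_superspace series \<Rightarrow> 'v \<Rightarrow> bool" where
  "creates vac a v \<longleftrightarrow> (\<forall>n I. n < 0 \<longrightarrow> a n I vac = 0) \<and> a 0 {} vac = v"


section \<open>Series in two variables\<close>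

text \<open>The arguments \<open>n I m K\<close> stand for the monomial \<open>z\<^sup>n \<theta>\<^sup>I w\<^sup>m \<zeta>\<^sup>K\<close>, written to the left of its
  coefficient.\<close>

type_synonym 'v series2 = "int \<Rightarrow> nat set \<Rightarrow> int \<Rightarrow> nat set \<Rightarrow> 'v \<Rightarrow> 'v"
type_synonym kernel = "int \<Rightarrow> nat set \<Rightarrow> int \<Rightarrow> nat set \<Rightarrow> complex"
type_synonym grassmann = "nat set \<Rightarrow> nat set \<Rightarrow> complex"

definition grassmann_one :: grassmann where
  "grassmann_one I K = (if I = {} \<and> K = {} then 1 else 0)"

definition grassmann_mult :: "grassmann \<Rightarrow> grassmann \<Rightarrow> grassmann" where
  "grassmann_mult f g I K =
     (\<Sum>I'\<in>Pow I. \<Sum>K'\<in>Pow K. eps2 I' K' (I - I') (K - K') * f I' K' * g (I - I') (K - K'))"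

definition theta_minus_zeta :: "nat \<Rightarrow> grassmann" where
  "theta_minus_zeta i I K =
     (if I = {i} \<and> K = {} then 1 else if I = {} \<and> K = {i} then - 1 else 0)"

text \<open>The product of the \<open>\<theta>\<^sup>i - \<zeta>\<^sup>i\<close> over \<open>i \<in> J\<close> in increasing order.\<close>

definition odd_power :: "nat set \<Rightarrow> grassmann" where
  "odd_power J =
     foldr (\<lambda>i. grassmann_mult (theta_minus_zeta i)) (sorted_list_of_set J) grassmann_one"

text \<open>The expansions of \<open>(Z - W)\<close> to the power \<open>j|J\<close>, where \<open>(z - w)\<^sup>j\<close> is expanded in
  nonnegative powers of \<open>w\<close> and of \<open>z\<close>, respectively.\<close>

definition expand_zw :: "int \<Rightarrow> nat set \<Rightarrow> kernel" where
  "expand_zw j J n I m K =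
     (if n + m = j \<and> 0 \<le> m then (of_int j gchoose nat m) * (- 1) powi m else 0) * odd_power J I K"

definition expand_wz :: "int \<Rightarrow> nat set \<Rightarrow> kernel" where
  "expand_wz j J n I m K =
     (if n + m = j \<and> 0 \<le> n then (of_int j gchoose nat n) * (- 1) powi m else 0) * odd_power J I K"

text \<open>The sum over the even exponents is evaluated on each vector separately; for the products
  occurring below only finitely many of its terms are then nonzero.\<close>

definition kernel_mult :: "kernel \<Rightarrow> 'v::complex_superspace series2 \<Rightarrow> 'v series2" where
  "kernel_mult c X n I m K v =
     (\<Sum>I'\<in>Pow I. \<Sum>K'\<in>Pow K. eps2 I' K' (I - I') (K - K') *\<^sub>C
        Sum_any (\<lambda>(n', m'). c n' I' m' K' *\<^sub>C X (n - n') (I - I') (m - m') (K - K') v))"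

text \<open>The products \<open>a(Z) b(W)\<close> and \<open>b(W) a(Z)\<close> of homogeneous fields. In the first, the
  coefficient of \<open>\<theta>\<^sup>I\<close> in \<open>a\<close> is moved past \<open>\<zeta>\<^sup>K\<close>; in the second, the
  coefficient of \<open>\<zeta>\<^sup>K\<close> in \<open>b\<close> is moved past \<open>\<theta>\<^sup>I\<close>, and then \<open>\<zeta>\<^sup>K\<close> itself is.\<close>

definition prod_ZW :: "nat \<Rightarrow> 'v::complex_superspace series \<Rightarrow> 'v series \<Rightarrow> 'v series2" where
  "prod_ZW N a b n I m K v =
     koszul ((parity_of N a + par I) * par K) *\<^sub>C a n I (b m K v)"

definition prod_WZ :: "nat \<Rightarrow> 'v::complex_superspace series \<Rightarrow> 'v series \<Rightarrow> 'v series2" where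
  "prod_WZ N b a n I m K v =
     koszul ((parity_of N b + par K) * par I + par K * par I) *\<^sub>C b m K (a n I v)"

definition supercomm :: "nat \<Rightarrow> 'v::complex_superspace series \<Rightarrow> 'v series \<Rightarrow> 'v series2" where
  "supercomm N a b n I m K v =
     prod_ZW N a b n I m K v - koszul (parity_of N a * parity_of N b) *\<^sub>C prod_WZ N b a n I m K v"

text \<open>For a nonnegative exponent the kernel is the polynomial \<open>(z - w)\<^sup>k\<close>.\<close>

definition local_pair :: "nat \<Rightarrow> 'v::complex_superspace series \<Rightarrow> 'v series \<Rightarrow> bool" where
  "local_pair N a b \<longleftrightarrow>
     (\<exists>k::nat. \<forall>n I m K v. kernel_mult (expand_zw (int k) {}) (supercomm N a b) n I m K v = 0)"

definition res_Z :: "nat \<Rightarrow> 'v series2 \<Rightarrow> 'v series" where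
  "res_Z N X m K = X (- 1) {1..N} m K"

definition nprod ::
  "nat \<Rightarrow> int \<Rightarrow> nat set \<Rightarrow> 'v::complex_superspace series \<Rightarrow> 'v series \<Rightarrow> 'v series" where
  "nprod N j J a b =
     res_Z N (\<lambda>n I m K v.
       kernel_mult (expand_zw j J) (prod_ZW N a b) n I m K v
       - koszul (parity_of N a * parity_of N b) *\<^sub>C
           kernel_mult (expand_wz j J) (prod_WZ N b a) n I m K v)"


section \<open>SUSY vertex algebras\<close>

text \<open>Conditions involving supercommutators are imposed on homogeneous vectors, where \<open>Y a\<close> is
  a homogeneous field; they extend to all vectors by linearity.\<close>

definition susy_vertex_algebra ::
  "nat \<Rightarrow> 'v::complex_superspace \<Rightarrow> ('v \<Rightarrow> 'v) \<Rightarrow> (nat \<Rightarrow> 'v \<Rightarrow> 'v) \<Rightarrow> ('v \<Rightarrow> 'v series) \<Rightarrow> bool"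
  where
  "susy_vertex_algebra N vac T S Y \<longleftrightarrow>
     vac \<in> grade 0 \<and>
     endo T \<and> endo_parity 0 T \<and>
     (\<forall>i\<in>{1..N}. endo (S i) \<and> endo_parity 1 (S i)) \<and>
     (\<forall>a. sfield N (Y a)) \<and>
     (\<forall>n I v. Vector_Spaces.linear scaleC scaleC (\<lambda>a. Y a n I v)) \<and>
     (\<forall>p. \<forall>a\<in>grade p. series_parity N p (Y a)) \<and>
     (\<forall>a. creates vac (Y a) a) \<and> T vac = 0 \<and> (\<forall>i\<in>{1..N}. S i vac = 0) \<and>
     (\<forall>p. \<forall>a\<in>grade p. bracket N 0 T (Y a) = d_even (Y a)) \<and>
     (\<forall>p. \<forall>a\<in>grade p. \<forall>i\<in>{1..N}. bracket N 1 (S i) (Y a) = d_odd i (Y a)) \<and>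
     (\<forall>p q. \<forall>a\<in>grade p. \<forall>b\<in>grade q. local_pair N (Y a) (Y b))"


section \<open>Words in the modes of a family of fields\<close>

text \<open>The list \<open>[(\<alpha>\<^sub>s, j\<^sub>s, J\<^sub>s), \<dots>, (\<alpha>\<^sub>1, j\<^sub>1, J\<^sub>1)]\<close>, leftmost factor first,
  encodes the iterated actions and products below.\<close>

type_synonym 'i mode_word = "('i \<times> int \<times> nat set) list"

definition mode_words :: "nat \<Rightarrow> 'i set \<Rightarrow> 'i mode_word set" where
  "mode_words N A = lists (A \<times> UNIV \<times> Pow {1..N})"

definition word_vector ::
  "nat \<Rightarrow> ('i \<Rightarrow> 'v series) \<Rightarrow> 'v \<Rightarrow> 'i mode_word \<Rightarrow> 'v" where
  "word_vector N F vac = (\<lambda>xs. foldr (\<lambda>(\<alpha>, j, J). mode N (F \<alpha>) j J) xs vac)"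

definition word_series ::
  "nat \<Rightarrow> ('i \<Rightarrow> 'v::complex_superspace series) \<Rightarrow> 'i mode_word \<Rightarrow> 'v series" where
  "word_series N F = (\<lambda>xs. foldr (\<lambda>(\<alpha>, j, J). nprod N j J (F \<alpha>)) xs id_series)"

definition word_sign :: "nat \<Rightarrow> 'i mode_word \<Rightarrow> complex" where
  "word_sign N xs = (\<Prod>(\<alpha>, j, J)\<leftarrow>xs. sigma N J)"

end

theory Submission
  imports Defs
begin

text \<open>
  A superfield is a finite family of fields \<open>a\<^sub>I(z)\<close> in the even variable, and the \<open>(j|J)\<close>-product is a
  signed sum of ordinary \<open>j\<close>-th products of these components. For fields with
  \<open>(z - w)\<^sup>r [a(z), b(w)] = 0\<close>, the \<open>j\<close>-th product (\<open>j < r\<close>) is the restriction to \<open>z = w\<close> of the divided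
  derivative of order \<open>r - 1 - j\<close> in \<open>z\<close> of the series \<open>(z - w)\<^sup>r a(z) b(w)\<close>, which is bounded below
  in both variables. This makes Dong's lemma and translation covariance formal; covariance under the odd
  \<open>S\<^sup>i\<close> is a Leibniz rule with a pairwise cancellation of terms.

  By Goddard's argument a covariant field \<open>X\<close> which is local with the generators is determined by its
  value \<open>X(Z)|0\<rangle>\<close> at \<open>Z = 0\<close>: if this value vanishes, covariance gives \<open>X(Z)|0\<rangle> = 0\<close>, and locality
  propagates this to all words in the generators. The iterated products of the generators
  are covariant and have as values the word vectors up to sign. Hence the fields generated by them correspond
  bijectively to the vectors of \<open>V\<close>, and the inverse of this correspondence is \<open>Y\<close>.
\<close>

section \<open>Residues of formal series in two even variables\<close>

lemma endo_add: "endo f \<Longrightarrow> f (x + y) = f x + f y"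
  unfolding endo_def Vector_Spaces.linear_def module_hom_def module_hom_axioms_def by blast

lemma endo_scale: "endo f \<Longrightarrow> f (c *\<^sub>C x) = c *\<^sub>C f x"
  unfolding endo_def Vector_Spaces.linear_def module_hom_def module_hom_axioms_def by blast

lemma endoI:
  assumes "\<And>x y. f (x + y) = f x + f y" "\<And>c x. f (c *\<^sub>C x) = c *\<^sub>C f x"
  shows "endo f"
  unfolding endo_def
  by (simp add: assms Vector_Spaces.linear_iff complex_vector.vector_space_axioms)

lemma endo_zero: "endo f \<Longrightarrow> f 0 = 0"
  using endo_scale[of f 0 0] by simp

lemma endo_minus: "endo f \<Longrightarrow> f (- x) = - f x"
  using endo_scale[of f "-1" x] by simp

lemma endo_diff: "endo f \<Longrightarrow> f (x - y) = f x - f y"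
  using endo_add[of f x "- y"] by (simp add: endo_minus)

lemma endo_sum: "endo f \<Longrightarrow> f (sum g A) = (\<Sum>x\<in>A. f (g x))"
  by (induction A rule: infinite_finite_induct) (simp_all add: endo_zero endo_add)

lemma endo_zero_fun: "endo (\<lambda>_. 0)"
  by (simp add: endoI)

lemmas endo_simps = endo_add endo_scale endo_zero endo_minus endo_diff

lemma Sum_any_lessThan:
  assumes "\<And>i. M \<le> i \<Longrightarrow> f i = 0"
  shows "Sum_any f = sum f {..<M::nat}"
  by (rule Sum_any.expand_superset) (use assms not_less in \<open>auto intro: ccontr\<close>)

lemma Sum_any_int_interval:
  assumes "\<And>p. p \<notin> {A..<B} \<Longrightarrow> f p = 0"
  shows "Sum_any f = sum f {A..<B::int}"
  by (rule Sum_any.expand_superset) (use assms in \<open>auto intro: ccontr\<close>)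

definition bounded_left :: "(int \<Rightarrow> int \<Rightarrow> 'v::zero) \<Rightarrow> bool" where
  "bounded_left X \<longleftrightarrow> (\<exists>M. \<forall>p q. p < M \<longrightarrow> X p q = 0)"

definition bounded_right :: "(int \<Rightarrow> int \<Rightarrow> 'v::zero) \<Rightarrow> bool" where
  "bounded_right X \<longleftrightarrow> (\<exists>M. \<forall>p q. q < M \<longrightarrow> X p q = 0)"

text \<open>Multiplication of \<open>X(z, w)\<close> by \<open>z - w\<close>.\<close>

definition zw_mult :: "(int \<Rightarrow> int \<Rightarrow> 'v::ab_group_add) \<Rightarrow> int \<Rightarrow> int \<Rightarrow> 'v" where
  "zw_mult X p q = X (p - 1) q - X p (q - 1)"

lemma bounded_left_zw_mult: "bounded_left X \<Longrightarrow> bounded_left (zw_mult X)"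
  unfolding bounded_left_def zw_mult_def by (erule ex_forward) auto

lemma bounded_right_zw_mult: "bounded_right X \<Longrightarrow> bounded_right (zw_mult X)"
  unfolding bounded_right_def zw_mult_def by (erule ex_forward) auto

lemma bounded_left_zw_mult_pow: "bounded_left X \<Longrightarrow> bounded_left ((zw_mult ^^ k) X)"
  by (induction k) (simp_all add: bounded_left_zw_mult)

lemma bounded_right_zw_mult_pow: "bounded_right X \<Longrightarrow> bounded_right ((zw_mult ^^ k) X)"
  by (induction k) (simp_all add: bounded_right_zw_mult)

lemma zw_mult_pow_endo: "endo f \<Longrightarrow> (zw_mult ^^ k) (\<lambda>p q. f (X p q)) p q = f ((zw_mult ^^ k) X p q)"
  by (induction k arbitrary: p q) (simp_all add: zw_mult_def endo_diff)

lemma zw_mult_pow_add: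
  "(zw_mult ^^ k) (\<lambda>p q. X p q + Y p q) p q = (zw_mult ^^ k) X p q + (zw_mult ^^ k) Y p q"
  by (induction k arbitrary: p q) (simp_all add: zw_mult_def)

lemma zw_mult_pow_zero: "(zw_mult ^^ k) (\<lambda>p q. 0) p q = 0"
  by (induction k arbitrary: p q) (simp_all add: zw_mult_def)

lemma zw_mult_pow_scale:
  "(zw_mult ^^ k) (\<lambda>p q. c *\<^sub>C X p q) p q = c *\<^sub>C (zw_mult ^^ k) X p q"
  by (induction k arbitrary: p q) (simp_all add: zw_mult_def complex_vector.scale_right_diff_distrib)

lemma zw_mult_pow_sum:
  "(zw_mult ^^ k) (\<lambda>p q. \<Sum>i\<in>I. X i p q) p q = (\<Sum>i\<in>I. (zw_mult ^^ k) (X i) p q)"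
  by (induction I rule: infinite_finite_induct) (simp_all add: zw_mult_pow_zero zw_mult_pow_add)

lemma zw_mult_pow_diff:
  "(zw_mult ^^ k) (\<lambda>p q. X p q - Y p q) p q = (zw_mult ^^ k) X p q - (zw_mult ^^ k) Y p q"
  by (induction k arbitrary: p q) (simp_all add: zw_mult_def)

lemma zw_mult_pow_flip:
  "(zw_mult ^^ k) (\<lambda>p q. X q p) p q = (-1) ^ k *\<^sub>C (zw_mult ^^ k) X q p"
  by (induction k arbitrary: p q)
    (simp_all add: zw_mult_def complex_vector.scale_right_diff_distrib)

text \<open>The residue in \<open>z\<close> of \<open>i\<^bsub>z,w\<^esub>(z - w)\<^sup>j X(z, w) - i\<^bsub>w,z\<^esub>(z - w)\<^sup>j Y(z, w)\<close>.\<close>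

definition res_pair ::
  "int \<Rightarrow> (int \<Rightarrow> int \<Rightarrow> 'v::complex_superspace) \<Rightarrow> (int \<Rightarrow> int \<Rightarrow> 'v) \<Rightarrow> int \<Rightarrow> 'v" where
  "res_pair j X Y m =
     Sum_any (\<lambda>i::nat. ((of_int j gchoose i) * (- 1) ^ i) *\<^sub>C X (int i - 1 - j) (m - int i)) -
     Sum_any (\<lambda>i::nat. ((of_int j gchoose i) * (- 1) powi (j - int i)) *\<^sub>C Y (- 1 - int i) (m - j + int i))"

lemma res_pair_lessThan:
  assumes "\<And>p q. q < M \<Longrightarrow> X p q = 0" "\<And>p q. p < M' \<Longrightarrow> Y p q = 0"
    and "nat (m - M + 1) \<le> L" "nat (- M') \<le> L"
  shows "res_pair j X Y m =
     (\<Sum>i<L. ((of_int j gchoose i) * (- 1) ^ i) *\<^sub>C X (int i - 1 - j) (m - int i)) -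
     (\<Sum>i<L. ((of_int j gchoose i) * (- 1) powi (j - int i)) *\<^sub>C Y (- 1 - int i) (m - j + int i))"
proof -
  have "X (int i - 1 - j) (m - int i) = 0" if "L \<le> i" for i
    by (rule assms(1)) (use assms(3) that in linarith)
  moreover have "Y (- 1 - int i) (m - j + int i) = 0" if "L \<le> i" for i
    by (rule assms(2)) (use assms(4) that in linarith)
  ultimately show ?thesis
    unfolding res_pair_def
    by (subst (1 2) Sum_any_lessThan[where M = L]) simp_all
qed

lemma res_pair_bound:
  assumes "bounded_right X" "bounded_left Y"
  obtains L0 where "\<And>L. L0 \<le> L \<Longrightarrow> res_pair j X Y m =
     (\<Sum>i<L. ((of_int j gchoose i) * (- 1) ^ i) *\<^sub>C X (int i - 1 - j) (m - int i)) -
     (\<Sum>i<L. ((of_int j gchoose i) * (- 1) powi (j - int i)) *\<^sub>C Y (- 1 - int i) (m - j + int i))"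
proof -
  obtain M where M: "\<And>p q. q < M \<Longrightarrow> X p q = 0"
    using assms(1) unfolding bounded_right_def by blast
  obtain M' where M': "\<And>p q. p < M' \<Longrightarrow> Y p q = 0"
    using assms(2) unfolding bounded_left_def by blast
  show thesis
  proof (rule that[of "max (nat (m - M + 1)) (nat (- M'))"])
    fix L assume "max (nat (m - M + 1)) (nat (- M')) \<le> L"
    then have "nat (m - M + 1) \<le> L" "nat (- M') \<le> L"
      by simp_all
    then show "res_pair j X Y m =
       (\<Sum>i<L. ((of_int j gchoose i) * (- 1) ^ i) *\<^sub>C X (int i - 1 - j) (m - int i)) -
       (\<Sum>i<L. ((of_int j gchoose i) * (- 1) powi (j - int i)) *\<^sub>C Y (- 1 - int i) (m - j + int i))"
      by (intro res_pair_lessThan[of M X M' Y m L j] M M')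
  qed
qed

lemma res_pair_endo:
  assumes "bounded_right X" "bounded_left Y" "endo f"
  shows "f (res_pair j X Y m) = res_pair j (\<lambda>p q. f (X p q)) (\<lambda>p q. f (Y p q)) m"
proof -
  have fX: "bounded_right (\<lambda>p q. f (X p q))" "bounded_left (\<lambda>p q. f (Y p q))"
    using assms unfolding bounded_right_def bounded_left_def by (metis endo_zero)+
  obtain L1 where L1: "\<And>L. L1 \<le> L \<Longrightarrow> res_pair j X Y m =
     (\<Sum>i<L. ((of_int j gchoose i) * (- 1) ^ i) *\<^sub>C X (int i - 1 - j) (m - int i)) -
     (\<Sum>i<L. ((of_int j gchoose i) * (- 1) powi (j - int i)) *\<^sub>C Y (- 1 - int i) (m - j + int i))"
    using res_pair_bound[OF assms(1,2)] by blast
  obtain L2 where L2: "\<And>L. L2 \<le> L \<Longrightarrow> res_pair j (\<lambda>p q. f (X p q)) (\<lambda>p q. f (Y p q)) m =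
     (\<Sum>i<L. ((of_int j gchoose i) * (- 1) ^ i) *\<^sub>C f (X (int i - 1 - j) (m - int i))) -
     (\<Sum>i<L. ((of_int j gchoose i) * (- 1) powi (j - int i)) *\<^sub>C f (Y (- 1 - int i) (m - j + int i)))"
    using res_pair_bound[OF fX] by blast
  show ?thesis
    using L1[of "max L1 L2"] L2[of "max L1 L2"] assms(3)
    by (simp add: endo_simps endo_sum)
qed

lemma Sum_any_scale:
  fixes f :: "'b \<Rightarrow> 'v::complex_superspace"
  shows "Sum_any (\<lambda>x. c *\<^sub>C f x) = c *\<^sub>C Sum_any f"
  by (cases "c = 0") (simp_all add: Sum_any.expand_set complex_vector.scale_sum_right)

lemma res_pair_scale:
  "res_pair j (\<lambda>p q. c *\<^sub>C X p q) (\<lambda>p q. c *\<^sub>C Y p q) m = c *\<^sub>C res_pair j X Y m"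
  unfolding res_pair_def complex_vector.scale_left_commute[of _ c] Sum_any_scale
  by (simp only: complex_vector.scale_right_diff_distrib)

lemma res_pair_add:
  assumes "bounded_right X" "bounded_left Y" "bounded_right X'" "bounded_left Y'"
  shows "res_pair j (\<lambda>p q. X p q + X' p q) (\<lambda>p q. Y p q + Y' p q) m =
    res_pair j X Y m + res_pair j X' Y' m"
proof -
  obtain L1 where L1: "\<And>L. L1 \<le> L \<Longrightarrow> res_pair j X Y m =
     (\<Sum>i<L. ((of_int j gchoose i) * (- 1) ^ i) *\<^sub>C X (int i - 1 - j) (m - int i)) -
     (\<Sum>i<L. ((of_int j gchoose i) * (- 1) powi (j - int i)) *\<^sub>C Y (- 1 - int i) (m - j + int i))"
    using res_pair_bound[OF assms(1,2)] by blast
  obtain L2 where L2: "\<And>L. L2 \<le> L \<Longrightarrow> res_pair j X' Y' m =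
     (\<Sum>i<L. ((of_int j gchoose i) * (- 1) ^ i) *\<^sub>C X' (int i - 1 - j) (m - int i)) -
     (\<Sum>i<L. ((of_int j gchoose i) * (- 1) powi (j - int i)) *\<^sub>C Y' (- 1 - int i) (m - j + int i))"
    using res_pair_bound[OF assms(3,4)] by blast
  have "bounded_right (\<lambda>p q. X p q + X' p q)"
    using assms(1,3) unfolding bounded_right_def by (metis add.right_neutral min_less_iff_conj)
  moreover have "bounded_left (\<lambda>p q. Y p q + Y' p q)"
    using assms(2,4) unfolding bounded_left_def by (metis add.right_neutral min_less_iff_conj)
  ultimately obtain L3 where L3: "\<And>L. L3 \<le> L \<Longrightarrow>
     res_pair j (\<lambda>p q. X p q + X' p q) (\<lambda>p q. Y p q + Y' p q) m =
     (\<Sum>i<L. ((of_int j gchoose i) * (- 1) ^ i) *\<^sub>C (X (int i - 1 - j) (m - int i) + X' (int i - 1 - j) (m - int i))) -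
     (\<Sum>i<L. ((of_int j gchoose i) * (- 1) powi (j - int i)) *\<^sub>C
        (Y (- 1 - int i) (m - j + int i) + Y' (- 1 - int i) (m - j + int i)))"
    using res_pair_bound[of "\<lambda>p q. X p q + X' p q" "\<lambda>p q. Y p q + Y' p q" j m] by blast
  show ?thesis
    using L1[of "max L1 (max L2 L3)"] L2[of "max L1 (max L2 L3)"] L3[of "max L1 (max L2 L3)"]
    by (simp add: complex_vector.scale_right_distrib sum.distrib)
qed

lemma res_pair_zw_mult:
  assumes "bounded_right X" "bounded_left Y"
  shows "res_pair j (zw_mult X) (zw_mult Y) m = res_pair (j + 1) X Y m"
proof -
  obtain M where M: "\<And>p q. q < M \<Longrightarrow> X p q = 0"
    using assms(1) unfolding bounded_right_def by blast
  obtain M' where M': "\<And>p q. p < M' \<Longrightarrow> Y p q = 0"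
    using assms(2) unfolding bounded_left_def by blast
  define L where "L = max (nat (m - M + 1)) (nat (1 - M'))"
  define g where "g i = (of_int j gchoose i :: complex)" for i
  have dX: "zw_mult X p q = 0" if "q < M" for p q
    using that by (simp add: zw_mult_def M)
  have dY: "zw_mult Y p q = 0" if "p < M'" for p q
    using that by (simp add: zw_mult_def M')
  have bin: "of_int (j + 1) gchoose Suc i = g i + g (Suc i)" for i
    using gbinomial_Suc_Suc[of "of_int j :: complex" i] by (simp add: g_def)
  have 1: "res_pair j (zw_mult X) (zw_mult Y) m =
     (\<Sum>i<Suc L. (g i * (- 1) ^ i) *\<^sub>C zw_mult X (int i - 1 - j) (m - int i)) -
     (\<Sum>i<Suc L. (g i * (- 1) powi (j - int i)) *\<^sub>C zw_mult Y (- 1 - int i) (m - j + int i))"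
    unfolding g_def by (rule res_pair_lessThan[OF dX dY]) (simp_all add: L_def, linarith+)
  have 2: "res_pair (j + 1) X Y m =
     (\<Sum>i<Suc L. ((of_int (j + 1) gchoose i) * (- 1) ^ i) *\<^sub>C X (int i - 1 - (j + 1)) (m - int i)) -
     (\<Sum>i<Suc L. ((of_int (j + 1) gchoose i) * (- 1) powi (j + 1 - int i)) *\<^sub>C Y (- 1 - int i) (m - (j + 1) + int i))"
    by (rule res_pair_lessThan[OF M M']) (simp_all add: L_def, linarith+)
  have "(\<Sum>i<Suc L. (g i * (- 1) ^ i) *\<^sub>C zw_mult X (int i - 1 - j) (m - int i)) =
     (\<Sum>i<Suc L. (g i * (- 1) ^ i) *\<^sub>C X (int i - 2 - j) (m - int i)) -
     (\<Sum>i<Suc L. (g i * (- 1) ^ i) *\<^sub>C X (int i - 1 - j) (m - int i - 1))"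
    by (simp add: zw_mult_def complex_vector.scale_right_diff_distrib sum_subtractf algebra_simps
        del: sum.lessThan_Suc)
  also have "\<dots> = X (- j - 2) m + (\<Sum>i<L. (g (Suc i) * (- 1) ^ Suc i) *\<^sub>C X (int i - 1 - j) (m - int i - 1)) -
     (\<Sum>i<L. (g i * (- 1) ^ i) *\<^sub>C X (int i - 1 - j) (m - int i - 1))"
  proof -
    have "X (int L - 1 - j) (m - int L - 1) = 0"
      by (rule M) (use L_def in linarith)
    then show ?thesis
      by (subst sum.lessThan_Suc_shift, subst sum.lessThan_Suc)
        (simp add: g_def algebra_simps, simp only: minus_diff_commute[of 2 j])
  qed
  also have "\<dots> = X (- j - 2) m + (\<Sum>i<L. ((of_int (j + 1) gchoose Suc i) * (- 1) ^ Suc i) *\<^sub>C X (int i - 1 - j) (m - int i - 1))"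
    unfolding bin
    by (simp add: sum_subtractf[symmetric] sum.distrib[symmetric] algebra_simps sum_negf[symmetric]
        complex_vector.scale_left_distrib del: of_int_add)
  also have "\<dots> = (\<Sum>i<Suc L. ((of_int (j + 1) gchoose i) * (- 1) ^ i) *\<^sub>C X (int i - 1 - (j + 1)) (m - int i))"
    by (subst sum.lessThan_Suc_shift) (simp add: algebra_simps)
  finally have X: "(\<Sum>i<Suc L. (g i * (- 1) ^ i) *\<^sub>C zw_mult X (int i - 1 - j) (m - int i)) = \<dots>" .
  have sg: "(- 1) powi (j - int (Suc i)) = - ((- 1) powi (j - int i) :: complex)" 
    "(- 1) powi (j + 1 - int (Suc i)) = ((- 1) powi (j - int i) :: complex)"
    "(- 1) powi (j + 1 - int i) = - ((- 1) powi (j - int i) :: complex)" for i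
    using power_int_add_1[of "-1::complex" "j - int (Suc i)"] power_int_add_1[of "-1::complex" "j - int i"]
    by (simp_all add: algebra_simps)
  have "(\<Sum>i<Suc L. (g i * (- 1) powi (j - int i)) *\<^sub>C zw_mult Y (- 1 - int i) (m - j + int i)) =
     (\<Sum>i<Suc L. (g i * (- 1) powi (j - int i)) *\<^sub>C Y (- 2 - int i) (m - j + int i)) -
     (\<Sum>i<Suc L. (g i * (- 1) powi (j - int i)) *\<^sub>C Y (- 1 - int i) (m - j + int i - 1))"
    by (simp add: zw_mult_def complex_vector.scale_right_diff_distrib sum_subtractf algebra_simps
        minus_diff_commute[of 2] del: sum.lessThan_Suc)
  also have "\<dots> = (\<Sum>i<L. (g i * (- 1) powi (j - int i)) *\<^sub>C Y (- 2 - int i) (m - j + int i)) -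
    ((- 1) powi j *\<^sub>C Y (- 1) (m - j - 1) +
     (\<Sum>i<L. (g (Suc i) * (- 1) powi (j - int (Suc i))) *\<^sub>C Y (- 2 - int i) (m - j + int i)))"
  proof -
    have "Y (- 2 - int L) (m - j + int L) = 0"
      by (rule M') (use L_def in linarith)
    then show ?thesis
      by (subst (2) sum.lessThan_Suc_shift, subst sum.lessThan_Suc)
        (simp add: g_def algebra_simps minus_diff_commute[of 2])
  qed
  also have "\<dots> = (- 1) powi (j + 1) *\<^sub>C Y (- 1) (m - j - 1) +
     (\<Sum>i<L. ((of_int (j + 1) gchoose Suc i) * (- 1) powi (j + 1 - int (Suc i))) *\<^sub>C Y (- 2 - int i) (m - j + int i))"
    unfolding bin sg
    by (simp add: sum.distrib sum_negf ring_distribs power_int_add_1 complex_vector.scale_left_distrib 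
        del: of_int_add of_nat_Suc)
  also have "\<dots> = (\<Sum>i<Suc L. ((of_int (j + 1) gchoose i) * (- 1) powi (j + 1 - int i)) *\<^sub>C Y (- 1 - int i) (m - (j + 1) + int i))"
    by (subst sum.lessThan_Suc_shift) (simp add: algebra_simps minus_diff_commute[of 2])
  finally show ?thesis
    unfolding 1 2 X by simp
qed

lemma res_pair_zw_mult_pow:
  assumes "bounded_right X" "bounded_left Y"
  shows "res_pair j ((zw_mult ^^ k) X) ((zw_mult ^^ k) Y) m = res_pair (j + int k) X Y m"
proof (induction k arbitrary: j)
  case (Suc k)
  then show ?case
    using res_pair_zw_mult[of "(zw_mult ^^ k) X" "(zw_mult ^^ k) Y" j m]
    by (simp add: bounded_right_zw_mult_pow bounded_left_zw_mult_pow assms add.assoc)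
qed simp

text \<open>The \<open>l\<close>-th divided derivative of \<open>P(z, w)\<close> in \<open>z\<close>, restricted to \<open>z = w\<close>.\<close>

definition diag_deriv :: "nat \<Rightarrow> (int \<Rightarrow> int \<Rightarrow> 'v::complex_superspace) \<Rightarrow> int \<Rightarrow> 'v" where
  "diag_deriv l P m = Sum_any (\<lambda>p::int. (of_int p gchoose l) *\<^sub>C P p (m + int l - p))"

lemma diag_deriv_interval:
  assumes "\<And>p q. p < A \<Longrightarrow> P p q = 0" "\<And>p q. q < B \<Longrightarrow> P p q = 0"
    and "A' \<le> A" "m + int l - B < B'"
  shows "diag_deriv l P m = (\<Sum>p\<in>{A'..<B'}. (of_int p gchoose l) *\<^sub>C P p (m + int l - p))"
  unfolding diag_deriv_def
proof (rule Sum_any_int_interval)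
  fix p assume "p \<notin> {A'..<B'}"
  then have "p < A \<or> m + int l - p < B"
    using assms(3,4) by auto
  then show "(of_int p gchoose l) *\<^sub>C P p (m + int l - p) = 0"
    using assms(1,2) by auto
qed

lemma gbinomial_negative:
  "((of_int (- 1 - int l) :: complex) gchoose i) * (- 1) ^ i = of_nat ((l + i) choose l)"
proof -
  have "((of_int (- 1 - int l) :: complex) gchoose i) = (-1) ^ i * ((of_nat (l + i)) gchoose i)"
    by (subst gbinomial_negated_upper) (simp add: algebra_simps)
  also have "((of_nat (l + i)) gchoose i :: complex) = of_nat ((l + i) choose l)"
    by (metis add_diff_cancel_right' binomial_gbinomial binomial_symmetric le_add2)
  finally show ?thesis
    by simp
qed

text \<open>For negative exponents, the two expansions of \<open>(z - w)\<close> to the power \<open>- 1 - l\<close> differ by the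
  \<open>l\<close>-th divided derivative of the delta function, so the residue is the restriction to the
  diagonal of a derivative.\<close>

lemma res_pair_diag_deriv:
  assumes "bounded_left P" "bounded_right P"
  shows "res_pair (- 1 - int l) P P m = diag_deriv l P m"
proof -
  obtain A where A: "\<And>p q. p < A \<Longrightarrow> P p q = 0"
    using assms(1) unfolding bounded_left_def by blast
  obtain B where B: "\<And>p q. q < B \<Longrightarrow> P p q = 0"
    using assms(2) unfolding bounded_right_def by blast
  define L where "L = max (nat (m - B + 1)) (nat (- A))"
  let ?f = "\<lambda>p. (of_int p gchoose l) *\<^sub>C P p (m + int l - p)"
  have 1: "(\<Sum>i<L. ((of_int (- 1 - int l) gchoose i) * (- 1) ^ i) *\<^sub>C P (int i - 1 - (- 1 - int l)) (m - int i))
    = sum ?f {int l..<int l + int L}"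
    unfolding gbinomial_negative
    by (rule sum.reindex_bij_witness[where i = "\<lambda>p. nat (p - int l)" and j = "\<lambda>i. int i + int l"])
      (auto simp: binomial_gbinomial algebra_simps)
  have c: "((of_int (- 1 - int l) gchoose i) * (- 1) powi (- 1 - int l - int i)) =
     - ((of_int (- 1 - int i) gchoose l) :: complex)" for i
  proof -
    have "(- 1) powi (- 1 - int l - int i) = ((- 1) powi (- int (Suc (l + i))) :: complex)"
      by (simp add: algebra_simps)
    also have "\<dots> = - ((-1) ^ i * (-1) ^ l)"
      by (simp add: power_int_minus power_add power_minus_mult flip: power_inverse del: of_nat_Suc)
    finally have "((of_int (- 1 - int l) gchoose i) * (- 1) powi (- 1 - int l - int i)) =
      - (((of_int (- 1 - int l) gchoose i) * (- 1) ^ i) * ((-1) ^ l) :: complex)"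
      by simp
    also have "\<dots> = - (of_nat ((l + i) choose l) * (-1) ^ l)"
      by (simp only: gbinomial_negative)
    also have "(of_nat ((l + i) choose l) :: complex) = (of_int (- 1 - int i) gchoose l) * (-1) ^ l"
      by (metis add.commute binomial_symmetric gbinomial_negative diff_add_inverse2 le_add1)
    finally show ?thesis
      by (simp add: mult.assoc flip: power_add mult_2)
  qed
  have 2: "(\<Sum>i<L. ((of_int (- 1 - int l) gchoose i) * (- 1) powi (- 1 - int l - int i)) *\<^sub>C
      P (- 1 - int i) (m - (- 1 - int l) + int i)) = - sum ?f {- int L..<0}"
    unfolding c
    by (simp only: complex_vector.scale_minus_left sum_negf neg_equal_iff_equal,
       rule sum.reindex_bij_witness[where i = "\<lambda>p. nat (- 1 - p)" and j = "\<lambda>i. - 1 - int i"])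
      (auto simp: algebra_simps)
  have 3: "sum ?f {0..<int l} = 0"
  proof (rule sum.neutral, rule ballI)
    fix p assume "p \<in> {0..<int l}"
    then obtain i where "p = int i" "i < l"
      by (metis atLeastLessThan_iff nonneg_int_cases of_nat_less_iff)
    then show "?f p = 0"
      by (simp add: binomial_gbinomial[symmetric])
  qed
  have "{- int L..<int l + int L} = {- int L..<0} \<union> {0..<int l} \<union> {int l..<int l + int L}"
    by auto
  then have 4: "sum ?f {- int L..<int l + int L} =
      sum ?f {- int L..<0} + sum ?f {0..<int l} + sum ?f {int l..<int l + int L}"
    by (simp only:) (subst sum.union_disjoint; (subst sum.union_disjoint)?; auto)
  have "diag_deriv l P m = sum ?f {- int L..<int l + int L}"
    by (rule diag_deriv_interval[OF A B]) (simp_all add: L_def, linarith+)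
  moreover have "res_pair (- 1 - int l) P P m = sum ?f {int l..<int l + int L} - (- sum ?f {- int L..<0})"
    unfolding 1[symmetric] 2[symmetric]
    by (intro res_pair_lessThan[of B P A P m L "- 1 - int l"] A B) (simp_all only: L_def max.cobounded1 max.cobounded2)
  ultimately show ?thesis
    using 3 4 by simp
qed

lemma finite_diagonal_support:
  assumes "bounded_left P" "bounded_right P"
  shows "finite {p. c p *\<^sub>C P p (k - p) \<noteq> 0}"
proof -
  obtain A where A: "\<And>p q. p < A \<Longrightarrow> P p q = 0"
    using assms(1) unfolding bounded_left_def by blast
  obtain B where B: "\<And>p q. q < B \<Longrightarrow> P p q = 0"
    using assms(2) unfolding bounded_right_def by blast
  have "{p. c p *\<^sub>C P p (k - p) \<noteq> 0} \<subseteq> {A..k - B}"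
  proof
    fix p assume "p \<in> {p. c p *\<^sub>C P p (k - p) \<noteq> 0}"
    then have "P p (k - p) \<noteq> 0"
      by auto
    then have "\<not> p < A" "\<not> k - p < B"
      using A B by blast+
    then show "p \<in> {A..k - B}"
      by simp
  qed
  then show ?thesis
    by (rule finite_subset) simp
qed

lemma bounded_shift:
  "bounded_left P \<Longrightarrow> bounded_left (\<lambda>p q. P (p + k) (q + k'))"
  "bounded_right P \<Longrightarrow> bounded_right (\<lambda>p q. P (p + k) (q + k'))"
proof -
  assume "bounded_left P"
  then obtain A where "\<And>p q. p < A \<Longrightarrow> P p q = 0"
    unfolding bounded_left_def by blast
  then have "\<forall>p q. p < A - k \<longrightarrow> P (p + k) (q + k') = 0"
    by simp
  then show "bounded_left (\<lambda>p q. P (p + k) (q + k'))"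
    unfolding bounded_left_def by blast
next
  assume "bounded_right P"
  then obtain A where "\<And>p q. q < A \<Longrightarrow> P p q = 0"
    unfolding bounded_right_def by blast
  then have "\<forall>p q. q < A - k' \<longrightarrow> P (p + k) (q + k') = 0"
    by simp
  then show "bounded_right (\<lambda>p q. P (p + k) (q + k'))"
    unfolding bounded_right_def by blast
qed

lemma diag_deriv_endo:
  assumes "bounded_left P" "bounded_right P" "endo f"
  shows "diag_deriv l (\<lambda>p q. f (P p q)) m = f (diag_deriv l P m)"
proof -
  have "bounded_left (\<lambda>p q. f (P p q))" "bounded_right (\<lambda>p q. f (P p q))"
    using assms unfolding bounded_right_def bounded_left_def by (metis endo_zero)+
  then show ?thesis
    using assms by (simp add: res_pair_diag_deriv[symmetric] res_pair_endo)
qed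

lemma endo_scale_fun: "endo (\<lambda>x. c *\<^sub>C x)"
  by (simp add: endoI complex_vector.scale_right_distrib complex_vector.scale_left_commute)

lemma diag_deriv_scale:
  assumes "bounded_left P" "bounded_right P"
  shows "diag_deriv l (\<lambda>p q. c *\<^sub>C P p q) m = c *\<^sub>C diag_deriv l P m"
  by (rule diag_deriv_endo[OF assms endo_scale_fun])

lemma diag_deriv_add:
  assumes "bounded_left P" "bounded_right P" "bounded_left Q" "bounded_right Q"
  shows "diag_deriv l (\<lambda>p q. P p q + Q p q) m = diag_deriv l P m + diag_deriv l Q m"
  unfolding diag_deriv_def complex_vector.scale_right_distrib
  by (rule Sum_any.distrib) (rule finite_diagonal_support, fact, fact)+

lemma bounded_endo:
  "bounded_left P \<Longrightarrow> endo f \<Longrightarrow> bounded_left (\<lambda>p q. f (P p q))"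
  "bounded_right P \<Longrightarrow> endo f \<Longrightarrow> bounded_right (\<lambda>p q. f (P p q))"
  unfolding bounded_right_def bounded_left_def by (metis endo_zero)+

lemma bounded_scale:
  "bounded_left P \<Longrightarrow> bounded_left (\<lambda>p q. c p q *\<^sub>C P p q)"
  "bounded_right P \<Longrightarrow> bounded_right (\<lambda>p q. c p q *\<^sub>C P p q)"
  unfolding bounded_right_def bounded_left_def by (metis complex_vector.scale_zero_right)+

lemma bounded_add_left:
  assumes "bounded_left P" "bounded_left Q"
  shows "bounded_left (\<lambda>p q. P p q + (Q p q :: 'v::ab_group_add))"
  using assms unfolding bounded_left_def by (metis add.right_neutral min_less_iff_conj)

lemma bounded_add_right:
  assumes "bounded_right P" "bounded_right Q"
  shows "bounded_right (\<lambda>p q. P p q + (Q p q :: 'v::ab_group_add))"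
  using assms unfolding bounded_right_def by (metis add.right_neutral min_less_iff_conj)

lemma bounded_diff_left:
  assumes "bounded_left P" "bounded_left Q"
  shows "bounded_left (\<lambda>p q. P p q - (Q p q :: 'v::ab_group_add))"
  using assms unfolding bounded_left_def by (metis diff_zero min_less_iff_conj)

lemma bounded_diff_right:
  assumes "bounded_right P" "bounded_right Q"
  shows "bounded_right (\<lambda>p q. P p q - (Q p q :: 'v::ab_group_add))"
  using assms unfolding bounded_right_def by (metis diff_zero min_less_iff_conj)

lemma diag_deriv_diff:
  assumes "bounded_left P" "bounded_right P" "bounded_left Q" "bounded_right Q"
  shows "diag_deriv l (\<lambda>p q. P p q - Q p q) m = diag_deriv l P m - diag_deriv l Q m"
  using diag_deriv_add[OF assms(1,2) bounded_scale(1)[OF assms(3), of "\<lambda>_ _. - 1"]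
      bounded_scale(2)[OF assms(4), of "\<lambda>_ _. - 1"], of l m] diag_deriv_scale[OF assms(3,4), of l "- 1" m]
  by simp

lemma diag_deriv_shift_right: "diag_deriv l (\<lambda>p q. P p (q - 1)) m = diag_deriv l P (m - 1)"
  unfolding diag_deriv_def by (simp add: algebra_simps)

lemma Sum_any_shift: "Sum_any (\<lambda>p::int. f (p + k)) = Sum_any f"
proof (rule Sum_any.reindex_cong[symmetric])
  show "bij (\<lambda>p::int. p + k)"
    by (rule bij_betw_byWitness[of _ "\<lambda>p. p - k"]) auto
qed auto

lemma diag_deriv_shift_left_0: "diag_deriv 0 (\<lambda>p q. P (p - 1) q) m = diag_deriv 0 P (m - 1)"
  unfolding diag_deriv_def
  by (subst Sum_any_shift[of _ 1, symmetric]) (simp add: algebra_simps)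

lemma diag_deriv_shift_left_Suc:
  assumes "bounded_left P" "bounded_right P"
  shows "diag_deriv (Suc l) (\<lambda>p q. P (p - 1) q) m = diag_deriv (Suc l) P (m - 1) + diag_deriv l P m"
proof -
  have "diag_deriv (Suc l) (\<lambda>p q. P (p - 1) q) m =
    Sum_any (\<lambda>p. (of_int (p + 1) gchoose Suc l) *\<^sub>C P p (m + int l - p))"
    unfolding diag_deriv_def
    by (subst Sum_any_shift[of _ 1, symmetric]) (simp add: algebra_simps)
  also have "\<dots> = Sum_any (\<lambda>p. (of_int p gchoose Suc l) *\<^sub>C P p (m + int l - p) +
      (of_int p gchoose l) *\<^sub>C P p (m + int l - p))"
    unfolding of_int_add of_int_1 gbinomial_Suc_Suc complex_vector.scale_left_distrib
    by (simp add: add.commute)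
  also have "\<dots> = diag_deriv (Suc l) P (m - 1) + diag_deriv l P m"
    unfolding diag_deriv_def
    by (subst Sum_any.distrib[OF finite_diagonal_support[OF assms] finite_diagonal_support[OF assms]]) simp
  finally show ?thesis .
qed

text \<open>The operator \<open>\<partial>\<^sub>z + \<partial>\<^sub>w\<close>.\<close>

definition total_deriv :: "(int \<Rightarrow> int \<Rightarrow> 'v::complex_superspace) \<Rightarrow> int \<Rightarrow> int \<Rightarrow> 'v" where
  "total_deriv X p q = of_int (p + 1) *\<^sub>C X (p + 1) q + of_int (q + 1) *\<^sub>C X p (q + 1)"

lemma zw_mult_total_deriv: "zw_mult (total_deriv X) = total_deriv (zw_mult X)"
  by (intro ext) (simp add: zw_mult_def total_deriv_def algebra_simps complex_vector.scale_left_distrib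
      complex_vector.scale_right_diff_distrib complex_vector.scale_left_diff_distrib)

lemma zw_mult_pow_total_deriv: "(zw_mult ^^ k) (total_deriv X) = total_deriv ((zw_mult ^^ k) X)"
  by (induction k) (simp_all add: zw_mult_total_deriv)

lemma diag_deriv_total_deriv:
  assumes "bounded_left P" "bounded_right P"
  shows "diag_deriv l (total_deriv P) m = of_int (m + 1) *\<^sub>C diag_deriv l P (m + 1)"
proof -
  let ?g = "\<lambda>p::int. (of_int p gchoose l :: complex)"
  let ?Q = "\<lambda>p. P p (m + 1 + int l - p)"
  have fin: "finite {p. c p *\<^sub>C ?Q p \<noteq> 0}" for c
    by (rule finite_diagonal_support[OF assms])
  have shift: "P (p + 1) (m + int l - p) = ?Q (p + 1)" for p
    by (simp add: algebra_simps)
  have fin': "finite {p. c p *\<^sub>C ?Q (p + 1) \<noteq> 0}" for c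
    using finite_vimageI[OF fin[of "\<lambda>p. c (p - 1)"], of "\<lambda>p. p + 1"] by (simp add: vimage_def)
  have "diag_deriv l (total_deriv P) m = Sum_any (\<lambda>p. (?g p * of_int (p + 1)) *\<^sub>C ?Q (p + 1) +
      (?g p * of_int (m + int l - p + 1)) *\<^sub>C ?Q p)"
    unfolding diag_deriv_def total_deriv_def shift complex_vector.scale_right_distrib complex_vector.scale_scale
    by (simp add: algebra_simps)
  also have "\<dots> = Sum_any (\<lambda>p. (?g p * of_int (p + 1)) *\<^sub>C ?Q (p + 1)) +
      Sum_any (\<lambda>p. (?g p * of_int (m + int l - p + 1)) *\<^sub>C ?Q p)"
    by (rule Sum_any.distrib[OF fin' fin])
  also have "Sum_any (\<lambda>p. (?g p * of_int (p + 1)) *\<^sub>C ?Q (p + 1)) =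
      Sum_any (\<lambda>p. (?g (p - 1) * of_int p) *\<^sub>C ?Q p)"
    by (subst (2) Sum_any_shift[of _ 1, symmetric]) simp
  also have "\<dots> + Sum_any (\<lambda>p. (?g p * of_int (m + int l - p + 1)) *\<^sub>C ?Q p) =
      Sum_any (\<lambda>p. (?g (p - 1) * of_int p) *\<^sub>C ?Q p + (?g p * of_int (m + int l - p + 1)) *\<^sub>C ?Q p)"
    by (rule Sum_any.distrib[OF fin fin, symmetric])
  also have "\<dots> = Sum_any (\<lambda>p. of_int (m + 1) *\<^sub>C (?g p *\<^sub>C ?Q p))"
  proof -
    have "?g (p - 1) * of_int p + ?g p * of_int (m + int l - p + 1) = of_int (m + 1) * ?g p" for p
      using gbinomial_absorb_comp[of "of_int p :: complex" l] by (simp add: algebra_simps)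
    then show ?thesis
      by (simp only: complex_vector.scale_left_distrib[symmetric] complex_vector.scale_scale)
  qed
  also have "\<dots> = of_int (m + 1) *\<^sub>C diag_deriv l P (m + 1)"
    unfolding diag_deriv_def by (rule Sum_any_scale)
  finally show ?thesis .
qed

definition zw_mult12 :: "(int \<Rightarrow> int \<Rightarrow> int \<Rightarrow> 'v::ab_group_add) \<Rightarrow> int \<Rightarrow> int \<Rightarrow> int \<Rightarrow> 'v" where
  "zw_mult12 G p q s = G (p - 1) q s - G p (q - 1) s"

definition zw_mult13 :: "(int \<Rightarrow> int \<Rightarrow> int \<Rightarrow> 'v::ab_group_add) \<Rightarrow> int \<Rightarrow> int \<Rightarrow> int \<Rightarrow> 'v" where
  "zw_mult13 G p q s = G (p - 1) q s - G p q (s - 1)"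

definition zw_mult23 :: "(int \<Rightarrow> int \<Rightarrow> int \<Rightarrow> 'v::ab_group_add) \<Rightarrow> int \<Rightarrow> int \<Rightarrow> int \<Rightarrow> 'v" where
  "zw_mult23 G p q s = G p (q - 1) s - G p q (s - 1)"

lemma zw_mult12_pow: "(zw_mult12 ^^ k) G p q s = (zw_mult ^^ k) (\<lambda>p q. G p q s) p q"
  by (induction k arbitrary: p q) (simp_all add: zw_mult12_def zw_mult_def)

lemma zw_mult13_pow: "(zw_mult13 ^^ k) G p q s = (zw_mult ^^ k) (\<lambda>p s. G p q s) p s"
  by (induction k arbitrary: p s) (simp_all add: zw_mult13_def zw_mult_def)

lemma zw_mult23_pow: "(zw_mult23 ^^ k) G p q s = (zw_mult ^^ k) (\<lambda>q s. G p q s) q s"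
  by (induction k arbitrary: q s) (simp_all add: zw_mult23_def zw_mult_def)

lemma funpow_commuting:
  assumes "\<And>x. f (g x) = g (f x)"
  shows "(f ^^ m) ((g ^^ n) x) = (g ^^ n) ((f ^^ m) x)"
proof -
  have "f ((g ^^ n) x) = (g ^^ n) (f x)" for x
    by (induction n) (simp_all add: assms)
  then show ?thesis
    by (induction m) simp_all
qed

lemma zw_mult_commute:
  "zw_mult13 (zw_mult12 G) = zw_mult12 (zw_mult13 G)" "zw_mult23 (zw_mult12 G) = zw_mult12 (zw_mult23 G)"
  "zw_mult13 (zw_mult23 G) = zw_mult23 (zw_mult13 G)"
  by (intro ext; simp add: zw_mult12_def zw_mult13_def zw_mult23_def)+

definition bounded3 :: "(int \<Rightarrow> int \<Rightarrow> int \<Rightarrow> 'v::zero) \<Rightarrow> bool" where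
  "bounded3 G \<longleftrightarrow> (\<forall>s. bounded_left (\<lambda>p q. G p q s) \<and> bounded_right (\<lambda>p q. G p q s))"

lemma bounded_minus_one:
  "bounded_left P \<Longrightarrow> bounded_left (\<lambda>p q. P (p - 1) q)"
  "bounded_right P \<Longrightarrow> bounded_right (\<lambda>p q. P (p - 1) q)"
  "bounded_left P \<Longrightarrow> bounded_left (\<lambda>p q. P p (q - 1))"
  "bounded_right P \<Longrightarrow> bounded_right (\<lambda>p q. P p (q - 1))"
  using bounded_shift[of P "- 1" 0] bounded_shift[of P 0 "- 1"] by simp_all

lemma bounded3_zw_mult13: "bounded3 G \<Longrightarrow> bounded3 (zw_mult13 G)"
  unfolding bounded3_def zw_mult13_def
  by (intro allI conjI bounded_diff_left bounded_diff_right bounded_minus_one) simp_all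

lemma bounded3_zw_mult23: "bounded3 G \<Longrightarrow> bounded3 (zw_mult23 G)"
  unfolding bounded3_def zw_mult23_def
  by (intro allI conjI bounded_diff_left bounded_diff_right bounded_minus_one) simp_all

lemma bounded3_zw_mult23_pow: "bounded3 G \<Longrightarrow> bounded3 ((zw_mult23 ^^ k) G)"
  by (induction k) (simp_all add: bounded3_zw_mult23)

lemma bounded3_slices:
  assumes "bounded3 G"
  shows "bounded_left (\<lambda>p q. G p q s)" "bounded_right (\<lambda>p q. G p q s)"
    "bounded_left (\<lambda>p q. G (p - 1) q s)" "bounded_right (\<lambda>p q. G (p - 1) q s)"
    "bounded_left (\<lambda>p q. G p (q - 1) s)" "bounded_right (\<lambda>p q. G p (q - 1) s)"
  using assms bounded_minus_one[of "\<lambda>p q. G p q s"] unfolding bounded3_def by blast+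

definition diag_deriv3 :: "nat \<Rightarrow> (int \<Rightarrow> int \<Rightarrow> int \<Rightarrow> 'v::complex_superspace) \<Rightarrow> int \<Rightarrow> int \<Rightarrow> 'v" where
  "diag_deriv3 l G m s = diag_deriv l (\<lambda>p q. G p q s) m"

lemma diag_deriv3_zw_mult23: "bounded3 G \<Longrightarrow> diag_deriv3 l (zw_mult23 G) = zw_mult (diag_deriv3 l G)"
  by (intro ext) (simp add: diag_deriv3_def zw_mult23_def zw_mult_def diag_deriv_diff bounded3_slices
      diag_deriv_shift_right[of l "\<lambda>p q. G p q _"])

lemma diag_deriv3_zw_mult23_pow: "bounded3 G \<Longrightarrow> diag_deriv3 l ((zw_mult23 ^^ k) G) = (zw_mult ^^ k) (diag_deriv3 l G)"
  by (induction k) (simp_all add: diag_deriv3_zw_mult23 bounded3_zw_mult23_pow)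

lemma diag_deriv3_zw_mult13_0: "bounded3 G \<Longrightarrow> diag_deriv3 0 (zw_mult13 G) = zw_mult (diag_deriv3 0 G)"
  by (intro ext) (simp add: diag_deriv3_def zw_mult13_def zw_mult_def diag_deriv_diff bounded3_slices
      diag_deriv_shift_left_0[of "\<lambda>p q. G p q _"])

lemma diag_deriv3_zw_mult13_Suc:
  "bounded3 G \<Longrightarrow> zw_mult (diag_deriv3 (Suc l) G) = (\<lambda>m s. diag_deriv3 (Suc l) (zw_mult13 G) m s - diag_deriv3 l G m s)"
  by (intro ext) (simp add: diag_deriv3_def zw_mult13_def zw_mult_def diag_deriv_diff bounded3_slices
      diag_deriv_shift_left_Suc[of "\<lambda>p q. G p q _"])

text \<open>The core of Dong's lemma: every derivative in \<open>z\<close> costs one more factor \<open>z - x\<close>, which becomes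
  \<open>w - x\<close> after the restriction to \<open>z = w\<close>.\<close>

lemma zw_mult_pow_diag_deriv3:
  assumes "bounded3 G" "(zw_mult13 ^^ r) G = (\<lambda>_ _ _. 0)"
  shows "(zw_mult ^^ (r + l)) (diag_deriv3 l G) = (\<lambda>_ _. 0)"
  using assms
proof (induction r arbitrary: l G)
  case 0
  then have "diag_deriv3 l G = (\<lambda>_ _. 0)"
    by (intro ext) (simp add: diag_deriv3_def diag_deriv_def)
  then show ?case
    by (intro ext) (simp add: zw_mult_pow_zero)
next
  case (Suc r)
  have IH: "(zw_mult ^^ (r + l)) (diag_deriv3 l (zw_mult13 G)) = (\<lambda>_ _. 0)" for l
    by (rule Suc.IH) (use Suc.prems in \<open>simp_all add: bounded3_zw_mult13 funpow_swap1\<close>)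
  show ?case
  proof (induction l)
    case 0
    then show ?case
      using IH[of 0] by (simp add: funpow_swap1 diag_deriv3_zw_mult13_0 Suc.prems(1))
  next
    case (Suc l)
    have "(zw_mult ^^ (Suc r + Suc l)) (diag_deriv3 (Suc l) G) = (zw_mult ^^ (r + Suc l)) (zw_mult (diag_deriv3 (Suc l) G))"
      by (simp add: funpow_swap1)
    also have "\<dots> = (\<lambda>_ _. 0)"
      unfolding diag_deriv3_zw_mult13_Suc[OF \<open>bounded3 G\<close>]
      using IH[of "Suc l"] Suc.IH
      by (intro ext) (simp only: zw_mult_pow_diff add_Suc add_Suc_right diff_self)
    finally show ?case .
  qed
qed

section \<open>Products of fields in one even variable\<close>

definition even_field :: "(int \<Rightarrow> 'v \<Rightarrow> 'v::complex_superspace) \<Rightarrow> bool" where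
  "even_field a \<longleftrightarrow> (\<forall>n. endo (a n)) \<and> (\<forall>v. \<exists>M. \<forall>n<M. a n v = 0)"

text \<open>\<open>(z - w)\<^sup>r (a(z) b(w) - e b(w) a(z)) = 0\<close>, where \<open>e\<close> is the sign of the supercommutator.\<close>

definition local_order :: "nat \<Rightarrow> complex \<Rightarrow> (int \<Rightarrow> 'v \<Rightarrow> 'v) \<Rightarrow> (int \<Rightarrow> 'v \<Rightarrow> 'v::complex_superspace) \<Rightarrow> bool" where
  "local_order r e a b \<longleftrightarrow> (\<forall>v. (zw_mult ^^ r) (\<lambda>p q. a p (b q v) - e *\<^sub>C b q (a p v)) = (\<lambda>_ _. 0))"

definition nth_prod ::
  "complex \<Rightarrow> int \<Rightarrow> (int \<Rightarrow> 'v \<Rightarrow> 'v) \<Rightarrow> (int \<Rightarrow> 'v \<Rightarrow> 'v::complex_superspace) \<Rightarrow> int \<Rightarrow> 'v \<Rightarrow> 'v" where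
  "nth_prod e j a b m v = res_pair j (\<lambda>p q. a p (b q v)) (\<lambda>p q. e *\<^sub>C b q (a p v)) m"

lemma even_field_bounded:
  assumes "even_field a" "even_field b"
  shows "bounded_right (\<lambda>p q. a p (b q v))" "bounded_left (\<lambda>p q. b q (a p v))"
    "bounded_left (\<lambda>p q. e *\<^sub>C b q (a p v))"
proof -
  obtain M where "\<forall>n<M. b n v = 0"
    using assms(2) unfolding even_field_def by blast
  moreover have "a p 0 = 0" for p
    using assms(1) endo_zero unfolding even_field_def by blast
  ultimately show "bounded_right (\<lambda>p q. a p (b q v))"
    unfolding bounded_right_def by (intro exI[of _ M]) simp
  obtain M where "\<forall>n<M. a n v = 0"
    using assms(1) unfolding even_field_def by blast
  moreover have "b p 0 = 0" for p
    using assms(2) endo_zero unfolding even_field_def by blast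
  ultimately show "bounded_left (\<lambda>p q. b q (a p v))" "bounded_left (\<lambda>p q. e *\<^sub>C b q (a p v))"
    unfolding bounded_left_def by (intro exI[of _ M]; simp)+
qed

lemma local_order_swap:
  "local_order r e a b \<Longrightarrow> (zw_mult ^^ r) (\<lambda>p q. e *\<^sub>C b q (a p v)) = (zw_mult ^^ r) (\<lambda>p q. a p (b q v))"
  unfolding local_order_def fun_eq_iff by (simp add: zw_mult_pow_diff)

lemma local_order_product_bounded:
  assumes "even_field a" "even_field b" "local_order r e a b"
  shows "bounded_left ((zw_mult ^^ r) (\<lambda>p q. a p (b q v)))" "bounded_right ((zw_mult ^^ r) (\<lambda>p q. a p (b q v)))"
  using bounded_left_zw_mult_pow[OF even_field_bounded(3)[OF assms(1,2)], of r e v]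
    bounded_right_zw_mult_pow[OF even_field_bounded(1)[OF assms(1,2)]]
  unfolding local_order_swap[OF assms(3)] by blast+

lemma nth_prod_diag_deriv:
  assumes "even_field a" "even_field b" "local_order r e a b" "j < int r"
  shows "nth_prod e j a b m v = diag_deriv (nat (int r - 1 - j)) ((zw_mult ^^ r) (\<lambda>p q. a p (b q v))) m"
proof -
  define l where "l = nat (int r - 1 - j)"
  have j: "j = (- 1 - int l) + int r"
    using assms(4) by (simp add: l_def)
  have "nth_prod e j a b m v =
    res_pair (- 1 - int l) ((zw_mult ^^ r) (\<lambda>p q. a p (b q v))) ((zw_mult ^^ r) (\<lambda>p q. e *\<^sub>C b q (a p v))) m"
    unfolding nth_prod_def j
    by (rule res_pair_zw_mult_pow[symmetric]) (rule even_field_bounded[OF assms(1,2)])+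
  then show ?thesis
    unfolding local_order_swap[OF assms(3)] l_def[symmetric]
    by (simp add: res_pair_diag_deriv local_order_product_bounded[OF assms(1,2,3)])
qed

lemma local_order_mono:
  assumes "local_order r e a b" "r \<le> r'"
  shows "local_order r' e a b"
proof -
  have "(zw_mult ^^ r') X = (zw_mult ^^ (r' - r)) ((zw_mult ^^ r) X)" for X :: "int \<Rightarrow> int \<Rightarrow> 'a"
    using assms(2) by (metis comp_apply funpow_add le_add_diff_inverse2)
  moreover have "(zw_mult ^^ (r' - r)) (\<lambda>_ _. 0 :: 'a) = (\<lambda>_ _. 0)"
    by (intro ext) (rule zw_mult_pow_zero)
  ultimately show ?thesis
    using assms(1) unfolding local_order_def by simp
qed

lemma local_order_sym:
  assumes "local_order r e a b" "e * e = 1"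
  shows "local_order r e b a"
  unfolding local_order_def
proof (intro allI ext)
  fix v p q
  let ?X = "\<lambda>p q. a p (b q v) - e *\<^sub>C b q (a p v)"
  have "(\<lambda>p q. b p (a q v) - e *\<^sub>C a q (b p v)) = (\<lambda>p q. (- e) *\<^sub>C ?X q p)"
    using assms(2) by (intro ext) (simp add: complex_vector.scale_right_diff_distrib)
  moreover have "(zw_mult ^^ r) (\<lambda>p q. (- e) *\<^sub>C ?X q p) p q = (- e) *\<^sub>C (- 1) ^ r *\<^sub>C (zw_mult ^^ r) ?X q p"
    by (subst zw_mult_pow_scale, subst zw_mult_pow_flip) simp
  ultimately show "(zw_mult ^^ r) (\<lambda>p q. b p (a q v) - e *\<^sub>C a q (b p v)) p q = 0"
    using assms(1) unfolding local_order_def by simp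
qed

lemma local_order_sum:
  assumes "\<And>i. i \<in> I \<Longrightarrow> local_order r e (a i) b" "\<And>n. endo (b n)"
  shows "local_order r e (\<lambda>n v. \<Sum>i\<in>I. c i *\<^sub>C a i n v) b"
  unfolding local_order_def
proof (intro allI ext)
  fix v p q
  let ?X = "\<lambda>i p q. a i p (b q v) - e *\<^sub>C b q (a i p v)"
  have "(\<lambda>p q. (\<Sum>i\<in>I. c i *\<^sub>C a i p (b q v)) - e *\<^sub>C b q (\<Sum>i\<in>I. c i *\<^sub>C a i p v)) =
    (\<lambda>p q. \<Sum>i\<in>I. c i *\<^sub>C ?X i p q)"
    using assms(2)
    by (intro ext) (simp add: endo_sum endo_scale complex_vector.scale_sum_right sum_subtractf
        complex_vector.scale_right_diff_distrib mult.commute)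
  moreover have "(zw_mult ^^ r) (\<lambda>p q. \<Sum>i\<in>I. c i *\<^sub>C ?X i p q) p q = 0"
    using assms(1) unfolding local_order_def by (simp add: zw_mult_pow_sum zw_mult_pow_scale)
  ultimately show "(zw_mult ^^ r) (\<lambda>p q. (\<Sum>i\<in>I. c i *\<^sub>C a i p (b q v)) - e *\<^sub>C b q (\<Sum>i\<in>I. c i *\<^sub>C a i p v)) p q = 0"
    by simp
qed

lemma local_order_zero:
  assumes "\<And>n. endo (b n)"
  shows "local_order r e (\<lambda>n v. 0) b" "local_order r e b (\<lambda>n v. 0)"
  using assms unfolding local_order_def by (simp_all add: fun_eq_iff zw_mult_pow_zero endo_zero)

lemma nth_prod_endo:
  assumes "even_field a" "even_field b"
  shows "endo (nth_prod e j a b m)"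
proof (rule endoI)
  have lin: "endo (a p)" "endo (b p)" for p
    using assms unfolding even_field_def by blast+
  fix x y c
  have "nth_prod e j a b m (x + y) = res_pair j (\<lambda>p q. a p (b q x) + a p (b q y))
     (\<lambda>p q. e *\<^sub>C b q (a p x) + e *\<^sub>C b q (a p y)) m"
    unfolding nth_prod_def by (simp add: lin endo_add complex_vector.scale_right_distrib)
  also have "\<dots> = nth_prod e j a b m x + nth_prod e j a b m y"
    unfolding nth_prod_def by (rule res_pair_add) (rule even_field_bounded[OF assms])+
  finally show "nth_prod e j a b m (x + y) = nth_prod e j a b m x + nth_prod e j a b m y" .
  have "nth_prod e j a b m (c *\<^sub>C x) = res_pair j (\<lambda>p q. c *\<^sub>C a p (b q x))
     (\<lambda>p q. c *\<^sub>C e *\<^sub>C b q (a p x)) m"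
    unfolding nth_prod_def by (simp add: lin endo_scale mult.commute)
  also have "\<dots> = c *\<^sub>C nth_prod e j a b m x"
    unfolding nth_prod_def by (rule res_pair_scale)
  finally show "nth_prod e j a b m (c *\<^sub>C x) = c *\<^sub>C nth_prod e j a b m x" .
qed

lemma nth_prod_even_field:
  assumes "even_field a" "even_field b" "local_order r e a b"
  shows "even_field (nth_prod e j a b)"
  unfolding even_field_def
proof (intro conjI allI nth_prod_endo assms)
  fix v
  define r' where "r' = max r (nat (j + 1))"
  have local_order: "local_order r' e a b"
    by (rule local_order_mono[OF assms(3)]) (simp add: r'_def)
  have j: "j < int r'"
    by (use r'_def in linarith)
  let ?P = "(zw_mult ^^ r') (\<lambda>p q. a p (b q v))" and ?l = "nat (int r' - 1 - j)"
  obtain A where A: "\<And>p q. p < A \<Longrightarrow> ?P p q = 0"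
    using local_order_product_bounded(1)[OF assms(1,2) local_order, of v] unfolding bounded_left_def by blast
  obtain B where B: "\<And>p q. q < B \<Longrightarrow> ?P p q = 0"
    using local_order_product_bounded(2)[OF assms(1,2) local_order, of v] unfolding bounded_right_def by blast
  have "nth_prod e j a b m v = 0" if "m < A + B - int ?l" for m
  proof -
    have "?P p (m + int ?l - p) = 0" for p
      by (cases "p < A") (use A B that in auto)
    then show ?thesis
      by (simp add: nth_prod_diag_deriv[OF assms(1,2) local_order j] diag_deriv_def)
  qed
  then show "\<exists>M. \<forall>n<M. nth_prod e j a b n v = 0"
    by blast
qed

lemma nth_prod_vacuum:
  assumes "even_field a" "even_field b" "\<And>n. n < 0 \<Longrightarrow> a n vac = 0" "\<And>n. n < 0 \<Longrightarrow> b n vac = 0"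
  shows "nth_prod e j a b 0 vac = a (- 1 - j) (b 0 vac)"
proof -
  have z: "a p 0 = 0" "b p 0 = 0" for p
    using assms(1,2) endo_zero unfolding even_field_def by blast+
  show ?thesis
    unfolding nth_prod_def
    by (subst res_pair_lessThan[where M = 0 and M' = 0 and L = 1]) (simp_all add: assms(3,4) z)
qed

text \<open>The fields \<open>a'\<close> and \<open>b'\<close> are the supercommutators of \<open>D\<close> with \<open>a\<close> and \<open>b\<close>; the scalars \<open>sa\<close> and
  \<open>sb\<close> are the signs for moving \<open>D\<close> past these fields.\<close>

lemma nth_prod_leibniz:
  assumes "endo D" "even_field a" "even_field b" "even_field a'" "even_field b'" "sa * sa = 1"
    and a: "\<And>n v. D (a n v) = sa *\<^sub>C a n (D v) + a' n v"
    and b: "\<And>n v. D (b n v) = sb *\<^sub>C b n (D v) + b' n v"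
  shows "D (nth_prod e j a b m v) = (sa * sb) *\<^sub>C nth_prod e j a b m (D v) +
    (nth_prod (e * sb) j a' b m v + sa *\<^sub>C nth_prod (e * sa) j a b' m v)"
proof -
  have lin: "endo (a p)" "endo (b p)" for p
    using assms unfolding even_field_def by blast+
  have sa: "sa *\<^sub>C (e * sa) *\<^sub>C x = e *\<^sub>C x" for x
    using assms(6) by (simp add: mult.left_commute)
  have "D (nth_prod e j a b m v) = res_pair j (\<lambda>p q. D (a p (b q v))) (\<lambda>p q. D (e *\<^sub>C b q (a p v))) m"
    unfolding nth_prod_def by (rule res_pair_endo) (intro even_field_bounded assms)+
  also have "\<dots> = res_pair j
      (\<lambda>p q. (sa * sb) *\<^sub>C a p (b q (D v)) + (a' p (b q v) + sa *\<^sub>C a p (b' q v)))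
      (\<lambda>p q. (sa * sb) *\<^sub>C e *\<^sub>C b q (a p (D v)) +
        ((e * sb) *\<^sub>C b q (a' p v) + sa *\<^sub>C (e * sa) *\<^sub>C b' q (a p v))) m"
    unfolding sa using \<open>endo D\<close>
    by (simp add: a b lin endo_simps complex_vector.scale_right_distrib ac_simps)
  also have "\<dots> = (sa * sb) *\<^sub>C nth_prod e j a b m (D v) +
    (nth_prod (e * sb) j a' b m v + sa *\<^sub>C nth_prod (e * sa) j a b' m v)"
  proof -
    note bd = even_field_bounded[OF assms(2,3)] even_field_bounded[OF assms(4,3)] even_field_bounded[OF assms(2,5)]
    show ?thesis
      unfolding nth_prod_def
      by (intro res_pair_add[THEN trans] arg_cong2[of _ _ _ _ "(+)"] res_pair_scale refl
          bounded_scale bounded_add_left bounded_add_right bd)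
  qed
  finally show ?thesis .
qed

lemma nth_prod_translation:
  assumes "endo T" "even_field a" "even_field b" "local_order r e a b"
    and a: "\<And>n v. T (a n v) - a n (T v) = of_int (n + 1) *\<^sub>C a (n + 1) v"
    and b: "\<And>n v. T (b n v) - b n (T v) = of_int (n + 1) *\<^sub>C b (n + 1) v"
  shows "T (nth_prod e j a b m v) - nth_prod e j a b m (T v) = of_int (m + 1) *\<^sub>C nth_prod e j a b (m + 1) v"
proof -
  have lin: "endo (a p)" "endo (b p)" for p
    using assms unfolding even_field_def by blast+
  define r' where "r' = max r (nat (j + 1))"
  have local_order: "local_order r' e a b"
    by (rule local_order_mono[OF assms(4)]) (simp add: r'_def)
  have j: "j < int r'"
    by (use r'_def in linarith)
  let ?X = "\<lambda>v p q. a p (b q v)"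
  let ?P = "\<lambda>v. (zw_mult ^^ r') (?X v)" and ?l = "nat (int r' - 1 - j)"
  have bd: "bounded_left (?P v)" "bounded_right (?P v)" for v
    by (rule local_order_product_bounded[OF assms(2,3) local_order])+
  have "(\<lambda>p q. T (?X v p q) - ?X (T v) p q) = total_deriv (?X v)"
  proof (intro ext)
    fix p q
    have "T (?X v p q) = a p (T (b q v)) + of_int (p + 1) *\<^sub>C a (p + 1) (b q v)"
      using a[of p "b q v"] by (simp add: algebra_simps)
    moreover have "T (b q v) = b q (T v) + of_int (q + 1) *\<^sub>C b (q + 1) v"
      using b[of q v] by (simp add: algebra_simps)
    ultimately show "T (?X v p q) - ?X (T v) p q = total_deriv (?X v) p q"
      by (simp add: total_deriv_def lin endo_simps)
  qed
  moreover have "(zw_mult ^^ r') (\<lambda>p q. T (?X v p q) - ?X (T v) p q) = (\<lambda>p q. T (?P v p q) - ?P (T v) p q)"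
    by (intro ext) (simp add: zw_mult_pow_diff zw_mult_pow_endo[OF \<open>endo T\<close>])
  ultimately have "(\<lambda>p q. T (?P v p q) - ?P (T v) p q) = total_deriv (?P v)"
    by (simp add: zw_mult_pow_total_deriv)
  then have "diag_deriv ?l (\<lambda>p q. T (?P v p q) - ?P (T v) p q) m = of_int (m + 1) *\<^sub>C diag_deriv ?l (?P v) (m + 1)"
    by (simp add: diag_deriv_total_deriv bd)
  then show ?thesis
    by (simp add: nth_prod_diag_deriv[OF assms(2,3) local_order j] diag_deriv_diff diag_deriv_endo[OF bd \<open>endo T\<close>] bd
        bounded_endo[OF _ \<open>endo T\<close>])
qed

lemma dong:
  assumes "even_field a" "even_field b" "even_field c" "local_order r e1 a b" "local_order r e2 a c" "local_order r e3 b c" "j < int r"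
  shows "local_order (r + nat (int r - 1 - j) + r) (e2 * e3) (nth_prod e1 j a b) c"
  unfolding local_order_def
proof (intro allI)
  fix v
  have lin: "endo (a p)" "endo (b p)" "endo (c p)" for p
    using assms unfolding even_field_def by blast+
  define l where "l = nat (int r - 1 - j)"
  let ?P = "\<lambda>v. (zw_mult ^^ r) (\<lambda>p q. a p (b q v))"
  have bd: "bounded_left (?P v)" "bounded_right (?P v)" for v
    by (rule local_order_product_bounded[OF assms(1,2,4)])+
  define A where "A p q s = a p (b q (c s v) - e3 *\<^sub>C c s (b q v))" for p q s
  define B where "B p q s = e3 *\<^sub>C (a p (c s (b q v)) - e2 *\<^sub>C c s (a p (b q v)))" for p q s
  define g where "g p q s = A p q s + B p q s" for p q s
  define G where "G = (zw_mult12 ^^ r) g"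
  have g: "g p q s = a p (b q (c s v)) - (e2 * e3) *\<^sub>C c s (a p (b q v))" for p q s
    by (simp add: g_def A_def B_def lin endo_simps complex_vector.scale_right_diff_distrib mult.commute)
  have G: "G p q s = ?P (c s v) p q - (e2 * e3) *\<^sub>C c s (?P v p q)" for p q s
    unfolding G_def zw_mult12_pow g by (simp add: zw_mult_pow_diff zw_mult_pow_scale zw_mult_pow_endo[OF lin(3)])
  have A0: "(zw_mult23 ^^ r) A = (\<lambda>_ _ _. 0)"
  proof (intro ext)
    fix p q s
    show "(zw_mult23 ^^ r) A p q s = 0"
      using assms(6) unfolding zw_mult23_pow A_def local_order_def
      by (simp add: zw_mult_pow_endo[OF lin(1)] lin endo_zero)
  qed
  have B0: "(zw_mult13 ^^ r) B = (\<lambda>_ _ _. 0)"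
  proof (intro ext)
    fix p q s
    show "(zw_mult13 ^^ r) B p q s = 0"
      using assms(5) unfolding zw_mult13_pow B_def local_order_def by (simp add: zw_mult_pow_scale)
  qed
  have zero: "(zw_mult13 ^^ r) (\<lambda>_ _ _. 0 :: 'a) = (\<lambda>_ _ _. 0)" "(zw_mult23 ^^ r) (\<lambda>_ _ _. 0 :: 'a) = (\<lambda>_ _ _. 0)"
    "(zw_mult12 ^^ r) (\<lambda>_ _ _. 0 :: 'a) = (\<lambda>_ _ _. 0)"
    by (intro ext; simp add: zw_mult13_pow zw_mult23_pow zw_mult12_pow zw_mult_pow_zero)+
  have "(zw_mult23 ^^ r) g = (zw_mult23 ^^ r) B"
    using A0 unfolding g_def by (intro ext) (simp add: zw_mult23_pow zw_mult_pow_add fun_eq_iff)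
  then have "(zw_mult13 ^^ r) ((zw_mult23 ^^ r) g) = (\<lambda>_ _ _. 0)"
    by (simp only: funpow_commuting[of zw_mult13 zw_mult23, OF zw_mult_commute(3)] B0 zero)
  then have *: "(zw_mult13 ^^ r) ((zw_mult23 ^^ r) G) = (\<lambda>_ _ _. 0)"
    unfolding G_def
    by (simp only: funpow_commuting[of zw_mult13 zw_mult12, OF zw_mult_commute(1)]
        funpow_commuting[of zw_mult23 zw_mult12, OF zw_mult_commute(2)] zero)
  have bG: "bounded3 G"
    unfolding bounded3_def G
    by (intro allI conjI bounded_diff_left bounded_diff_right bounded_scale bd
        bounded_endo(1)[OF bd(1) lin(3)] bounded_endo(2)[OF bd(2) lin(3)])
  have "(zw_mult ^^ (r + l)) (diag_deriv3 l ((zw_mult23 ^^ r) G)) = (\<lambda>_ _. 0)"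
    by (rule zw_mult_pow_diag_deriv3[OF bounded3_zw_mult23_pow[OF bG] *])
  then have "(zw_mult ^^ (r + l + r)) (diag_deriv3 l G) = (\<lambda>_ _. 0)"
    unfolding diag_deriv3_zw_mult23_pow[OF bG] funpow_add[of "r + l" r] comp_apply .
  moreover have "diag_deriv3 l G = (\<lambda>m s. nth_prod e1 j a b m (c s v) - (e2 * e3) *\<^sub>C c s (nth_prod e1 j a b m v))"
    unfolding diag_deriv3_def G nth_prod_diag_deriv[OF assms(1,2,4,7)] l_def[symmetric]
    by (intro ext) (simp add: diag_deriv_diff diag_deriv_scale diag_deriv_endo[OF bd lin(3)] bd bounded_scale
        bounded_endo[OF _ lin(3)])
  ultimately show "(zw_mult ^^ (r + nat (int r - 1 - j) + r))
      (\<lambda>m s. nth_prod e1 j a b m (c s v) - (e2 * e3) *\<^sub>C c s (nth_prod e1 j a b m v)) = (\<lambda>_ _. 0)"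
    by (simp add: l_def)
qed

section \<open>Signs\<close>

\<comment> \<open>These rules turn bit arithmetic into Boolean formulas, which would defeat ring normalization.\<close>
declare add_bit_eq_xor [simp del] mult_bit_eq_and [simp del]

lemma koszul_simps [simp]: "koszul 0 = 1" "koszul 1 = - 1"
  by (simp_all add: koszul_def)

lemma koszul_add: "koszul (x + y) = koszul x * koszul y"
  by (cases x; cases y) simp_all

lemma koszul_square [simp]: "koszul x * koszul x = 1"
  by (cases x) simp_all

lemma minus_one_power_koszul: "(- 1) ^ n = koszul (of_nat n)"
  by (induction n) (simp_all add: koszul_add)

lemma bit_add_self_left: "x + (x + y) = (y :: bit)"
  by (cases x; cases y) simp_all

lemma bit_add_self: "x + x = (0 :: bit)"
  by (cases x) simp_all

lemmas bit_simps = bit_add_self bit_add_self_left distrib_left distrib_right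
  add.assoc add.commute add.left_commute mult.assoc mult.commute mult.left_commute

definition inversions :: "nat set \<Rightarrow> nat set \<Rightarrow> bit" where
  "inversions I K = of_nat (card {(i, k). i \<in> I \<and> k \<in> K \<and> k < i})"

lemma eps_inversions: "eps I K = (if I \<inter> K = {} then koszul (inversions I K) else 0)"
  by (simp add: eps_def inversions_def minus_one_power_koszul)

lemma inversions_empty [simp]: "inversions {} K = 0" "inversions I {} = 0"
  by (simp_all add: inversions_def)

lemma finite_inversions: "finite I \<Longrightarrow> finite K \<Longrightarrow> finite {(i, k). i \<in> I \<and> k \<in> K \<and> k < (i::nat)}"
  by (rule finite_subset[of _ "I \<times> K"]) auto

lemma inversions_union_left:
  assumes "finite I" "finite I'" "finite K" "I \<inter> I' = {}"
  shows "inversions (I \<union> I') K = inversions I K + inversions I' K"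
proof -
  have "{(i, k). i \<in> I \<union> I' \<and> k \<in> K \<and> k < i} =
    {(i, k). i \<in> I \<and> k \<in> K \<and> k < i} \<union> {(i, k). i \<in> I' \<and> k \<in> K \<and> k < i}"
    by auto
  then show ?thesis
    unfolding inversions_def using assms
    by (simp only:) (subst card_Un_disjoint, auto intro!: finite_inversions)
qed

lemma inversions_union_right:
  assumes "finite I" "finite K" "finite K'" "K \<inter> K' = {}"
  shows "inversions I (K \<union> K') = inversions I K + inversions I K'"
proof -
  have "{(i, k). i \<in> I \<and> k \<in> K \<union> K' \<and> k < i} =
    {(i, k). i \<in> I \<and> k \<in> K \<and> k < i} \<union> {(i, k). i \<in> I \<and> k \<in> K' \<and> k < i}"
    by auto
  then show ?thesis
    unfolding inversions_def using assms
    by (simp only:) (subst card_Un_disjoint, auto intro!: finite_inversions)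
qed

lemma inversions_insert_aux:
  assumes "finite I" "finite K"
  shows "i \<notin> I \<Longrightarrow> inversions (insert i I) K = inversions {i} K + inversions I K"
    "i \<notin> K \<Longrightarrow> inversions I (insert i K) = inversions I {i} + inversions I K"
  using inversions_union_left[of "{i}" I K] inversions_union_right[of I "{i}" K] assms by simp_all

lemma inversions_singleton_self [simp]: "inversions {i} {i} = 0"
proof -
  have "{(i', k). i' \<in> {i} \<and> k \<in> {i} \<and> k < i'} = {}"
    by auto
  then show ?thesis
    unfolding inversions_def by (simp only: card.empty of_nat_0)
qed

lemma par_empty [simp]: "par {} = 0"
  by (simp add: par_def)

lemma par_insert: "finite I \<Longrightarrow> i \<notin> I \<Longrightarrow> par (insert i I) = 1 + par I"
  by (simp add: par_def)

lemma par_union: "finite I \<Longrightarrow> finite K \<Longrightarrow> I \<inter> K = {} \<Longrightarrow> par (I \<union> K) = par I + par K"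
  by (simp add: par_def card_Un_disjoint)

lemma par_diff:
  assumes "finite I" "K \<subseteq> I"
  shows "par (I - K) = par I + par K"
proof -
  have "par I = par (I - K) + par K"
    using assms par_union[of "I - K" K] by (simp add: Un_absorb2 finite_subset Diff_disjoint Int_commute)
  then show ?thesis
    by (simp add: bit_simps)
qed

lemma inversions_singleton_swap:
  assumes "finite K" "i \<notin> K"
  shows "inversions K {i} = par K + inversions {i} K"
  using assms
proof (induction K)
  case (insert k K)
  have "inversions {k} {i} = 1 + inversions {i} {k}"
  proof (cases "k < i")
    case True
    then have "{(i', k'). i' \<in> {k} \<and> k' \<in> {i} \<and> k' < i'} = {}"
      "{(i', k'). i' \<in> {i} \<and> k' \<in> {k} \<and> k' < i'} = {(i, k)}"
      by auto
    then show ?thesis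
      unfolding inversions_def by (simp only:) simp
  next
    case False
    then have "{(i', k'). i' \<in> {k} \<and> k' \<in> {i} \<and> k' < i'} = {(k, i)}"
      "{(i', k'). i' \<in> {i} \<and> k' \<in> {k} \<and> k' < i'} = {}"
      using insert.prems by auto
    then show ?thesis
      unfolding inversions_def by (simp only:) simp
  qed
  with insert show ?case
    by (simp add: inversions_insert_aux[of K "{i}"] inversions_insert_aux[of "{i}" K] par_insert bit_simps)
qed simp

definition below :: "nat \<Rightarrow> nat set \<Rightarrow> bit" where
  "below i K = inversions {i} K"

lemma inversions_insert:
  assumes "finite I" "finite K" "i \<notin> I"
  shows "inversions (insert i I) K = below i K + inversions I K"
    "i \<notin> K \<Longrightarrow> inversions I (insert i K) = par I + below i I + inversions I K"
  using assms inversions_insert_aux[OF assms(1,2), of i] inversions_singleton_swap[OF assms(1,3)]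
  by (simp_all add: below_def)

lemma inversions_below:
  "(\<And>i k. i \<in> I \<Longrightarrow> k \<in> K \<Longrightarrow> i \<le> k) \<Longrightarrow> inversions I K = 0"
proof -
  assume "\<And>i k. i \<in> I \<Longrightarrow> k \<in> K \<Longrightarrow> i \<le> k"
  then have "{(i, k). i \<in> I \<and> k \<in> K \<and> k < i} = {}"
    by (fastforce dest: leD)
  then show ?thesis
    unfolding inversions_def by (simp only: card.empty of_nat_0)
qed

lemma odd_power_eq:
  assumes "finite J"
  shows "odd_power J I K =
    (if I \<inter> K = {} \<and> I \<union> K = J then koszul (par K + inversions I K) else 0)"
  using assms
proof (induction J arbitrary: I K rule: finite_linorder_min_induct)
  case empty
  then show ?case
    by (simp add: odd_power_def grassmann_one_def)
next
  case (insert b A)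
  have b: "b \<notin> A"
    using insert.hyps by blast
  have "Min (insert b A) = b"
    using insert.hyps by (intro Min_eqI) (auto intro: less_imp_le)
  then have "sorted_list_of_set (insert b A) = b # sorted_list_of_set A"
    using insert.hyps(1) b by (subst sorted_list_of_set_nonempty) simp_all
  then have odd: "odd_power (insert b A) = grassmann_mult (theta_minus_zeta b) (odd_power A)"
    by (simp add: odd_power_def)
  show ?case
  proof (cases "finite I \<and> finite K")
    case False
    then have "I \<union> K \<noteq> insert b A"
      using insert.hyps(1) by (metis finite_Un finite_insert)
    moreover have "infinite (Pow I) \<or> infinite (Pow K)"
      using False by simp
    ultimately show ?thesis
      unfolding odd grassmann_mult_def by auto
  next
    case True
    let ?f = "\<lambda>I' K'. eps2 I' K' (I - I') (K - K') * theta_minus_zeta b I' K' * odd_power A (I - I') (K - K')"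
    have "(\<Sum>I'\<in>Pow I. \<Sum>K'\<in>Pow K. ?f I' K') = (\<Sum>(I', K')\<in>Pow I \<times> Pow K. ?f I' K')"
      by (simp add: sum.cartesian_product)
    also have "\<dots> = (\<Sum>(I', K')\<in>(Pow I \<times> Pow K) \<inter> {({b}, {}), ({}, {b})}. ?f I' K')"
      by (rule sum.mono_neutral_right) (use True in \<open>auto simp: theta_minus_zeta_def split: if_splits\<close>)
    also have "\<dots> = (if b \<in> I then ?f {b} {} else 0) + (if b \<in> K then ?f {} {b} else 0)"
    proof -
      have "(Pow I \<times> Pow K) \<inter> {({b}, {}), ({}, {b})} =
        (if b \<in> I then {({b}, {})} else {}) \<union> (if b \<in> K then {({}, {b})} else {})"
        by auto
      then show ?thesis
        by auto
    qed
    also have "(if b \<in> I then ?f {b} {} else 0) =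
      (if b \<in> I \<and> I \<inter> K = {} \<and> I \<union> K = insert b A then koszul (par K + inversions I K) else 0)"
    proof (cases "b \<in> I \<and> (I - {b}) \<inter> K = {} \<and> (I - {b}) \<union> K = A")
      case T: True
      define I0 where "I0 = I - {b}"
      have I: "I = insert b I0" "b \<notin> I0" "b \<notin> K" "finite I0"
        using T True b unfolding I0_def by auto
      have le: "below b I0 = 0" "below b K = 0"
        unfolding below_def
        by (rule inversions_below; use T insert.hyps(2) I0_def in \<open>auto intro: less_imp_le\<close>)+
      have "?f {b} {} = koszul (par K + inversions I0 K)"
        using T I le by (simp add: I0_def[symmetric] insert.IH eps2_def eps_inversions theta_minus_zeta_def inversions_insert)
      also have "inversions I0 K = inversions I K"
        using I le True by (simp add: inversions_insert)
      finally show ?thesis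
        using T I by auto
    next
      case F: False
      then have "\<not> (b \<in> I \<and> I \<inter> K = {} \<and> I \<union> K = insert b A)"
        using b by blast
      with F show ?thesis
        by (auto simp: insert.IH)
    qed
    also have "(if b \<in> K then ?f {} {b} else 0) =
      (if b \<in> K \<and> I \<inter> K = {} \<and> I \<union> K = insert b A then koszul (par K + inversions I K) else 0)"
    proof (cases "b \<in> K \<and> I \<inter> (K - {b}) = {} \<and> I \<union> (K - {b}) = A")
      case T: True
      define K0 where "K0 = K - {b}"
      have K: "K = insert b K0" "b \<notin> K0" "b \<notin> I" "finite K0"
        using T True b unfolding K0_def by auto
      have le: "below b I = 0" "below b K0 = 0"
        unfolding below_def
        by (rule inversions_below; use T insert.hyps(2) K0_def in \<open>auto intro: less_imp_le\<close>)+
      have "?f {} {b} = koszul (par I) * (- koszul (par K0 + inversions I K0))"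
        using T K le by (simp add: K0_def[symmetric] insert.IH eps2_def eps_inversions theta_minus_zeta_def inversions_insert par_insert)
      also have "\<dots> = koszul (par I + 1 + par K0 + inversions I K0)"
        by (simp add: koszul_add)
      also have "par I + 1 + par K0 + inversions I K0 = par K + inversions I K"
        using K le True by (simp add: inversions_insert par_insert bit_simps)
      finally show ?thesis
        using T K by auto
    next
      case F: False
      have "\<not> (b \<in> K \<and> I \<inter> K = {} \<and> I \<union> K = insert b A)"
      proof
        assume *: "b \<in> K \<and> I \<inter> K = {} \<and> I \<union> K = insert b A"
        then have "I \<union> (K - {b}) = (I \<union> K) - {b}"
          by blast
        also have "\<dots> = A"
          using * b by simp
        finally show False
          using F * by blast
      qed
      with F show ?thesis
        by (auto simp: insert.IH)
    qed
    finally show ?thesis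
      unfolding odd grassmann_mult_def by auto
  qed
qed

text \<open>The exponent of the sign with which the component \<open>I2\<close> of \<open>a\<close> and the component \<open>K2\<close> of \<open>b\<close> enter
  the product \<open>a(W)\<^bsub>(j|J)\<^esub>b(W)\<close>, when \<open>\<theta>\<close> to the power \<open>I1\<close> and \<open>\<zeta>\<close> to the power \<open>K1\<close> are taken from
  \<open>(Z - W)\<close> to the power \<open>j|J\<close>.\<close>

definition sign_exponent :: "bit \<Rightarrow> nat set \<Rightarrow> nat set \<Rightarrow> nat set \<Rightarrow> nat set \<Rightarrow> bit" where
  "sign_exponent p I1 I2 K1 K2 =
    par K1 * par I2 + inversions I1 I2 + inversions K1 K2 + (par K1 + inversions I1 K1) + (p + par I2) * par K2"

lemma sign_exponent_cancel:
  assumes "finite I" "finite I2" "finite K1" "finite K" "i \<notin> I" "i \<notin> I2" "i \<notin> K1" "i \<notin> K"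
  shows "sign_exponent p (insert i I) I2 K1 (insert i K) + (par I2 + below i I2) +
    (sign_exponent p I (insert i I2) (insert i K1) K + (p + par (insert i I2) + par K + below i K)) = 1"
  using assms unfolding sign_exponent_def
  by (simp add: inversions_insert par_insert bit_simps)

lemma sign_exponent_insert_K2:
  assumes "finite K1" "finite K2" "i \<notin> K1" "i \<notin> K2"
  shows "sign_exponent p I1 I2 K1 (insert i K2) + below i K1 + below i K2 =
    sign_exponent p I1 I2 K1 K2 + (p + par I2 + par K2 + below i K2) + (par K1 + par K2)"
  using assms unfolding sign_exponent_def
  by (simp add: inversions_insert par_insert bit_simps)

lemma sign_exponent_move:
  assumes "finite I" "finite I2" "finite K1" "finite K2" "i \<notin> I" "i \<notin> I2" "i \<notin> K1" "i \<notin> K2"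
  shows "sign_exponent p I (insert i I2) (insert i K1) K2 + below i K1 + below i K2 =
    sign_exponent p (insert i I) I2 K1 K2 + (par I2 + below i I2) + (par K1 + par K2)"
  using assms unfolding sign_exponent_def
  by (simp add: inversions_insert par_insert bit_simps)

section \<open>Components of superfields and of their products\<close>

lemma Sum_any_inj:
  assumes "inj f" "\<And>x. x \<notin> range f \<Longrightarrow> h x = 0"
  shows "Sum_any h = Sum_any (\<lambda>i. h (f i))"
proof -
  have "{x. h x \<noteq> 0} = f ` {i. h (f i) \<noteq> 0}"
    using assms(2) by (auto simp: image_iff) (metis rangeE)
  then show ?thesis
    unfolding Sum_any.expand_set
    using sum.reindex[OF inj_on_subset[OF assms(1)], of "{i. h (f i) \<noteq> 0}" h] by (simp add: comp_def)
qed

lemma Sum_any_expand_zw: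
  fixes X :: "int \<Rightarrow> int \<Rightarrow> 'v::complex_superspace"
  shows "Sum_any (\<lambda>(n', m'). expand_zw j J n' I m' K *\<^sub>C X n' m') =
    odd_power J I K *\<^sub>C
      Sum_any (\<lambda>i::nat. ((of_int j gchoose i) * (- 1) ^ i) *\<^sub>C X (j - int i) (int i))"
proof -
  let ?f = "\<lambda>i::nat. (j - int i, int i)"
  let ?h = "\<lambda>(n', m'). expand_zw j J n' I m' K *\<^sub>C X n' m'"
  have "inj ?f"
    by (simp add: inj_def)
  moreover have "?h x = 0" if "x \<notin> range ?f" for x
  proof -
    have "fst x + snd x \<noteq> j \<or> snd x < 0"
    proof (rule ccontr)
      assume "\<not> ?thesis"
      then have "x = ?f (nat (snd x))"
        by (simp add: prod_eq_iff)
      with that show False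
        by blast
    qed
    then show ?thesis
      by (auto simp: expand_zw_def split_def)
  qed
  ultimately have "Sum_any ?h = Sum_any (\<lambda>i. ?h (?f i))"
    by (rule Sum_any_inj)
  also have "\<dots> = Sum_any (\<lambda>i::nat. odd_power J I K *\<^sub>C ((of_int j gchoose i) * (- 1) ^ i) *\<^sub>C X (j - int i) (int i))"
    by (rule Sum_any.cong) (simp add: expand_zw_def mult.commute)
  finally show ?thesis
    by (simp only: Sum_any_scale)
qed

lemma Sum_any_expand_wz:
  fixes X :: "int \<Rightarrow> int \<Rightarrow> 'v::complex_superspace"
  shows "Sum_any (\<lambda>(n', m'). expand_wz j J n' I m' K *\<^sub>C X n' m') =
    odd_power J I K *\<^sub>C
      Sum_any (\<lambda>i::nat. ((of_int j gchoose i) * (- 1) powi (j - int i)) *\<^sub>C X (int i) (j - int i))"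
proof -
  let ?f = "\<lambda>i::nat. (int i, j - int i)"
  let ?h = "\<lambda>(n', m'). expand_wz j J n' I m' K *\<^sub>C X n' m'"
  have "inj ?f"
    by (simp add: inj_def)
  moreover have "?h x = 0" if "x \<notin> range ?f" for x
  proof -
    have "fst x + snd x \<noteq> j \<or> fst x < 0"
    proof (rule ccontr)
      assume "\<not> ?thesis"
      then have "x = ?f (nat (fst x))"
        by (simp add: prod_eq_iff)
      with that show False
        by blast
    qed
    then show ?thesis
      by (auto simp: expand_wz_def split_def)
  qed
  ultimately have "Sum_any ?h = Sum_any (\<lambda>i. ?h (?f i))"
    by (rule Sum_any_inj)
  also have "\<dots> = Sum_any (\<lambda>i::nat. odd_power J I K *\<^sub>C ((of_int j gchoose i) * (- 1) powi (j - int i)) *\<^sub>C X (int i) (j - int i))"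
    by (rule Sum_any.cong) (simp add: expand_wz_def mult.commute)
  finally show ?thesis
    by (simp only: Sum_any_scale)
qed

lemma zw_mult_pow_expand:
  "(zw_mult ^^ k) X n m = (\<Sum>i\<le>k. (of_nat (k choose i) * (- 1) ^ i) *\<^sub>C X (n - int k + int i) (m - int i))"
proof (induction k arbitrary: X n m)
  case (Suc k)
  let ?t = "\<lambda>c i. (of_nat c * (- 1) ^ i) *\<^sub>C X (n - int (Suc k) + int i) (m - int i)"
  have "(zw_mult ^^ Suc k) X n m = (\<Sum>i\<le>k. (of_nat (k choose i) * (- 1) ^ i) *\<^sub>C
      (X (n - int (Suc k) + int i) (m - int i) - X (n - int (Suc k) + int (Suc i)) (m - int (Suc i))))"
    unfolding funpow_Suc_right comp_apply Suc.IH by (simp add: zw_mult_def algebra_simps)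
  also have "\<dots> = (\<Sum>i\<le>k. ?t (k choose i) i) + (\<Sum>i\<le>k. ?t (k choose i) (Suc i))"
    by (simp add: complex_vector.scale_right_diff_distrib sum_subtractf sum_negf del: of_nat_Suc)
  also have "(\<Sum>i\<le>k. ?t (k choose i) i) = (\<Sum>i\<le>Suc k. ?t (k choose i) i)"
    by (simp add: binomial_eq_0)
  also have "\<dots> = ?t 1 0 + (\<Sum>i\<le>k. ?t (k choose Suc i) (Suc i))"
    by (subst sum.atMost_Suc_shift) simp
  also have "\<dots> + (\<Sum>i\<le>k. ?t (k choose i) (Suc i)) = ?t 1 0 + (\<Sum>i\<le>k. ?t (Suc k choose Suc i) (Suc i))"
    by (simp add: sum.distrib[symmetric] complex_vector.scale_left_distrib[symmetric] ring_distribs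
        add.commute del: of_nat_Suc power_Suc)
  also have "\<dots> = (\<Sum>i\<le>Suc k. ?t (Suc k choose i) i)"
    by (subst sum.atMost_Suc_shift) simp
  finally show ?case .
qed simp

lemma kernel_mult_power:
  assumes "finite I" "finite K"
  shows "kernel_mult (expand_zw (int k) {}) X n I m K v = (zw_mult ^^ k) (\<lambda>n m. X n I m K v) n m"
proof -
  let ?f = "\<lambda>I' K'. eps2 I' K' (I - I') (K - K') *\<^sub>C odd_power {} I' K' *\<^sub>C
     Sum_any (\<lambda>i::nat. ((of_int (int k) gchoose i) * (- 1) ^ i) *\<^sub>C
        X (n - (int k - int i)) (I - I') (m - int i) (K - K') v)"
  have "kernel_mult (expand_zw (int k) {}) X n I m K v = (\<Sum>I'\<in>Pow I. \<Sum>K'\<in>Pow K. ?f I' K')"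
    unfolding kernel_mult_def
    by (subst Sum_any_expand_zw[where X = "\<lambda>n' m'. X (n - n') (I - _) (m - m') (K - _) v"]) simp
  also have "\<dots> = (\<Sum>I'\<in>{{}}. \<Sum>K'\<in>Pow K. ?f I' K')"
    by (rule sum.mono_neutral_right) (use assms in \<open>auto simp: odd_power_eq intro!: sum.neutral\<close>)
  also have "\<dots> = (\<Sum>K'\<in>Pow K. ?f {} K')"
    by (simp only: sum.insert finite.emptyI empty_iff not_False_eq_True sum.empty add_0_right)
  also have "\<dots> = (\<Sum>K'\<in>{{}}. ?f {} K')"
    by (rule sum.mono_neutral_right) (use assms in \<open>auto simp: odd_power_eq\<close>)
  also have "\<dots> = Sum_any (\<lambda>i::nat. (of_nat (k choose i) * (- 1) ^ i) *\<^sub>C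
        X (n - int k + int i) I (m - int i) K v)"
    by (simp add: odd_power_eq eps2_def eps_inversions binomial_gbinomial diff_diff_eq2 add_diff_eq algebra_simps)
  also have "\<dots> = (\<Sum>i<Suc k. (of_nat (k choose i) * (- 1) ^ i) *\<^sub>C
        X (n - int k + int i) I (m - int i) K v)"
    by (rule Sum_any_lessThan) (simp add: binomial_eq_0)
  finally show ?thesis
    by (simp only: zw_mult_pow_expand lessThan_Suc_atMost)
qed

lemma sfieldD:
  assumes "sfield N a"
  shows "endo (a n I)" "\<not> I \<subseteq> {1..N} \<Longrightarrow> a n I v = 0" "a n I 0 = 0" "even_field (\<lambda>n. a n I)"
  using assms unfolding sfield_def even_field_def by (auto simp: endo_zero)

lemma endo_both_parities:
  assumes "endo f" "endo_parity p f" "endo_parity (1 + p) f"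
  shows "f v = 0"
proof -
  have "f u = 0" if "u \<in> grade q" for u q
  proof -
    have "f u \<in> grade (q + p) \<inter> grade (q + (1 + p))"
      using assms(2,3) that unfolding endo_parity_def by blast
    moreover have "grade r \<inter> grade (1 + r) = {0 :: 'a}" for r
      using grade_Int[where 'a = 'a] by (cases r) (auto simp: bit_add_self)
    ultimately show ?thesis
      by (metis add.left_commute singletonD)
  qed
  moreover obtain y z where "y \<in> grade 0" "z \<in> grade 1" "v = y + z"
    using grade_sum by blast
  ultimately show ?thesis
    using assms(1) by (metis add.right_neutral endo_add)
qed

lemma parity_of_cases:
  assumes "sfield N a" "series_parity N p a"
  shows "parity_of N a = p \<or> a = (\<lambda>_ _ _. 0)"
proof (cases "parity_of N a = p")
  case False
  then have "p = 1" "series_parity N 0 a"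
    using assms(2) unfolding parity_of_def by (cases p; auto split: if_splits)+
  have "a n I v = 0" for n I v
  proof (cases "I \<subseteq> {1..N}")
    case True
    then have "endo_parity (par I) (a n I)" "endo_parity (1 + par I) (a n I)"
      using assms(2) \<open>series_parity N 0 a\<close> \<open>p = 1\<close> unfolding series_parity_def by auto
    then show ?thesis
      using endo_both_parities sfieldD(1)[OF assms(1)] by blast
  qed (simp add: sfieldD[OF assms(1)])
  then show ?thesis
    by blast
qed simp

lemma prod_ZW_eq:
  assumes "sfield N a" "series_parity N p a"
  shows "prod_ZW N a b n I m K v = koszul ((p + par I) * par K) *\<^sub>C a n I (b m K v)"
  using parity_of_cases[OF assms] unfolding prod_ZW_def by auto

lemma prod_WZ_eq:
  assumes "sfield N a" "series_parity N p a" "sfield N b" "series_parity N q b"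
  shows "koszul (parity_of N a * parity_of N b) *\<^sub>C prod_WZ N b a n I m K v =
    koszul ((p + par I) * par K) *\<^sub>C koszul ((p + par I) * (q + par K)) *\<^sub>C b m K (a n I v)"
proof -
  have "p * q + ((q + par K) * par I + par K * par I) = (p + par I) * par K + (p + par I) * (q + par K)"
    by (simp add: bit_simps)
  then have "koszul (p * q) * koszul ((q + par K) * par I + par K * par I) =
      koszul ((p + par I) * par K) * koszul ((p + par I) * (q + par K))"
    by (simp flip: koszul_add)
  then show ?thesis
    using parity_of_cases[OF assms(1,2)] parity_of_cases[OF assms(3,4)] sfieldD(3)[OF assms(3)]
    unfolding prod_WZ_def by auto
qed

lemma bracket_eq:
  assumes "sfield N a" "series_parity N p a" "endo A"
  shows "bracket N q A a n I v =
    koszul (q * par I) *\<^sub>C A (a n I v) - koszul (q * p) *\<^sub>C a n I (A v)"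
  using parity_of_cases[OF assms(1,2)] endo_zero[OF assms(3)] unfolding bracket_def by auto

definition component_prod ::
  "bit \<Rightarrow> bit \<Rightarrow> int \<Rightarrow> 'v::complex_superspace series \<Rightarrow> 'v series \<Rightarrow> nat set \<Rightarrow> nat set \<Rightarrow> int \<Rightarrow> 'v \<Rightarrow> 'v" where
  "component_prod p q j a b I K = nth_prod (koszul ((p + par I) * (q + par K))) j (\<lambda>n. a n I) (\<lambda>n. b n K)"

lemma nprod_infinite: "infinite K \<Longrightarrow> nprod N j J a b m K v = 0"
  by (simp add: nprod_def res_Z_def kernel_mult_def)

lemma nprod_finite:
  assumes a: "sfield N a" "series_parity N p a" and b: "sfield N b" "series_parity N q b"
    and J: "J \<subseteq> {1..N}" and K: "finite K"
  shows "nprod N j J a b m K v = (\<Sum>K'\<in>Pow (K \<inter> J).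
    koszul (sign_exponent p (J - K') ({1..N} - (J - K')) K' (K - K')) *\<^sub>C
      component_prod p q j a b ({1..N} - (J - K')) (K - K') m v)"
proof -
  let ?N = "{1..N}"
  have fJ: "finite J"
    using J finite_subset by blast
  let ?S1 = "\<lambda>I' K'. Sum_any (\<lambda>i::nat. ((of_int j gchoose i) * (- 1) ^ i) *\<^sub>C
    prod_ZW N a b (- 1 - (j - int i)) (?N - I') (m - int i) (K - K') v)"
  let ?S2 = "\<lambda>I' K'. Sum_any (\<lambda>i::nat. ((of_int j gchoose i) * (- 1) powi (j - int i)) *\<^sub>C
    prod_WZ N b a (- 1 - int i) (?N - I') (m - (j - int i)) (K - K') v)"
  let ?k = "koszul (parity_of N a * parity_of N b)"
  let ?c = "\<lambda>I' K'. eps2 I' K' (?N - I') (K - K') * odd_power J I' K'"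
  let ?d = "\<lambda>I' K'. koszul ((p + par (?N - I')) * par (K - K'))"
  have 1: "kernel_mult (expand_zw j J) (prod_ZW N a b) (- 1) ?N m K v =
    (\<Sum>I'\<in>Pow ?N. \<Sum>K'\<in>Pow K. ?c I' K' *\<^sub>C ?S1 I' K')"
    unfolding kernel_mult_def
    by (subst Sum_any_expand_zw[where X = "\<lambda>n' m'. prod_ZW N a b (- 1 - n') (?N - _) (m - m') (K - _) v"]) simp
  have 2: "kernel_mult (expand_wz j J) (prod_WZ N b a) (- 1) ?N m K v =
    (\<Sum>I'\<in>Pow ?N. \<Sum>K'\<in>Pow K. ?c I' K' *\<^sub>C ?S2 I' K')"
    unfolding kernel_mult_def
    by (subst Sum_any_expand_wz[where X = "\<lambda>n' m'. prod_WZ N b a (- 1 - n') (?N - _) (m - m') (K - _) v"]) simp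
  have S: "?S1 I' K' - ?k *\<^sub>C ?S2 I' K' = ?d I' K' *\<^sub>C component_prod p q j a b (?N - I') (K - K') m v" for I' K'
  proof -
    have "?k *\<^sub>C ?S2 I' K' = Sum_any (\<lambda>i::nat. ((of_int j gchoose i) * (- 1) powi (j - int i)) *\<^sub>C
      (?k *\<^sub>C prod_WZ N b a (- 1 - int i) (?N - I') (m - (j - int i)) (K - K') v))"
      unfolding Sum_any_scale[symmetric] by (simp only: complex_vector.scale_left_commute)
    moreover have "- 1 - (j - int i) = int i - 1 - j" "m - (j - int i) = m - j + int i" for i
      by simp_all
    ultimately show ?thesis
      unfolding prod_WZ_eq[OF a b] prod_ZW_eq[OF a] component_prod_def nth_prod_def res_pair_def
        complex_vector.scale_right_diff_distrib
      unfolding Sum_any_scale[symmetric]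
      by (simp only: complex_vector.scale_left_commute)
  qed
  have "nprod N j J a b m K v = (\<Sum>I'\<in>Pow ?N. \<Sum>K'\<in>Pow K. ?c I' K' *\<^sub>C (?S1 I' K' - ?k *\<^sub>C ?S2 I' K'))"
    unfolding nprod_def res_Z_def 1 2 complex_vector.scale_right_diff_distrib sum_subtractf
      complex_vector.scale_sum_right complex_vector.scale_left_commute[of ?k] ..
  also have "\<dots> = (\<Sum>K'\<in>Pow K. \<Sum>I'\<in>Pow ?N. (?c I' K' * ?d I' K') *\<^sub>C component_prod p q j a b (?N - I') (K - K') m v)"
    unfolding S by (subst sum.swap) simp
  also have "\<dots> = (\<Sum>K'\<in>Pow (K \<inter> J). \<Sum>I'\<in>Pow ?N. (?c I' K' * ?d I' K') *\<^sub>C component_prod p q j a b (?N - I') (K - K') m v)"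
    by (rule sum.mono_neutral_right) (use K in \<open>auto simp: odd_power_eq[OF fJ] intro!: sum.neutral split: if_splits\<close>)
  also have "\<dots> = (\<Sum>K'\<in>Pow (K \<inter> J).
    koszul (sign_exponent p (J - K') (?N - (J - K')) K' (K - K')) *\<^sub>C component_prod p q j a b (?N - (J - K')) (K - K') m v)"
  proof (rule sum.cong[OF refl])
    fix K' assume K': "K' \<in> Pow (K \<inter> J)"
    have "(\<Sum>I'\<in>Pow ?N. (?c I' K' * ?d I' K') *\<^sub>C component_prod p q j a b (?N - I') (K - K') m v) =
      (\<Sum>I'\<in>{J - K'}. (?c I' K' * ?d I' K') *\<^sub>C component_prod p q j a b (?N - I') (K - K') m v)"
      by (rule sum.mono_neutral_right) (use K' J in \<open>auto simp: odd_power_eq[OF fJ]\<close>)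
    moreover have "?c (J - K') K' * ?d (J - K') K' = koszul (sign_exponent p (J - K') (?N - (J - K')) K' (K - K'))"
    proof -
      have "(J - K') \<inter> K' = {} \<and> (J - K') \<union> K' = J" "(J - K') \<inter> (?N - (J - K')) = {}" "K' \<inter> (K - K') = {}"
        using K' by auto
      then show ?thesis
        by (simp add: sign_exponent_def odd_power_eq[OF fJ] eps2_def eps_inversions koszul_add)
    qed
    ultimately show "(\<Sum>I'\<in>Pow ?N. (?c I' K' * ?d I' K') *\<^sub>C component_prod p q j a b (?N - I') (K - K') m v) =
      koszul (sign_exponent p (J - K') (?N - (J - K')) K' (K - K')) *\<^sub>C component_prod p q j a b (?N - (J - K')) (K - K') m v"
      by simp
  qed
  finally show ?thesis .
qed

lemma component_prod_zero: "sfield N a \<Longrightarrow> \<not> K \<subseteq> {1..N} \<Longrightarrow> sfield N b \<Longrightarrow> component_prod p q j a b I K m v = 0"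
  by (simp add: component_prod_def nth_prod_def res_pair_def sfieldD)

lemma nprod_eq:
  assumes "sfield N a" "series_parity N p a" "sfield N b" "series_parity N q b" "J \<subseteq> {1..N}"
  shows "nprod N j J a b m K v = (\<Sum>K'\<in>Pow (K \<inter> J).
    koszul (sign_exponent p (J - K') ({1..N} - (J - K')) K' (K - K')) *\<^sub>C
      component_prod p q j a b ({1..N} - (J - K')) (K - K') m v)"
proof (cases "finite K")
  case False
  have "component_prod p q j a b ({1..N} - (J - K')) (K - K') m v = 0" if "K' \<in> Pow (K \<inter> J)" for K'
  proof -
    have "finite K'"
      using that assms(5) by (metis Int_subset_iff PowD finite_atLeastAtMost finite_subset)
    then have "\<not> K - K' \<subseteq> {1..N}"
      using False by (metis finite_Diff2 finite_atLeastAtMost finite_subset)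
    then show ?thesis
      by (rule component_prod_zero[OF assms(1) _ assms(3)])
  qed
  then show ?thesis
    using False by (simp add: nprod_infinite)
qed (rule nprod_finite[OF assms])

definition super_local :: "nat \<Rightarrow> bit \<Rightarrow> bit \<Rightarrow> nat \<Rightarrow> 'v::complex_superspace series \<Rightarrow> 'v series \<Rightarrow> bool" where
  "super_local N p q r a b \<longleftrightarrow> (\<forall>I K. I \<subseteq> {1..N} \<longrightarrow> K \<subseteq> {1..N} \<longrightarrow>
    local_order r (koszul ((p + par I) * (q + par K))) (\<lambda>n. a n I) (\<lambda>n. b n K))"

lemma supercomm_eq:
  assumes "sfield N a" "series_parity N p a" "sfield N b" "series_parity N q b"
  shows "supercomm N a b n I m K v = koszul ((p + par I) * par K) *\<^sub>C
    (a n I (b m K v) - koszul ((p + par I) * (q + par K)) *\<^sub>C b m K (a n I v))"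
  unfolding supercomm_def prod_ZW_eq[OF assms(1,2)] prod_WZ_eq[OF assms]
  by (simp only: complex_vector.scale_right_diff_distrib)

lemma local_pair_iff:
  assumes "sfield N a" "series_parity N p a" "sfield N b" "series_parity N q b"
  shows "local_pair N a b \<longleftrightarrow> (\<exists>r. super_local N p q r a b)"
proof -
  have *: "(\<forall>n I m K v. kernel_mult (expand_zw (int r) {}) (supercomm N a b) n I m K v = 0) \<longleftrightarrow>
    super_local N p q r a b" for r
  proof -
    let ?X = "\<lambda>I K v n m. a n I (b m K v) - koszul ((p + par I) * (q + par K)) *\<^sub>C b m K (a n I v)"
    have *: "kernel_mult (expand_zw (int r) {}) (supercomm N a b) n I m K v =
      koszul ((p + par I) * par K) *\<^sub>C (zw_mult ^^ r) (?X I K v) n m" if "finite I" "finite K" for n I m K v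
      unfolding kernel_mult_power[OF that] supercomm_eq[OF assms] by (rule zw_mult_pow_scale)
    have k: "koszul x \<noteq> 0" for x
      by (simp add: koszul_def)
    show ?thesis
    proof
      assume "\<forall>n I m K v. kernel_mult (expand_zw (int r) {}) (supercomm N a b) n I m K v = 0"
      then show "super_local N p q r a b"
        unfolding super_local_def local_order_def using * k finite_subset[of _ "{1..N}"]
        by (intro allI impI ext) (metis (no_types, lifting) complex_vector.scale_eq_0_iff finite_atLeastAtMost)
    next
      assume l: "super_local N p q r a b"
      show "\<forall>n I m K v. kernel_mult (expand_zw (int r) {}) (supercomm N a b) n I m K v = 0"
      proof (intro allI)
        fix n I m K v
        consider "I \<subseteq> {1..N}" "K \<subseteq> {1..N}" | "infinite I \<or> infinite K"
          | "finite I" "finite K" "\<not> (I \<subseteq> {1..N} \<and> K \<subseteq> {1..N})"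
          by blast
        then show "kernel_mult (expand_zw (int r) {}) (supercomm N a b) n I m K v = 0"
        proof cases
          case 1
          then have "finite I" "finite K"
            using finite_subset by blast+
          then show ?thesis
            using 1 l unfolding super_local_def local_order_def by (simp add: *)
        next
          case 2
          then show ?thesis
            by (auto simp: kernel_mult_def)
        next
          case 3
          then have "?X I K v = (\<lambda>n m. 0)"
            by (cases "I \<subseteq> {1..N}")
              (simp_all add: sfieldD(2,3)[OF assms(1)] sfieldD(2,3)[OF assms(3)])
          then show ?thesis
            using 3 by (simp add: * zw_mult_pow_zero)
        qed
      qed
    qed
  qed
  show ?thesis
    unfolding local_pair_def * ..
qed

lemma super_local_mono: "super_local N p q r a b \<Longrightarrow> r \<le> r' \<Longrightarrow> super_local N p q r' a b"
  unfolding super_local_def by (intro allI impI, rule local_order_mono) simp_all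

lemma super_local_sym: "super_local N p q r a b \<Longrightarrow> super_local N q p r b a"
  unfolding super_local_def
  by (intro allI impI, subst mult.commute, rule local_order_sym) simp_all

lemma even_field_zero: "even_field (\<lambda>n v. 0)"
  unfolding even_field_def by (simp add: endo_zero_fun)

lemma even_field_scale:
  assumes "even_field a"
  shows "even_field (\<lambda>n v. c *\<^sub>C a n v)"
proof -
  have "\<exists>M. \<forall>n<M. c *\<^sub>C a n v = 0" for v
    using assms unfolding even_field_def by (metis complex_vector.scale_zero_right)
  moreover have "endo (\<lambda>v. c *\<^sub>C a n v)" for n
    using assms unfolding even_field_def
    by (intro endoI) (simp_all add: endo_simps complex_vector.scale_right_distrib mult.commute)
  ultimately show ?thesis
    unfolding even_field_def by blast
qed

lemma even_field_add:
  assumes "even_field a" "even_field b"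
  shows "even_field (\<lambda>n v. a n v + b n v)"
proof -
  have "\<exists>M. \<forall>n<M. a n v + b n v = 0" for v
  proof -
    obtain A B where "\<forall>n<A. a n v = 0" "\<forall>n<B. b n v = 0"
      using assms unfolding even_field_def by blast
    then show ?thesis
      by (intro exI[of _ "min A B"]) simp
  qed
  moreover have "endo (\<lambda>v. a n v + b n v)" for n
    using assms unfolding even_field_def
    by (intro endoI) (simp_all add: endo_simps complex_vector.scale_right_distrib)
  ultimately show ?thesis
    unfolding even_field_def by blast
qed

lemma even_field_sum:
  assumes "\<And>i. i \<in> A \<Longrightarrow> even_field (a i)"
  shows "even_field (\<lambda>n v. \<Sum>i\<in>A. c i *\<^sub>C a i n v)"
  using assms by (induction A rule: infinite_finite_induct) (simp_all add: even_field_zero even_field_add even_field_scale)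

lemma grade_minus: "x \<in> grade p \<Longrightarrow> y \<in> grade p \<Longrightarrow> x - y \<in> grade p"
  using grade_add[of x p "(- 1) *\<^sub>C y"] grade_scaleC[of y p "- 1"] by simp

lemma grade_sum_closed: "(\<And>i. i \<in> A \<Longrightarrow> f i \<in> grade p) \<Longrightarrow> sum f A \<in> grade p"
  by (induction A rule: infinite_finite_induct) (simp_all add: grade_zero grade_add)

lemma res_pair_grade:
  "(\<And>m n. X m n \<in> grade p) \<Longrightarrow> (\<And>m n. Y m n \<in> grade p) \<Longrightarrow> res_pair j X Y m \<in> grade p"
  unfolding res_pair_def Sum_any.expand_set by (intro grade_minus grade_sum_closed grade_scaleC)

lemma nth_prod_scale_left:
  "(\<And>n. endo (b n)) \<Longrightarrow> nth_prod e j (\<lambda>n v. c *\<^sub>C a n v) b m v = c *\<^sub>C nth_prod e j a b m v"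
  unfolding nth_prod_def res_pair_scale[symmetric] by (simp only: endo_scale complex_vector.scale_left_commute[of _ c])

lemma nth_prod_scale_right:
  "(\<And>n. endo (a n)) \<Longrightarrow> nth_prod e j a (\<lambda>n v. c *\<^sub>C b n v) m v = c *\<^sub>C nth_prod e j a b m v"
  unfolding nth_prod_def res_pair_scale[symmetric] by (simp only: endo_scale complex_vector.scale_left_commute[of _ c])

lemma nth_prod_zero:
  "(\<And>n. endo (b n)) \<Longrightarrow> nth_prod e j (\<lambda>n v. 0) b m v = 0"
  "(\<And>n. endo (a n)) \<Longrightarrow> nth_prod e j a (\<lambda>n v. 0) m v = 0"
  unfolding nth_prod_def res_pair_def by (simp_all add: endo_zero)

definition T_covariant :: "('v \<Rightarrow> 'v) \<Rightarrow> 'v::complex_superspace series \<Rightarrow> bool" where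
  "T_covariant T a \<longleftrightarrow> (\<forall>n I v. T (a n I v) - a n I (T v) = of_int (n + 1) *\<^sub>C a (n + 1) I v)"

definition S_covariant :: "bit \<Rightarrow> nat \<Rightarrow> ('v \<Rightarrow> 'v) \<Rightarrow> 'v::complex_superspace series \<Rightarrow> bool" where
  "S_covariant p i S a \<longleftrightarrow> (\<forall>n I v. koszul (par I) *\<^sub>C S (a n I v) - koszul p *\<^sub>C a n I (S v) = d_odd i a n I v)"

lemma bracket_even_iff:
  assumes "sfield N a" "series_parity N p a" "endo T"
  shows "bracket N 0 T a = d_even a \<longleftrightarrow> T_covariant T a"
  unfolding T_covariant_def fun_eq_iff bracket_eq[OF assms] d_even_def by simp

lemma bracket_odd_iff:
  assumes "sfield N a" "series_parity N p a" "endo S"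
  shows "bracket N 1 S a = d_odd i a \<longleftrightarrow> S_covariant p i S a"
  unfolding S_covariant_def fun_eq_iff bracket_eq[OF assms] by simp

lemma below_disjoint_union:
  "finite I \<Longrightarrow> finite K \<Longrightarrow> I \<inter> K = {} \<Longrightarrow> below i (I \<union> K) = below i I + below i K"
  unfolding below_def by (rule inversions_union_right) simp_all

lemma sum_Pow_insert:
  assumes "finite B" "i \<notin> B"
  shows "sum f (Pow (insert i B)) = (\<Sum>X\<in>Pow B. f X + f (insert i X))"
proof -
  have inj: "inj_on (insert i) (Pow B)"
    using assms(2) by (auto intro!: inj_onI)
  have "sum f (Pow (insert i B)) = sum f (Pow B) + sum f (insert i ` Pow B)"
    unfolding Pow_insert by (rule sum.union_disjoint) (use assms in auto)
  then show ?thesis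
    by (simp add: sum.reindex[OF inj] sum.distrib comp_def)
qed

locale local_field_pair =
  fixes N :: nat and p q :: bit and r :: nat and a b :: "'v::complex_superspace series"
  assumes a: "sfield N a" "series_parity N p a"
    and b: "sfield N b" "series_parity N q b"
    and local_order: "super_local N p q r a b"
begin

lemma component_prod_even_field:
  assumes "I \<subseteq> {1..N}"
  shows "even_field (component_prod p q j a b I K)"
proof (cases "K \<subseteq> {1..N}")
  case True
  show ?thesis
    unfolding component_prod_def
    by (rule nth_prod_even_field[OF sfieldD(4)[OF a(1)] sfieldD(4)[OF b(1)]])
      (use local_order assms True in \<open>auto simp: super_local_def\<close>)
next
  case False
  then have "component_prod p q j a b I K = (\<lambda>n v. 0)"
    by (intro ext) (rule component_prod_zero[OF a(1) _ b(1)])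
  then show ?thesis
    by (simp add: even_field_zero)
qed

lemma nprod_fun_eq:
  assumes "J \<subseteq> {1..N}"
  shows "(\<lambda>n. nprod N j J a b n K) = (\<lambda>n v. \<Sum>K'\<in>Pow (K \<inter> J).
    koszul (sign_exponent p (J - K') ({1..N} - (J - K')) K' (K - K')) *\<^sub>C
      component_prod p q j a b ({1..N} - (J - K')) (K - K') n v)"
  by (intro ext) (rule nprod_eq[OF a b assms])

lemma nprod_even_field:
  assumes "J \<subseteq> {1..N}"
  shows "even_field (\<lambda>n. nprod N j J a b n K)"
  unfolding nprod_fun_eq[OF assms] by (rule even_field_sum, rule component_prod_even_field) blast

lemma nprod_outside:
  assumes "J \<subseteq> {1..N}" "\<not> K \<subseteq> {1..N}"
  shows "nprod N j J a b m K v = 0"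
  unfolding nprod_eq[OF a b assms(1)]
proof (rule sum.neutral, rule ballI)
  fix K' assume "K' \<in> Pow (K \<inter> J)"
  then have "\<not> K - K' \<subseteq> {1..N}"
    using assms by blast
  then show "koszul (sign_exponent p (J - K') ({1..N} - (J - K')) K' (K - K')) *\<^sub>C
      component_prod p q j a b ({1..N} - (J - K')) (K - K') m v = 0"
    by (simp only: component_prod_zero[OF a(1) _ b(1)] complex_vector.scale_zero_right not_False_eq_True)
qed

lemma nprod_sfield:
  assumes "J \<subseteq> {1..N}"
  shows "sfield N (nprod N j J a b)"
  unfolding sfield_def
proof (intro conjI allI impI)
  show "endo (nprod N j J a b n I)" for n I
    using nprod_even_field[OF assms] unfolding even_field_def by blast
  show "\<exists>m. \<forall>n<m. nprod N j J a b n I v = 0" for v I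
    using nprod_even_field[OF assms] unfolding even_field_def by blast
qed (use nprod_outside[OF assms] in blast)

lemma parity_split:
  assumes "J \<subseteq> {1..N}" "K \<subseteq> {1..N}" "K' \<subseteq> K \<inter> J"
  shows "(p + par ({1..N} - (J - K'))) + (q + par (K - K')) = (p + q + par ({1..N} - J)) + par K"
proof -
  have fin: "finite K" "finite J"
    using assms finite_subset by blast+
  have "par ({1..N} - (J - K')) = par {1..N} + (par J + par K')" "par ({1..N} - J) = par {1..N} + par J"
    "par (K - K') = par K + par K'"
    using assms fin by (subst par_diff; (subst par_diff)?; auto)+
  then show ?thesis
    by (simp only: bit_simps add_0_left add_0_right)
qed

lemma component_prod_parity:
  assumes "I \<subseteq> {1..N}" "K \<subseteq> {1..N}"
  shows "endo_parity ((p + par I) + (q + par K)) (component_prod p q j a b I K m)"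
  unfolding endo_parity_def component_prod_def nth_prod_def
proof (intro allI ballI)
  fix s and v :: 'v assume v: "v \<in> grade s"
  have a': "a n I x \<in> grade (t + (p + par I))" if "x \<in> grade t" for n x t
    using a(2) assms(1) that unfolding series_parity_def endo_parity_def by blast
  have b': "b n K x \<in> grade (t + (q + par K))" if "x \<in> grade t" for n x t
    using b(2) assms(2) that unfolding series_parity_def endo_parity_def by blast
  have e: "s + ((p + par I) + (q + par K)) = s + (q + par K) + (p + par I)"
    "s + ((p + par I) + (q + par K)) = s + (p + par I) + (q + par K)"
    by (simp_all only: ac_simps)
  show "res_pair j (\<lambda>pa qa. a pa I (b qa K v))
     (\<lambda>pa qa. koszul ((p + par I) * (q + par K)) *\<^sub>C b qa K (a pa I v)) m
     \<in> grade (s + ((p + par I) + (q + par K)))"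
  proof (rule res_pair_grade)
    show "a m I (b n K v) \<in> grade (s + ((p + par I) + (q + par K)))" for m n
      unfolding e(1) by (rule a'[OF b'[OF v]])
    show "koszul ((p + par I) * (q + par K)) *\<^sub>C b n K (a m I v) \<in> grade (s + ((p + par I) + (q + par K)))" for m n
      unfolding e(2) by (rule grade_scaleC, rule b'[OF a'[OF v]])
  qed
qed

lemma nprod_parity:
  assumes "J \<subseteq> {1..N}"
  shows "series_parity N (p + q + par ({1..N} - J)) (nprod N j J a b)"
  unfolding series_parity_def endo_parity_def
proof (intro allI impI ballI)
  fix n K s and v :: 'v assume K: "K \<subseteq> {1..N}" and v: "v \<in> grade s"
  show "nprod N j J a b n K v \<in> grade (s + (p + q + par ({1..N} - J) + par K))"
    unfolding nprod_eq[OF a b assms]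
  proof (rule grade_sum_closed, rule grade_scaleC)
    fix K' assume K': "K' \<in> Pow (K \<inter> J)"
    then have "endo_parity ((p + par ({1..N} - (J - K'))) + (q + par (K - K')))
        (component_prod p q j a b ({1..N} - (J - K')) (K - K') n)"
      by (intro component_prod_parity) (use K in auto)
    then show "component_prod p q j a b ({1..N} - (J - K')) (K - K') n v \<in> grade (s + (p + q + par ({1..N} - J) + par K))"
      using v K' unfolding endo_parity_def by (subst parity_split[OF assms K, symmetric]) auto
  qed
qed

lemma component_prod_translation:
  assumes "I \<subseteq> {1..N}" "endo T" "T_covariant T a" "T_covariant T b"
  shows "T (component_prod p q j a b I K m v) - component_prod p q j a b I K m (T v) = of_int (m + 1) *\<^sub>C component_prod p q j a b I K (m + 1) v"
proof (cases "K \<subseteq> {1..N}")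
  case True
  show ?thesis
    unfolding component_prod_def
    by (rule nth_prod_translation[OF assms(2) sfieldD(4)[OF a(1)] sfieldD(4)[OF b(1)]])
      (use local_order assms True in \<open>auto simp: super_local_def T_covariant_def\<close>)
next
  case False
  then show ?thesis
    by (simp add: component_prod_zero[OF a(1) _ b(1)] endo_zero[OF assms(2)])
qed

lemma nprod_T_covariant:
  assumes "J \<subseteq> {1..N}" "endo T" "T_covariant T a" "T_covariant T b"
  shows "T_covariant T (nprod N j J a b)"
  unfolding T_covariant_def
proof (intro allI)
  fix m K v
  show "T (nprod N j J a b m K v) - nprod N j J a b m K (T v) = of_int (m + 1) *\<^sub>C nprod N j J a b (m + 1) K v"
    unfolding nprod_eq[OF a b assms(1)] endo_sum[OF assms(2)] endo_scale[OF assms(2)]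
      sum_subtractf[symmetric] complex_vector.scale_right_diff_distrib[symmetric]
      complex_vector.scale_sum_right
    by (rule sum.cong[OF refl], subst component_prod_translation[OF _ assms(2-)])
      (auto simp: complex_vector.scale_left_commute)
qed

lemma component_prod_leibniz:
  assumes I: "I \<subseteq> {1..N}" and K: "K \<subseteq> {1..N}" and "endo S" "S_covariant p i S a" "S_covariant q i S b"
  shows "S (component_prod p q j a b I K m v) =
    koszul ((p + par I) + (q + par K)) *\<^sub>C component_prod p q j a b I K m (S v) +
    ((if i \<in> I then 0 else koszul (par I + below i I) *\<^sub>C component_prod p q j a b (insert i I) K m v) +
     (if i \<in> K then 0 else koszul (p + par I + (par K + below i K)) *\<^sub>C component_prod p q j a b I (insert i K) m v))"
proof -
  have fin: "finite I" "finite K"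
    using I K finite_subset by blast+
  define a' where "a' = (\<lambda>n v. if i \<in> I then 0 else koszul (par I + below i I) *\<^sub>C a n (insert i I) v)"
  define b' where "b' = (\<lambda>n v. if i \<in> K then 0 else koszul (par K + below i K) *\<^sub>C b n (insert i K) v)"
  have *: "S (c n I v) = koszul (p + par I) *\<^sub>C c n I (S v) +
      (if i \<in> I then 0 else koszul (par I + below i I) *\<^sub>C c n (insert i I) v)"
    if "S_covariant p i S c" for c :: "'v series" and p n I v
  proof -
    have "koszul (par I) *\<^sub>C S (c n I v) = koszul p *\<^sub>C c n I (S v) + d_odd i c n I v"
      using that unfolding S_covariant_def by (metis diff_eq_eq add.commute)
    then have "koszul (par I) *\<^sub>C koszul (par I) *\<^sub>C S (c n I v) =
      koszul (par I) *\<^sub>C (koszul p *\<^sub>C c n I (S v) + d_odd i c n I v)"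
      by simp
    then show ?thesis
      by (auto simp: d_odd_def eps_inversions below_def koszul_add complex_vector.scale_right_distrib mult.commute)
  qed
  have even_field: "even_field (\<lambda>n. a n I)" "even_field (\<lambda>n. b n K)" "even_field a'" "even_field b'"
    unfolding a'_def b'_def
    by (cases "i \<in> I"; cases "i \<in> K";
        simp add: sfieldD(4)[OF a(1)] sfieldD(4)[OF b(1)] even_field_zero
          even_field_scale[OF sfieldD(4)[OF a(1)]] even_field_scale[OF sfieldD(4)[OF b(1)]])+
  have "S (component_prod p q j a b I K m v) =
    (koszul (p + par I) * koszul (q + par K)) *\<^sub>C component_prod p q j a b I K m (S v) +
    (nth_prod (koszul ((p + par I) * (q + par K)) * koszul (q + par K)) j a' (\<lambda>n. b n K) m v +
     koszul (p + par I) *\<^sub>C nth_prod (koszul ((p + par I) * (q + par K)) * koszul (p + par I)) j (\<lambda>n. a n I) b' m v)"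
    unfolding component_prod_def
    by (rule nth_prod_leibniz[OF \<open>endo S\<close> even_field])
      (auto simp: a'_def b'_def *[OF assms(4)] *[OF assms(5)])
  moreover have "nth_prod (koszul ((p + par I) * (q + par K)) * koszul (q + par K)) j a' (\<lambda>n. b n K) m v =
    (if i \<in> I then 0 else koszul (par I + below i I) *\<^sub>C component_prod p q j a b (insert i I) K m v)"
  proof (cases "i \<in> I")
    case True
    then show ?thesis
      by (simp add: a'_def nth_prod_zero sfieldD(1)[OF b(1)])
  next
    case False
    have "(p + par I) * (q + par K) + (q + par K) = (p + par (insert i I)) * (q + par K)"
      using False fin by (simp add: par_insert bit_simps)
    with False show ?thesis
      by (simp add: a'_def nth_prod_scale_left sfieldD(1)[OF b(1)] component_prod_def flip: koszul_add)
  qed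
  moreover have "nth_prod (koszul ((p + par I) * (q + par K)) * koszul (p + par I)) j (\<lambda>n. a n I) b' m v =
    (if i \<in> K then 0 else koszul (par K + below i K) *\<^sub>C component_prod p q j a b I (insert i K) m v)"
  proof (cases "i \<in> K")
    case True
    then show ?thesis
      by (simp add: b'_def nth_prod_zero sfieldD(1)[OF a(1)])
  next
    case False
    have "(p + par I) * (q + par K) + (p + par I) = (p + par I) * (q + par (insert i K))"
      using False fin by (simp add: par_insert bit_simps)
    with False show ?thesis
      by (simp add: b'_def nth_prod_scale_right sfieldD(1)[OF a(1)] component_prod_def flip: koszul_add)
  qed
  ultimately show ?thesis
    by (simp add: koszul_add)
qed

lemma nprod_vacuum:
  assumes "J \<subseteq> {1..N}" "\<And>n I. n < 0 \<Longrightarrow> a n I vac = 0" "\<And>n I. n < 0 \<Longrightarrow> b n I vac = 0"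
  shows "nprod N j J a b 0 {} vac = sigma N J *\<^sub>C a (- 1 - j) ({1..N} - J) (b 0 {} vac)"
  unfolding nprod_eq[OF a b assms(1)] component_prod_def
  by (simp add: nth_prod_vacuum[OF sfieldD(4)[OF a(1)] sfieldD(4)[OF b(1)]] assms sign_exponent_def sigma_def eps_inversions)

lemma nprod_super_local:
  assumes J: "J \<subseteq> {1..N}" and c: "sfield N c"
    and ac: "super_local N p s r1 a c" and bc: "super_local N q s r2 b c"
  shows "\<exists>r'. super_local N (p + q + par ({1..N} - J)) s r' (nprod N j J a b) c"
proof -
  define r0 where "r0 = max (max r (nat (j + 1))) (max r1 r2)"
  have j: "j < int r0"
    by (use r0_def in linarith)
  have l: "super_local N p q r0 a b" "super_local N p s r0 a c" "super_local N q s r0 b c"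
    using local_order ac bc by (auto intro: super_local_mono simp: r0_def)
  have "super_local N (p + q + par ({1..N} - J)) s (r0 + nat (int r0 - 1 - j) + r0) (nprod N j J a b) c"
    unfolding super_local_def
  proof (intro allI impI)
    fix K M assume K: "K \<subseteq> {1..N}" and M: "M \<subseteq> {1..N}"
    have "local_order (r0 + nat (int r0 - 1 - j) + r0) (koszul ((p + q + par ({1..N} - J) + par K) * (s + par M)))
      (component_prod p q j a b ({1..N} - (J - K')) (K - K')) (\<lambda>n. c n M)" if "K' \<in> Pow (K \<inter> J)" for K'
    proof -
      let ?I = "{1..N} - (J - K')" and ?K = "K - K'"
      have sub: "?I \<subseteq> {1..N}" "?K \<subseteq> {1..N}"
        using K by auto
      have "local_order (r0 + nat (int r0 - 1 - j) + r0)
        (koszul ((p + par ?I) * (s + par M)) * koszul ((q + par ?K) * (s + par M)))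
        (component_prod p q j a b ?I ?K) (\<lambda>n. c n M)"
        unfolding component_prod_def
        by (rule dong[OF sfieldD(4)[OF a(1)] sfieldD(4)[OF b(1)] sfieldD(4)[OF c] _ _ _ j])
          (use l sub M in \<open>simp_all only: super_local_def\<close>)
      moreover have "koszul ((p + par ?I) * (s + par M)) * koszul ((q + par ?K) * (s + par M)) =
        koszul ((p + q + par ({1..N} - J) + par K) * (s + par M))"
        unfolding koszul_add[symmetric] distrib_right[symmetric]
        using that by (subst parity_split[OF J K, symmetric]) auto
      ultimately show ?thesis
        by simp
    qed
    then have "local_order (r0 + nat (int r0 - 1 - j) + r0) (koszul ((p + q + par ({1..N} - J) + par K) * (s + par M)))
      (\<lambda>n v. \<Sum>K'\<in>Pow (K \<inter> J). koszul (sign_exponent p (J - K') ({1..N} - (J - K')) K' (K - K')) *\<^sub>C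
        component_prod p q j a b ({1..N} - (J - K')) (K - K') n v) (\<lambda>n. c n M)"
      by (rule local_order_sum[OF _ sfieldD(1)[OF c]])
    then show "local_order (r0 + nat (int r0 - 1 - j) + r0) (koszul ((p + q + par ({1..N} - J) + par K) * (s + par M)))
      (\<lambda>n. nprod N j J a b n K) (\<lambda>n. c n M)"
      unfolding nprod_fun_eq[OF J] .
  qed
  then show ?thesis
    by blast
qed

lemma nprod_S_covariant:
  assumes J: "J \<subseteq> {1..N}" and i: "i \<in> {1..N}" and S: "endo S" "S_covariant p i S a" "S_covariant q i S b"
  shows "S_covariant (p + q + par ({1..N} - J)) i S (nprod N j J a b)"
  unfolding S_covariant_def
proof (intro allI)
  fix m K v
  let ?pp = "p + q + par ({1..N} - J)"
  show "koszul (par K) *\<^sub>C S (nprod N j J a b m K v) - koszul ?pp *\<^sub>C nprod N j J a b m K (S v) =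
    d_odd i (nprod N j J a b) m K v"
  proof (cases "K \<subseteq> {1..N}")
    case False
    then have "\<not> insert i K \<subseteq> {1..N}"
      by blast
    with False show ?thesis
      by (simp add: nprod_outside[OF J] d_odd_def endo_zero[OF S(1)])
  next
    case K: True
    have fin: "finite K" "finite J"
      using K J finite_subset by blast+
    define I2 where "I2 X = {1..N} - (J - X)" for X
    define c where "c K X = koszul (sign_exponent p (J - X) (I2 X) X (K - X))" for K X
    define n where "n I K = component_prod p q j a b I K m v" for I K
    define t1 where "t1 X = (if i \<in> I2 X then 0 else koszul (par (I2 X) + below i (I2 X)) *\<^sub>C n (insert i (I2 X)) (K - X))" for X
    define t2 where "t2 X = (if i \<in> K - X then 0 else
      koszul (p + par (I2 X) + (par (K - X) + below i (K - X))) *\<^sub>C n (I2 X) (insert i (K - X)))" for X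
    have eq: "nprod N j J a b m L w = (\<Sum>X\<in>Pow (L \<inter> J). c L X *\<^sub>C component_prod p q j a b (I2 X) (L - X) m w)" for L w
      unfolding c_def I2_def by (rule nprod_eq[OF a b J])
    have finI: "finite (I2 X)" for X
      by (simp add: I2_def)
    have "S (nprod N j J a b m K v) = (\<Sum>X\<in>Pow (K \<inter> J). c K X *\<^sub>C
      (koszul (?pp + par K) *\<^sub>C component_prod p q j a b (I2 X) (K - X) m (S v) + (t1 X + t2 X)))"
      unfolding eq endo_sum[OF S(1)] endo_scale[OF S(1)]
    proof (rule sum.cong[OF refl])
      fix X assume X: "X \<in> Pow (K \<inter> J)"
      have "S (component_prod p q j a b (I2 X) (K - X) m v) =
        koszul ((p + par (I2 X)) + (q + par (K - X))) *\<^sub>C component_prod p q j a b (I2 X) (K - X) m (S v) + (t1 X + t2 X)"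
        unfolding t1_def t2_def n_def by (rule component_prod_leibniz[OF _ _ S]) (use K in \<open>auto simp: I2_def\<close>)
      also have "(p + par (I2 X)) + (q + par (K - X)) = ?pp + par K"
        unfolding I2_def by (rule parity_split[OF J K]) (use X in blast)
      finally show "c K X *\<^sub>C S (component_prod p q j a b (I2 X) (K - X) m v) = c K X *\<^sub>C
        (koszul (?pp + par K) *\<^sub>C component_prod p q j a b (I2 X) (K - X) m (S v) + (t1 X + t2 X))"
        by simp
    qed
    also have "\<dots> = koszul (?pp + par K) *\<^sub>C nprod N j J a b m K (S v) + (\<Sum>X\<in>Pow (K \<inter> J). c K X *\<^sub>C (t1 X + t2 X))"
      unfolding eq by (simp only: complex_vector.scale_right_distrib sum.distrib
          complex_vector.scale_sum_right complex_vector.scale_left_commute)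
    finally have "koszul (par K) *\<^sub>C S (nprod N j J a b m K v) - koszul ?pp *\<^sub>C nprod N j J a b m K (S v) =
      koszul (par K) *\<^sub>C (\<Sum>X\<in>Pow (K \<inter> J). c K X *\<^sub>C (t1 X + t2 X))"
      by (simp add: complex_vector.scale_right_distrib koszul_add mult.left_commute[of "koszul (par K)"])
    also have "\<dots> = d_odd i (nprod N j J a b) m K v"
    proof (cases "i \<in> K")
      case iK: True
      have "(\<Sum>X\<in>Pow (K \<inter> J). c K X *\<^sub>C (t1 X + t2 X)) = 0"
      proof (cases "i \<in> J")
        case False
        then have "t1 X = 0" "t2 X = 0" if "X \<in> Pow (K \<inter> J)" for X
          using that iK i by (auto simp: t1_def t2_def I2_def)
        then show ?thesis
          by simp
      next
        case iJ: True
        define B where "B = K \<inter> J - {i}"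
        have B: "K \<inter> J = insert i B" "i \<notin> B" "finite B"
          using iJ iK fin by (auto simp: B_def)
        have "c K X *\<^sub>C (t1 X + t2 X) + c K (insert i X) *\<^sub>C (t1 (insert i X) + t2 (insert i X)) = 0"
          if X: "X \<in> Pow B" for X
        proof -
          define I0 where "I0 = J - insert i X"
          define K0 where "K0 = K - insert i X"
          have iX: "i \<notin> X" "finite X" "finite I0" "finite K0" "i \<notin> I0" "i \<notin> K0"
            using X B fin finite_subset by (auto simp: I0_def K0_def)
          have e: "J - X = insert i I0" "I2 (insert i X) = insert i (I2 X)" "K - X = insert i K0" "i \<notin> I2 X"
            using iX iJ iK i by (auto simp: I0_def K0_def I2_def)
          let ?A = "sign_exponent p (insert i I0) (I2 X) X (insert i K0) + (par (I2 X) + below i (I2 X))"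
          let ?B = "sign_exponent p I0 (insert i (I2 X)) (insert i X) K0 + (p + par (insert i (I2 X)) + par K0 + below i K0)"
          have 1: "c K X *\<^sub>C (t1 X + t2 X) = koszul ?A *\<^sub>C n (insert i (I2 X)) (insert i K0)"
            unfolding c_def t1_def t2_def e(1,3) using e(4) by (simp add: koszul_add)
          have 2: "c K (insert i X) *\<^sub>C (t1 (insert i X) + t2 (insert i X)) = koszul ?B *\<^sub>C n (insert i (I2 X)) (insert i K0)"
            unfolding c_def t1_def t2_def e(2) I0_def[symmetric] K0_def[symmetric]
            using iX(6) by (simp add: koszul_add mult.assoc)
          have "?A + ?B = 1"
            by (rule sign_exponent_cancel) (use iX e finI in simp_all)
          then have "koszul ?A + koszul ?B = 0"
            by (cases ?A; cases ?B) (simp_all add: bit_simps)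
          then show ?thesis
            unfolding 1 2 by (simp only: complex_vector.scale_left_distrib[symmetric] complex_vector.scale_zero_left)
        qed
        then show ?thesis
          unfolding B(1) sum_Pow_insert[OF B(3,2)] by simp
      qed
      then show ?thesis
        using iK by (simp add: d_odd_def)
    next
      case iK: False
      let ?d = "\<lambda>X. koszul (below i K) *\<^sub>C c (insert i K) X *\<^sub>C n (I2 X) (insert i K - X)"
      have d: "d_odd i (nprod N j J a b) m K v = (\<Sum>X\<in>Pow (insert i K \<inter> J). ?d X)"
        using iK unfolding d_odd_def eq n_def[symmetric]
        by (simp add: eps_inversions below_def complex_vector.scale_sum_right)
      have split: "par K = par X + par (K - X)" "below i K = below i X + below i (K - X)" if "X \<subseteq> K" for X
      proof -
        have "K = X \<union> (K - X)" "finite X"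
          using that fin finite_subset by blast+
        then show "par K = par X + par (K - X)" "below i K = below i X + below i (K - X)"
          using par_union[of X "K - X"] below_disjoint_union[of X "K - X" i] fin by auto
      qed
      have T2: "koszul (par K) *\<^sub>C c K X *\<^sub>C t2 X = ?d X" if X: "X \<in> Pow (K \<inter> J)" for X
      proof -
        have X': "X \<subseteq> K" "i \<notin> X" "finite X" "insert i K - X = insert i (K - X)"
          using X iK fin finite_subset by blast+
        let ?k = "sign_exponent p (J - X) (I2 X) X (K - X)"
        let ?E = "p + par (I2 X) + (par (K - X) + below i (K - X))"
        have "sign_exponent p (J - X) (I2 X) X (insert i (K - X)) + below i X + below i (K - X) =
          ?k + (p + par (I2 X) + par (K - X) + below i (K - X)) + (par X + par (K - X))"
          by (rule sign_exponent_insert_K2) (use X' iK fin in auto)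
        then have "par K + (?k + ?E) = below i K + sign_exponent p (J - X) (I2 X) X (insert i (K - X))"
          unfolding split[OF X'(1)] by (simp only: ac_simps)
        then have "koszul (par K) * (koszul ?k * koszul ?E) =
          koszul (below i K) * koszul (sign_exponent p (J - X) (I2 X) X (insert i (K - X)))"
          by (simp only: koszul_add[symmetric])
        then show ?thesis
          using iK unfolding t2_def c_def X'(4) by simp
      qed
      show ?thesis
      proof (cases "i \<in> J")
        case False
        then have "t1 X = 0" for X
          using i by (simp add: t1_def I2_def)
        moreover have "insert i K \<inter> J = K \<inter> J"
          using False by blast
        ultimately show ?thesis
          unfolding d complex_vector.scale_sum_right by (intro sum.cong) (simp_all only: T2 add_0_left)
      next
        case iJ: True
        have T1: "koszul (par K) *\<^sub>C c K X *\<^sub>C t1 X = ?d (insert i X)" if X: "X \<in> Pow (K \<inter> J)" for X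
        proof -
          define I0 where "I0 = J - insert i X"
          have X': "X \<subseteq> K" "i \<notin> X" "finite X" "insert i K - insert i X = K - X" "i \<notin> I0" "finite I0"
            using X iK fin finite_subset by (auto simp: I0_def)
          have e: "J - X = insert i I0" "I2 (insert i X) = insert i (I2 X)" "i \<notin> I2 X"
            using X' iJ i by (auto simp: I0_def I2_def)
          let ?k = "sign_exponent p (insert i I0) (I2 X) X (K - X)"
          let ?k' = "sign_exponent p I0 (insert i (I2 X)) (insert i X) (K - X)"
          let ?E = "par (I2 X) + below i (I2 X)"
          have "?k' + below i X + below i (K - X) = ?k + ?E + (par X + par (K - X))"
            by (rule sign_exponent_move) (use X' iK fin finI e in auto)
          then have "par K + (?k + ?E) = below i K + ?k'"
            unfolding split[OF X'(1)] by (simp only: ac_simps)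
          then have "koszul (par K) * (koszul ?k * koszul ?E) = koszul (below i K) * koszul ?k'"
            by (simp only: koszul_add[symmetric])
          then show ?thesis
            using e(3) unfolding t1_def c_def X'(4) e(1,2) I0_def[symmetric] by simp
        qed
        have *: "insert i K \<inter> J = insert i (K \<inter> J)" "i \<notin> K \<inter> J" "finite (K \<inter> J)"
          using iJ iK fin by auto
        show ?thesis
          unfolding d *(1) sum_Pow_insert[OF *(3,2)] complex_vector.scale_sum_right
          by (intro sum.cong refl)
            (simp only: complex_vector.scale_right_distrib T1 T2 add.commute)
      qed
    qed
    finally show ?thesis .
  qed
qed

end

section \<open>Goddard uniqueness\<close>

lemma zw_mult_pow_eq_0_imp:
  assumes "bounded_right Y" "(zw_mult ^^ r) Y = (\<lambda>_ _. 0)"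
  shows "Y = (\<lambda>_ _. 0)"
  using assms(2)
proof (induction r)
  case (Suc r)
  let ?Z = "(zw_mult ^^ r) Y"
  have step: "?Z p q = ?Z (p + 1) (q - 1)" for p q
  proof -
    have "zw_mult ?Z (p + 1) q = 0"
      using Suc.prems by simp
    then show ?thesis
      by (simp add: zw_mult_def)
  qed
  obtain M where M: "\<And>p q. q < M \<Longrightarrow> ?Z p q = 0"
    using bounded_right_zw_mult_pow[OF assms(1), of r] unfolding bounded_right_def by blast
  have Z: "?Z p (M - 1 + int k) = 0" for p k
  proof (induction k arbitrary: p)
    case (Suc k)
    then show ?case
      by (subst step) (simp add: algebra_simps)
  qed (simp add: M)
  have "?Z p q = 0" for p q
    using M[of q p] Z[of p "nat (q - M + 1)"] by (cases "q < M") auto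
  then show ?case
    using Suc.IH by blast
qed simp

text \<open>The step of Goddard's uniqueness argument: \<open>(z - w)\<close> is cancelled from \<open>(z - w)\<^sup>r x(z) f(w) u = 0\<close>,
  which is legitimate because \<open>f(w) u\<close> is bounded below in \<open>w\<close>.\<close>

lemma local_order_annihilates:
  assumes "local_order r e x f" "\<And>n. endo (x n)" "even_field f" "\<And>n. x n u = 0"
  shows "x n (f m u) = 0"
proof -
  obtain M where "\<forall>q<M. f q u = 0"
    using assms(3) unfolding even_field_def by blast
  then have "bounded_right (\<lambda>p q. x p (f q u))"
    unfolding bounded_right_def using endo_zero[OF assms(2)] by (intro exI[of _ M]) simp
  moreover have "f q 0 = 0" for q
    using assms(3) endo_zero unfolding even_field_def by blast
  then have "(zw_mult ^^ r) (\<lambda>p q. x p (f q u)) = (\<lambda>_ _. 0)"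
    using assms(1,4) unfolding local_order_def by (auto dest: spec[of _ u])
  ultimately have "(\<lambda>p q. x p (f q u)) = (\<lambda>_ _. 0)"
    by (rule zw_mult_pow_eq_0_imp)
  then show ?thesis
    by meson
qed

definition lincomb :: "complex \<Rightarrow> 'v::complex_superspace series \<Rightarrow> complex \<Rightarrow> 'v series \<Rightarrow> 'v series" where
  "lincomb x X y Y n I v = x *\<^sub>C X n I v + y *\<^sub>C Y n I v"

lemma sfield_lincomb:
  assumes "sfield N X" "sfield N Y"
  shows "sfield N (lincomb x X y Y)"
proof -
  have "even_field (\<lambda>n v. x *\<^sub>C X n I v + y *\<^sub>C Y n I v)" for I
    by (intro even_field_add even_field_scale[OF sfieldD(4)[OF assms(1)]] even_field_scale[OF sfieldD(4)[OF assms(2)]])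
  then have "even_field (\<lambda>n. lincomb x X y Y n I)" for I
    by (simp add: lincomb_def[abs_def])
  moreover have "lincomb x X y Y n I v = 0" if "\<not> I \<subseteq> {1..N}" for n I v
    by (simp only: lincomb_def sfieldD(2)[OF assms(1) that] sfieldD(2)[OF assms(2) that]
        complex_vector.scale_zero_right add_0_left)
  ultimately show ?thesis
    unfolding sfield_def by (intro conjI allI impI ext) (simp_all add: even_field_def)
qed

lemma series_parity_lincomb:
  "series_parity N p X \<Longrightarrow> series_parity N p Y \<Longrightarrow> series_parity N p (lincomb x X y Y)"
  unfolding series_parity_def endo_parity_def lincomb_def
  by (intro allI impI ballI grade_add grade_scaleC) simp_all

lemma T_covariant_lincomb:
  assumes "endo T" "T_covariant T X" "T_covariant T Y"
  shows "T_covariant T (lincomb x X y Y)"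
  unfolding T_covariant_def
proof (intro allI)
  fix n I v
  have "T (lincomb x X y Y n I v) - lincomb x X y Y n I (T v) =
    x *\<^sub>C (T (X n I v) - X n I (T v)) + y *\<^sub>C (T (Y n I v) - Y n I (T v))"
    using assms(1) by (simp add: lincomb_def endo_simps complex_vector.scale_right_diff_distrib)
  also have "\<dots> = of_int (n + 1) *\<^sub>C lincomb x X y Y (n + 1) I v"
    using assms(2,3) unfolding T_covariant_def lincomb_def
    by (simp only: complex_vector.scale_right_distrib complex_vector.scale_left_commute)
  finally show "T (lincomb x X y Y n I v) - lincomb x X y Y n I (T v) =
    of_int (n + 1) *\<^sub>C lincomb x X y Y (n + 1) I v" .
qed

lemma S_covariant_lincomb:
  assumes "endo S" "S_covariant p i S X" "S_covariant p i S Y"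
  shows "S_covariant p i S (lincomb x X y Y)"
  unfolding S_covariant_def
proof (intro allI)
  fix n I v
  have "koszul (par I) *\<^sub>C S (lincomb x X y Y n I v) - koszul p *\<^sub>C lincomb x X y Y n I (S v) =
    x *\<^sub>C (koszul (par I) *\<^sub>C S (X n I v) - koszul p *\<^sub>C X n I (S v)) +
    y *\<^sub>C (koszul (par I) *\<^sub>C S (Y n I v) - koszul p *\<^sub>C Y n I (S v))"
    using assms(1)
    by (simp add: lincomb_def endo_simps complex_vector.scale_right_diff_distrib
        complex_vector.scale_right_distrib mult.commute)
  also have "\<dots> = x *\<^sub>C d_odd i X n I v + y *\<^sub>C d_odd i Y n I v"
    using assms(2,3) unfolding S_covariant_def by simp
  also have "\<dots> = d_odd i (lincomb x X y Y) n I v"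
    by (simp add: d_odd_def lincomb_def complex_vector.scale_right_distrib mult.commute)
  finally show "koszul (par I) *\<^sub>C S (lincomb x X y Y n I v) - koszul p *\<^sub>C lincomb x X y Y n I (S v) =
    d_odd i (lincomb x X y Y) n I v" .
qed

lemma local_order_lincomb:
  assumes "local_order r e a c" "local_order r e b c" "\<And>n. endo (c n)"
  shows "local_order r e (\<lambda>n v. x *\<^sub>C a n v + y *\<^sub>C b n v) c"
  using local_order_sum[of UNIV r e "\<lambda>i. if i then a else b" c "\<lambda>i. if i then x else y"] assms
  by (simp add: UNIV_bool add.commute)

lemma local_pair_lincomb:
  assumes "sfield N X" "series_parity N p X" "sfield N Y" "series_parity N p Y"
    and "sfield N Z" "series_parity N q Z" "local_pair N X Z" "local_pair N Y Z"
  shows "local_pair N (lincomb x X y Y) Z"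
proof -
  obtain r1 r2 where "super_local N p q r1 X Z" "super_local N p q r2 Y Z"
    using assms local_pair_iff by blast
  then have "super_local N p q (max r1 r2) X Z" "super_local N p q (max r1 r2) Y Z"
    by (auto intro: super_local_mono)
  then have "super_local N p q (max r1 r2) (lincomb x X y Y) Z"
    unfolding super_local_def lincomb_def[abs_def] using sfieldD(1)[OF assms(5)] by (simp add: local_order_lincomb)
  then show ?thesis
    using local_pair_iff[OF sfield_lincomb[OF assms(1,3)] series_parity_lincomb[OF assms(2,4)] assms(5,6)]
    by blast
qed

lemma local_pair_sym:
  assumes "sfield N a" "series_parity N p a" "sfield N b" "series_parity N q b" "local_pair N a b"
  shows "local_pair N b a"
  using assms local_pair_iff[OF assms(1-4)] local_pair_iff[OF assms(3,4,1,2)] super_local_sym by blast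

lemma zero_series:
  "sfield N (\<lambda>_ _ _. 0)" "series_parity N p (\<lambda>_ _ _. 0)"
  "endo T \<Longrightarrow> T_covariant T (\<lambda>_ _ _. 0)" "endo S \<Longrightarrow> S_covariant q i S (\<lambda>_ _ _. 0)"
  "sfield N Z \<Longrightarrow> series_parity N q Z \<Longrightarrow> local_pair N (\<lambda>_ _ _. 0) Z"
proof -
  show 1: "sfield N (\<lambda>_ _ _. 0)" "series_parity N p (\<lambda>_ _ _. 0)" for p
    by (simp_all add: sfield_def endo_zero_fun series_parity_def endo_parity_def grade_zero)
  show "endo T \<Longrightarrow> T_covariant T (\<lambda>_ _ _. 0)" "endo S \<Longrightarrow> S_covariant q i S (\<lambda>_ _ _. 0)"
    by (simp_all add: T_covariant_def S_covariant_def d_odd_def endo_zero)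
  assume Z: "sfield N Z" "series_parity N q Z"
  have "super_local N 0 q 0 (\<lambda>_ _ _. 0) Z"
    unfolding super_local_def by (intro allI impI local_order_zero sfieldD(1)[OF Z(1)])
  then show "local_pair N (\<lambda>_ _ _. 0) Z"
    using local_pair_iff[OF 1 Z] by blast
qed

lemma id_series:
  "sfield N id_series" "series_parity N 0 id_series"
  "endo T \<Longrightarrow> T_covariant T id_series" "endo S \<Longrightarrow> S_covariant 0 i S id_series"
  "sfield N Z \<Longrightarrow> series_parity N q Z \<Longrightarrow> local_pair N id_series Z"
proof -
  show 1: "sfield N id_series" "series_parity N 0 id_series"
    by (auto simp: sfield_def id_series_def series_parity_def endo_parity_def grade_zero fun_eq_iff
        intro!: endoI)
  show "endo T \<Longrightarrow> T_covariant T id_series"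
    by (auto simp: T_covariant_def id_series_def endo_zero eq_neg_iff_add_eq_0[symmetric])
  show "endo S \<Longrightarrow> S_covariant 0 i S id_series"
    by (simp add: S_covariant_def id_series_def d_odd_def endo_zero)
  assume Z: "sfield N Z" "series_parity N q Z"
  have "super_local N 0 q 0 id_series Z"
    unfolding super_local_def local_order_def
    by (auto simp: id_series_def fun_eq_iff sfieldD(3)[OF Z(1)])
  then show "local_pair N id_series Z"
    using local_pair_iff[OF 1 Z] by blast
qed

text \<open>By truncation there is a lowest nonzero coefficient of \<open>X(z)|0\<rangle>\<close>, and translation covariance
  forces its exponent to be nonnegative.\<close>

lemma vacuum_regular:
  assumes "sfield N X" "endo T" "T_covariant T X" "T vac = 0" "n < 0"
  shows "X n I vac = 0"
proof -
  obtain M where M: "\<And>n. n < M \<Longrightarrow> X n I vac = 0"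
    using assms(1) unfolding sfield_def by blast
  have "M - 1 + int k < 0 \<longrightarrow> X (M - 1 + int k) I vac = 0" for k
  proof (induction k)
    case (Suc k)
    let ?m = "M - 1 + int k"
    have "of_int (?m + 1) *\<^sub>C X (?m + 1) I vac = T (X ?m I vac) - X ?m I (T vac)"
      using assms(3) unfolding T_covariant_def by simp
    with Suc show ?case
      using assms(4) by (auto simp: endo_zero[OF assms(2)] sfieldD(3)[OF assms(1)] add.commute
          of_int_add[symmetric] simp del: of_int_add)
  qed (simp add: M)
  from this[of "nat (n - (M - 1))"] show ?thesis
    using M[of n] assms(5) by (cases "n < M") auto
qed

lemma vacuum_zero:
  assumes X: "sfield N X" and T: "endo T" "T_covariant T X" "T vac = 0"
    and S: "\<And>i. i \<in> {1..N} \<Longrightarrow> endo (S i)" "\<And>i. i \<in> {1..N} \<Longrightarrow> S_covariant p i (S i) X"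
      "\<And>i. i \<in> {1..N} \<Longrightarrow> S i vac = 0"
    and "X 0 {} vac = 0"
  shows "X n I vac = 0"
proof (cases "I \<subseteq> {1..N}")
  case True
  have nonneg: "X (int k) {} vac = 0" for k
  proof (induction k)
    case (Suc k)
    have "of_int (int k + 1) *\<^sub>C X (int k + 1) {} vac = T (X (int k) {} vac) - X (int k) {} (T vac)"
      using T(2) unfolding T_covariant_def by simp
    also have "\<dots> = 0"
      by (simp add: Suc T endo_zero sfieldD(3)[OF X])
    finally have "of_int (int k + 1) *\<^sub>C X (int k + 1) {} vac = 0" .
    moreover have "of_int (int k + 1) \<noteq> (0 :: complex)"
      unfolding of_int_eq_0_iff by linarith
    ultimately have "X (int k + 1) {} vac = 0"
      unfolding complex_vector.scale_eq_0_iff by blast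
    then show ?case
      by (simp only: of_nat_Suc add.commute)
  qed (simp add: assms(8))
  have base: "X n {} vac = 0" for n
    using vacuum_regular[OF X T, of n "{}"] nonneg[of "nat n"] by (cases "n < 0") auto
  have "finite I"
    using True finite_subset by blast
  then show ?thesis
    using True
  proof (induction I arbitrary: n)
    case (insert i I)
    then have i: "i \<in> {1..N}" and IH: "X n I vac = 0"
      by auto
    have "d_odd i X n I vac = koszul (par I) *\<^sub>C S i (X n I vac) - koszul p *\<^sub>C X n I (S i vac)"
      using S(2)[OF i] unfolding S_covariant_def by simp
    also have "\<dots> = 0"
      by (simp add: IH S(3)[OF i] endo_zero[OF S(1)[OF i]] sfieldD(3)[OF X])
    finally have "d_odd i X n I vac = 0" .
    then show ?case
      using insert.hyps(2) by (simp add: d_odd_def eps_inversions koszul_def split: if_splits)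
  qed (simp add: base)
qed (simp add: sfieldD(2)[OF X])

lemma sigma_square: "sigma N J * sigma N J = 1"
  by (simp add: sigma_def eps_inversions)

section \<open>The reconstruction\<close>

locale generating_fields =
  fixes N :: nat and vac :: "'v::complex_superspace" and T :: "'v \<Rightarrow> 'v" and S :: "nat \<Rightarrow> 'v \<Rightarrow> 'v"
    and A :: "'i set" and F :: "'i \<Rightarrow> 'v series" and gen :: "'i \<Rightarrow> 'v"
  assumes vac_even: "vac \<in> grade 0"
    and T_even: "endo T" "endo_parity 0 T"
    and S_odd: "\<And>i. i \<in> {1..N} \<Longrightarrow> endo (S i)" "\<And>i. i \<in> {1..N} \<Longrightarrow> endo_parity 1 (S i)"
    and T_vac: "T vac = 0"
    and S_vac: "\<And>i. i \<in> {1..N} \<Longrightarrow> S i vac = 0"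
    and F_field: "\<And>\<alpha>. \<alpha> \<in> A \<Longrightarrow> sfield N (F \<alpha>)"
    and F_homogeneous: "\<And>\<alpha>. \<alpha> \<in> A \<Longrightarrow> \<exists>p. series_parity N p (F \<alpha>)"
    and F_vacuum: "\<And>\<alpha>. \<alpha> \<in> A \<Longrightarrow> creates vac (F \<alpha>) (gen \<alpha>)"
    and F_T: "\<And>\<alpha>. \<alpha> \<in> A \<Longrightarrow> bracket N 0 T (F \<alpha>) = d_even (F \<alpha>)"
    and F_S: "\<And>\<alpha> i. \<alpha> \<in> A \<Longrightarrow> i \<in> {1..N} \<Longrightarrow> bracket N 1 (S i) (F \<alpha>) = d_odd i (F \<alpha>)"
    and F_local: "\<And>\<alpha> \<beta>. \<alpha> \<in> A \<Longrightarrow> \<beta> \<in> A \<Longrightarrow> local_pair N (F \<alpha>) (F \<beta>)"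
    and span: "complex_vector.span (word_vector N F vac ` mode_words N A) = UNIV"
begin

definition commutant :: "bit \<Rightarrow> 'v series \<Rightarrow> bool" where
  "commutant p X \<longleftrightarrow> sfield N X \<and> series_parity N p X \<and> (\<forall>\<alpha>\<in>A. local_pair N X (F \<alpha>))"

definition covariant :: "bit \<Rightarrow> 'v series \<Rightarrow> bool" where
  "covariant p X \<longleftrightarrow> commutant p X \<and> T_covariant T X \<and> (\<forall>i\<in>{1..N}. S_covariant p i (S i) X)"

text \<open>Fields local with everything local with the generating family. Two such fields are mutually
  local because they lie in both commutants.\<close>

definition vertex :: "bit \<Rightarrow> 'v series \<Rightarrow> bool" where
  "vertex p X \<longleftrightarrow> covariant p X \<and> (\<forall>q Z. commutant q Z \<longrightarrow> local_pair N X Z)"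

lemma commutantD:
  assumes "commutant p X"
  shows "sfield N X" "series_parity N p X" "\<alpha> \<in> A \<Longrightarrow> local_pair N X (F \<alpha>)"
  using assms unfolding commutant_def by auto

lemma covariantD:
  assumes "covariant p X"
  shows "commutant p X" "sfield N X" "series_parity N p X" "T_covariant T X" "i \<in> {1..N} \<Longrightarrow> S_covariant p i (S i) X"
  using assms unfolding covariant_def commutant_def by auto

lemma vertexD:
  assumes "vertex p X"
  shows "covariant p X" "commutant p X" "commutant q Z \<Longrightarrow> local_pair N X Z"
  using assms unfolding vertex_def covariant_def by auto

lemma vertex_local: "vertex p X \<Longrightarrow> vertex q Z \<Longrightarrow> local_pair N X Z"
  using vertexD by blast

lemma covariant_lincomb:
  assumes "covariant p X" "covariant p Y"
  shows "covariant p (lincomb x X y Y)"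
proof -
  have "local_pair N (lincomb x X y Y) (F \<alpha>)" if \<alpha>: "\<alpha> \<in> A" for \<alpha>
  proof -
    obtain q where q: "series_parity N q (F \<alpha>)"
      using F_homogeneous[OF \<alpha>] by blast
    show ?thesis
      by (rule local_pair_lincomb[OF covariantD(2,3)[OF assms(1)] covariantD(2,3)[OF assms(2)]
            F_field[OF \<alpha>] q])
        (rule commutantD(3)[OF covariantD(1)[OF assms(1)] \<alpha>] commutantD(3)[OF covariantD(1)[OF assms(2)] \<alpha>])+
  qed
  then show ?thesis
    using assms unfolding covariant_def commutant_def
    by (intro conjI ballI sfield_lincomb series_parity_lincomb T_covariant_lincomb T_even S_covariant_lincomb S_odd) blast+
qed

lemma vertex_lincomb:
  assumes "vertex p X" "vertex p Y"
  shows "vertex p (lincomb x X y Y)"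
proof -
  note X = vertexD[OF assms(1)] and Y = vertexD[OF assms(2)]
  have "local_pair N (lincomb x X y Y) Z" if "commutant q Z" for q Z
    using local_pair_lincomb[OF commutantD(1,2)[OF X(2)] commutantD(1,2)[OF Y(2)] commutantD(1,2)[OF that]]
      X(3)[OF that] Y(3)[OF that] by blast
  then show ?thesis
    using covariant_lincomb[OF X(1) Y(1)] unfolding vertex_def by blast
qed

lemma F_commutant: "\<alpha> \<in> A \<Longrightarrow> series_parity N p (F \<alpha>) \<Longrightarrow> commutant p (F \<alpha>)"
  unfolding commutant_def using F_field F_local by blast

lemma F_vertex:
  assumes "\<alpha> \<in> A" "series_parity N p (F \<alpha>)"
  shows "vertex p (F \<alpha>)"
proof -
  have "local_pair N (F \<alpha>) Z" if "commutant q Z" for q Z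
    using local_pair_sym[OF commutantD(1,2)[OF that] F_field[OF assms(1)] assms(2)] commutantD(3)[OF that assms(1)]
    by blast
  moreover have "T_covariant T (F \<alpha>)"
    using bracket_even_iff[OF F_field[OF assms(1)] assms(2) T_even(1)] F_T[OF assms(1)] by blast
  moreover have "S_covariant p i (S i) (F \<alpha>)" if "i \<in> {1..N}" for i
    using bracket_odd_iff[OF F_field[OF assms(1)] assms(2) S_odd(1)[OF that]] F_S[OF assms(1) that] by blast
  ultimately show ?thesis
    using F_commutant[OF assms] unfolding vertex_def covariant_def by blast
qed

lemma zero_vertex: "vertex p (\<lambda>_ _ _. 0)"
proof -
  have "local_pair N (\<lambda>_ _ _. 0) (F \<alpha>)" if "\<alpha> \<in> A" for \<alpha>
    using zero_series(5) F_field F_homogeneous that by blast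
  moreover have "local_pair N (\<lambda>_ _ _. 0) Z" if "commutant q Z" for q Z
    using zero_series(5) commutantD(1,2)[OF that] by blast
  ultimately show ?thesis
    unfolding vertex_def covariant_def commutant_def
    using zero_series(1-4) T_even(1) S_odd(1) by blast
qed

lemma id_vertex: "vertex 0 id_series"
proof -
  have "local_pair N id_series (F \<alpha>)" if "\<alpha> \<in> A" for \<alpha>
    using id_series(5) F_field F_homogeneous that by blast
  moreover have "local_pair N id_series Z" if "commutant q Z" for q Z
    using id_series(5) commutantD(1,2)[OF that] by blast
  ultimately show ?thesis
    unfolding vertex_def covariant_def commutant_def
    using id_series(1-4) T_even(1) S_odd(1) by blast
qed

lemma nprod_vertex:
  assumes \<alpha>: "\<alpha> \<in> A" "series_parity N p (F \<alpha>)" and X: "vertex q X" and J: "J \<subseteq> {1..N}"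
  shows "vertex (p + q + par ({1..N} - J)) (nprod N j J (F \<alpha>) X)"
proof -
  note Fv = vertexD[OF F_vertex[OF \<alpha>]] and Xv = vertexD[OF X]
  note Ff = commutantD(1,2)[OF Fv(2)] and Xf = commutantD(1,2)[OF Xv(2)]
  have "local_pair N (F \<alpha>) X"
    using Fv(3)[OF Xv(2)] .
  then obtain r where "super_local N p q r (F \<alpha>) X"
    using local_pair_iff[OF Ff Xf] by blast
  then interpret local_field_pair N p q r "F \<alpha>" X
    using Ff Xf by unfold_locales
  let ?P = "nprod N j J (F \<alpha>) X"
  have P: "sfield N ?P" "series_parity N (p + q + par ({1..N} - J)) ?P"
    by (rule nprod_sfield[OF J] nprod_parity[OF J])+
  have local_order: "local_pair N ?P Z"
    if Z: "sfield N Z" "series_parity N s Z" and FZ: "local_pair N (F \<alpha>) Z" and XZ: "local_pair N X Z"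
    for s Z
  proof -
    obtain r1 r2 where "super_local N p s r1 (F \<alpha>) Z" "super_local N q s r2 X Z"
      using FZ XZ local_pair_iff[OF Ff Z] local_pair_iff[OF Xf Z] by blast
    then show ?thesis
      using nprod_super_local[OF J Z(1)] local_pair_iff[OF P Z] by blast
  qed
  have "local_pair N ?P (F \<beta>)" if "\<beta> \<in> A" for \<beta>
    using local_order[OF F_field[OF that]] F_homogeneous[OF that] F_local[OF \<alpha>(1) that] commutantD(3)[OF Xv(2) that]
    by blast
  moreover have "local_pair N ?P Z" if "commutant s Z" for s Z
    using local_order[OF commutantD(1,2)[OF that] Fv(3)[OF that] Xv(3)[OF that]] .
  moreover have "T_covariant T ?P"
    by (rule nprod_T_covariant[OF J T_even(1) covariantD(4)[OF Fv(1)] covariantD(4)[OF Xv(1)]])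
  moreover have "S_covariant (p + q + par ({1..N} - J)) i (S i) ?P" if "i \<in> {1..N}" for i
    by (rule nprod_S_covariant[OF J that S_odd(1)[OF that] covariantD(5)[OF Fv(1) that] covariantD(5)[OF Xv(1) that]])
  ultimately show ?thesis
    using P unfolding vertex_def covariant_def commutant_def by blast
qed

lemma covariant_regular: "covariant p X \<Longrightarrow> n < 0 \<Longrightarrow> X n I vac = 0"
  using vacuum_regular[OF covariantD(2) T_even(1) covariantD(4) T_vac] by blast

lemma nprod_vertex_vacuum:
  assumes "\<alpha> \<in> A" "vertex q X" "J \<subseteq> {1..N}"
  shows "nprod N j J (F \<alpha>) X 0 {} vac = sigma N J *\<^sub>C mode N (F \<alpha>) j J (X 0 {} vac)"
proof -
  obtain p where p: "series_parity N p (F \<alpha>)"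
    using F_homogeneous[OF assms(1)] by blast
  note Fv = vertexD[OF F_vertex[OF assms(1) p]] and Xv = vertexD[OF assms(2)]
  note Ff = commutantD(1,2)[OF Fv(2)] and Xf = commutantD(1,2)[OF Xv(2)]
  obtain r where "super_local N p q r (F \<alpha>) X"
    using local_pair_iff[OF Ff Xf] Fv(3)[OF Xv(2)] by blast
  then interpret local_field_pair N p q r "F \<alpha>" X
    using Ff Xf by unfold_locales
  show ?thesis
    unfolding mode_def
    by (rule nprod_vacuum[OF assms(3) covariant_regular[OF Fv(1)] covariant_regular[OF Xv(1)]])
qed

lemma word_Cons:
  "word_vector N F vac ((\<alpha>, j, J) # xs) = mode N (F \<alpha>) j J (word_vector N F vac xs)"
  "word_series N F ((\<alpha>, j, J) # xs) = nprod N j J (F \<alpha>) (word_series N F xs)"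
  "word_sign N ((\<alpha>, j, J) # xs) = sigma N J * word_sign N xs"
  by (simp_all add: word_vector_def word_series_def word_sign_def)

lemma mode_words_induct [consumes 1, case_names Nil Cons]:
  assumes "xs \<in> mode_words N A" "P []"
    and "\<And>\<alpha> j J xs. \<alpha> \<in> A \<Longrightarrow> J \<subseteq> {1..N} \<Longrightarrow> xs \<in> mode_words N A \<Longrightarrow> P xs \<Longrightarrow> P ((\<alpha>, j, J) # xs)"
  shows "P xs"
  using assms(1)[unfolded mode_words_def]
proof (induction rule: lists.induct)
  case (Cons x xs)
  obtain \<alpha> j J where "x = (\<alpha>, j, J)"
    by (cases x) blast
  then show ?case
    using assms(3)[of \<alpha> J xs j] Cons unfolding mode_words_def by simp
qed (fact assms(2))

lemma word_vertex:
  assumes "xs \<in> mode_words N A"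
  shows "(\<exists>p. vertex p (word_series N F xs)) \<and>
    word_sign N xs *\<^sub>C word_series N F xs 0 {} vac = word_vector N F vac xs"
  using assms
proof (induction rule: mode_words_induct)
  case Nil
  then show ?case
    using id_vertex by (auto simp: word_series_def word_sign_def word_vector_def) (simp add: id_series_def)
next
  case (Cons \<alpha> j J xs)
  then obtain q where q: "vertex q (word_series N F xs)"
    by blast
  obtain p where p: "series_parity N p (F \<alpha>)"
    using F_homogeneous[OF Cons.hyps(1)] by blast
  have "endo (mode N (F \<alpha>) j J)"
    unfolding mode_def by (rule sfieldD(1)[OF F_field[OF Cons.hyps(1)]])
  then have "word_sign N xs *\<^sub>C mode N (F \<alpha>) j J (word_series N F xs 0 {} vac) =
      mode N (F \<alpha>) j J (word_vector N F vac xs)"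
    using Cons.IH by (simp flip: endo_scale)
  moreover have "sigma N J * word_sign N xs * sigma N J = word_sign N xs"
    using sigma_square[of N J] by (simp add: mult_ac)
  ultimately have "(sigma N J * word_sign N xs) *\<^sub>C sigma N J *\<^sub>C
      mode N (F \<alpha>) j J (word_series N F xs 0 {} vac) = mode N (F \<alpha>) j J (word_vector N F vac xs)"
    by (simp only: complex_vector.scale_scale)
  then show ?case
    unfolding word_Cons nprod_vertex_vacuum[OF Cons.hyps(1) q Cons.hyps(2)]
    using nprod_vertex[OF Cons.hyps(1) p q Cons.hyps(2), of j] by blast
qed

lemma goddard:
  assumes "covariant p X" "X 0 {} vac = 0"
  shows "X = (\<lambda>_ _ _. 0)"
proof -
  note X = covariantD[OF assms(1)]
  have "\<forall>n I. X n I (word_vector N F vac xs) = 0" if "xs \<in> mode_words N A" for xs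
    using that
  proof (induction rule: mode_words_induct)
    case Nil
    show ?case
      using vacuum_zero[OF X(2) T_even(1) X(4) T_vac S_odd(1) X(5) S_vac assms(2)]
      by (simp add: word_vector_def)
  next
    case (Cons \<alpha> j J xs)
    obtain q where q: "series_parity N q (F \<alpha>)"
      using F_homogeneous[OF Cons.hyps(1)] by blast
    obtain r where r: "super_local N p q r X (F \<alpha>)"
      using commutantD(3)[OF X(1) Cons.hyps(1)] local_pair_iff[OF X(2,3) F_field[OF Cons.hyps(1)] q] by blast
    show ?case
    proof (intro allI)
      fix n I
      show "X n I (word_vector N F vac ((\<alpha>, j, J) # xs)) = 0"
      proof (cases "I \<subseteq> {1..N}")
        case True
        with r have "local_order r (koszul ((p + par I) * (q + par ({1..N} - J)))) (\<lambda>n. X n I) (\<lambda>n. F \<alpha> n ({1..N} - J))"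
          unfolding super_local_def by blast
        from local_order_annihilates[OF this sfieldD(1)[OF X(2)] sfieldD(4)[OF F_field[OF Cons.hyps(1)]]]
        show ?thesis
          using Cons.IH by (simp add: word_Cons mode_def)
      qed (simp add: sfieldD(2)[OF X(2)])
    qed
  qed
  moreover have "complex_vector.subspace {v. \<forall>n I. X n I v = 0}"
    by (rule complex_vector.subspaceI)
      (simp_all add: sfieldD(3)[OF X(2)] endo_add[OF sfieldD(1)[OF X(2)]] endo_scale[OF sfieldD(1)[OF X(2)]])
  ultimately have "complex_vector.span (word_vector N F vac ` mode_words N A) \<subseteq> {v. \<forall>n I. X n I v = 0}"
    by (intro complex_vector.span_minimal) auto
  then have "v \<in> {v. \<forall>n I. X n I v = 0}" for v
    unfolding span by (rule subsetD) (rule UNIV_I)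
  then show ?thesis
    by (intro ext) simp
qed

definition state_field :: "'v series \<Rightarrow> bool" where
  "state_field X \<longleftrightarrow> (\<exists>X0 X1. vertex 0 X0 \<and> vertex 1 X1 \<and> X = lincomb 1 X0 1 X1)"

lemma vertex_state_field: "vertex p X \<Longrightarrow> state_field X"
proof -
  assume X: "vertex p X"
  have "X = lincomb 1 X 1 (\<lambda>_ _ _. 0)" "X = lincomb 1 (\<lambda>_ _ _. 0) 1 X"
    by (simp_all add: lincomb_def fun_eq_iff)
  then show ?thesis
    using X zero_vertex unfolding state_field_def by (cases p) auto
qed

lemma state_field_lincomb:
  assumes "state_field X" "state_field Y"
  shows "state_field (lincomb x X y Y)"
proof -
  obtain X0 X1 Y0 Y1 where *: "vertex 0 X0" "vertex 1 X1" "X = lincomb 1 X0 1 X1"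
    "vertex 0 Y0" "vertex 1 Y1" "Y = lincomb 1 Y0 1 Y1"
    using assms unfolding state_field_def by blast
  have "lincomb x X y Y = lincomb 1 (lincomb x X0 y Y0) 1 (lincomb x X1 y Y1)"
    unfolding * by (simp add: lincomb_def fun_eq_iff complex_vector.scale_right_distrib ac_simps)
  then show ?thesis
    unfolding state_field_def
    using vertex_lincomb[OF *(1,4), of x y] vertex_lincomb[OF *(2,5), of x y] by blast
qed

lemma vertex_vacuum_grade: "vertex p X \<Longrightarrow> X n {} vac \<in> grade p"
proof -
  assume "vertex p X"
  then have "endo_parity (p + par {}) (X n {})"
    using commutantD(2)[OF vertexD(2)] unfolding series_parity_def by blast
  then have "\<forall>v\<in>grade 0. X n {} v \<in> grade (0 + (p + par {}))"
    unfolding endo_parity_def by (rule spec)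
  then show "X n {} vac \<in> grade p"
    using vac_even by simp
qed

lemma grade_both:
  assumes "x \<in> grade 0" "x \<in> grade 1"
  shows "x = (0 :: 'v)"
  using IntI[OF assms] unfolding grade_Int by (rule singletonD)

lemma grade_sum_zero:
  assumes "x \<in> grade 0" "y \<in> grade 1" "x + y = (0 :: 'v)"
  shows "x = 0" "y = 0"
proof -
  have "0 - y = x"
    using assms(3) by (metis add_diff_cancel_right')
  then have "x \<in> grade 1"
    using grade_minus[OF grade_zero assms(2)] by metis
  then show "x = 0"
    by (rule grade_both[OF assms(1)])
  then show "y = 0"
    using assms(3) by simp
qed

lemma state_field_zero:
  assumes "state_field X" "X 0 {} vac = 0"
  shows "X = (\<lambda>_ _ _. 0)"
proof -
  obtain X0 X1 where *: "vertex 0 X0" "vertex 1 X1" "X = lincomb 1 X0 1 X1"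
    using assms unfolding state_field_def by blast
  have "X0 0 {} vac + X1 0 {} vac = 0"
    using assms(2) by (simp add: * lincomb_def)
  then have "X0 0 {} vac = 0" "X1 0 {} vac = 0"
    using grade_sum_zero[OF vertex_vacuum_grade[OF *(1)] vertex_vacuum_grade[OF *(2)]] by simp_all
  then have "X0 = (\<lambda>_ _ _. 0)" "X1 = (\<lambda>_ _ _. 0)"
    using goddard[OF vertexD(1)[OF *(1)]] goddard[OF vertexD(1)[OF *(2)]] by simp_all
  then show ?thesis
    by (simp add: * lincomb_def fun_eq_iff)
qed

lemma state_field_unique:
  assumes "state_field X" "state_field Y" "X 0 {} vac = Y 0 {} vac"
  shows "X = Y"
proof -
  have "lincomb 1 X (- 1) Y = (\<lambda>_ _ _. 0)"
    by (rule state_field_zero[OF state_field_lincomb[OF assms(1,2)]]) (simp add: lincomb_def assms(3))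
  then show ?thesis
    by (simp add: lincomb_def fun_eq_iff)
qed

lemma state_field_exists: "\<exists>X. state_field X \<and> X 0 {} vac = v"
proof -
  let ?V = "{v. \<exists>X. state_field X \<and> X 0 {} vac = v}"
  have comb: "x *\<^sub>C u + y *\<^sub>C w \<in> ?V" if "u \<in> ?V" "w \<in> ?V" for x u y w
  proof -
    obtain X Y where "state_field X" "X 0 {} vac = u" "state_field Y" "Y 0 {} vac = w"
      using \<open>u \<in> ?V\<close> \<open>w \<in> ?V\<close> by blast
    then have "state_field (lincomb x X y Y) \<and> lincomb x X y Y 0 {} vac = x *\<^sub>C u + y *\<^sub>C w"
      by (simp add: state_field_lincomb lincomb_def)
    then show ?thesis
      by blast
  qed
  have zero: "0 \<in> ?V"
    using vertex_state_field[OF zero_vertex] by blast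
  have "complex_vector.subspace ?V"
  proof (rule complex_vector.subspaceI)
    show "u + w \<in> ?V" if "u \<in> ?V" "w \<in> ?V" for u w
      using comb[OF that, of 1 1] by simp
    show "c *\<^sub>C u \<in> ?V" if "u \<in> ?V" for c u
      using comb[OF that that, of c 0] by simp
  qed (rule zero)
  moreover have "word_vector N F vac xs \<in> ?V" if xs: "xs \<in> mode_words N A" for xs
  proof -
    obtain p where p: "vertex p (word_series N F xs)"
      using word_vertex[OF xs] by blast
    then have "word_series N F xs 0 {} vac \<in> ?V"
      using vertex_state_field by blast
    then show ?thesis
      using comb[of "word_series N F xs 0 {} vac" "word_series N F xs 0 {} vac" "word_sign N xs" 0]
        word_vertex[OF xs] by simp
  qed
  ultimately have "complex_vector.span (word_vector N F vac ` mode_words N A) \<subseteq> ?V"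
    by (intro complex_vector.span_minimal) auto
  then show ?thesis
    unfolding span by blast
qed

definition Y :: "'v \<Rightarrow> 'v series" where
  "Y v = (THE X. state_field X \<and> X 0 {} vac = v)"

lemma Y_eqI: "state_field X \<Longrightarrow> X 0 {} vac = v \<Longrightarrow> Y v = X"
  unfolding Y_def by (rule the_equality) (auto intro: state_field_unique)

lemma Y_state_field: "state_field (Y v)" "Y v 0 {} vac = v"
  using state_field_exists[of v] Y_eqI by auto

lemma Y_vertex:
  assumes "v \<in> grade p"
  shows "vertex p (Y v)"
proof -
  obtain X0 X1 where *: "vertex 0 X0" "vertex 1 X1" "Y v = lincomb 1 X0 1 X1"
    using Y_state_field(1)[of v] unfolding state_field_def by blast
  have v: "v = X0 0 {} vac + X1 0 {} vac"
    using Y_state_field(2)[of v] by (simp add: * lincomb_def)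
  note g = vertex_vacuum_grade[OF *(1), of 0] vertex_vacuum_grade[OF *(2), of 0]
  show ?thesis
  proof (cases "p = 0")
    case True
    then have "v - X0 0 {} vac \<in> grade 0"
      using grade_minus[OF _ g(1)] assms by simp
    then have "X1 0 {} vac = 0"
      by (intro grade_both g(2)) (simp add: v)
    then have "Y v = X0"
      using v by (intro Y_eqI vertex_state_field[OF *(1)]) simp
    then show ?thesis
      using * True by simp
  next
    case False
    then have p: "p = 1"
      by simp
    then have "v - X1 0 {} vac \<in> grade 1"
      using grade_minus[OF _ g(2)] assms by blast
    then have "X0 0 {} vac = 0"
      by (intro grade_both g(1)) (simp add: v)
    then have "Y v = X1"
      using v by (intro Y_eqI vertex_state_field[OF *(2)]) simp
    then show ?thesis
      using * p by simp
  qed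
qed

lemma Y_lincomb: "Y (x *\<^sub>C u + y *\<^sub>C w) = lincomb x (Y u) y (Y w)"
  by (rule Y_eqI) (simp_all add: state_field_lincomb Y_state_field lincomb_def)

lemma Y_linear: "endo (\<lambda>a. Y a n I v)"
proof (rule endoI)
  show "Y (x + y) n I v = Y x n I v + Y y n I v" for x y
    using Y_lincomb[of 1 x 1 y] by (simp add: lincomb_def)
  show "Y (c *\<^sub>C x) n I v = c *\<^sub>C Y x n I v" for c x
    using Y_lincomb[of c x 0 x] by (simp add: lincomb_def)
qed

lemma Y_sfield: "sfield N (Y v)"
  using Y_state_field(1)[of v] sfield_lincomb commutantD(1) vertexD(2)
  unfolding state_field_def by metis

lemma Y_creates: "creates vac (Y v) v"
proof -
  obtain X0 X1 where *: "vertex 0 X0" "vertex 1 X1" "Y v = lincomb 1 X0 1 X1"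
    using Y_state_field(1)[of v] unfolding state_field_def by blast
  have "Y v n I vac = 0" if "n < 0" for n I
    using covariant_regular[OF vertexD(1)[OF *(1)] that] covariant_regular[OF vertexD(1)[OF *(2)] that]
    by (simp add: * lincomb_def)
  then show ?thesis
    unfolding creates_def using Y_state_field(2) by blast
qed

lemma Y_susy_vertex_algebra: "susy_vertex_algebra N vac T S Y"
  unfolding susy_vertex_algebra_def
proof (intro conjI allI ballI)
  show "Vector_Spaces.linear scaleC scaleC (\<lambda>a. Y a n I v)" for n I v
    using Y_linear unfolding endo_def .
  fix p and v :: 'v assume v: "v \<in> grade p"
  note V = covariantD[OF vertexD(1)[OF Y_vertex[OF v]]]
  show "series_parity N p (Y v)"
    by (rule V(3))
  show "bracket N 0 T (Y v) = d_even (Y v)"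
    using bracket_even_iff[OF V(2,3) T_even(1)] V(4) by blast
  show "bracket N 1 (S i) (Y v) = d_odd i (Y v)" if "i \<in> {1..N}" for i
    using bracket_odd_iff[OF V(2,3) S_odd(1)[OF that]] V(5)[OF that] by blast
  show "local_pair N (Y v) (Y w)" if "w \<in> grade q" for q w
    by (rule vertex_local[OF Y_vertex[OF v] Y_vertex[OF that]])
qed (use vac_even T_even S_odd T_vac S_vac Y_sfield Y_creates in auto)

lemma Y_word:
  assumes "xs \<in> mode_words N A"
  shows "Y (word_vector N F vac xs) n I v = word_sign N xs *\<^sub>C word_series N F xs n I v"
proof -
  obtain p where p: "vertex p (word_series N F xs)"
    using word_vertex[OF assms] by blast
  let ?W = "lincomb (word_sign N xs) (word_series N F xs) 0 (word_series N F xs)"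
  have "Y (word_vector N F vac xs) = ?W"
    by (rule Y_eqI[OF vertex_state_field[OF vertex_lincomb[OF p p]]])
      (simp add: lincomb_def word_vertex[OF assms])
  then show ?thesis
    by (simp add: lincomb_def)
qed

lemma Y_gen:
  assumes "\<alpha> \<in> A"
  shows "Y (gen \<alpha>) = F \<alpha>"
  using F_homogeneous[OF assms] F_vacuum[OF assms] vertex_state_field[OF F_vertex[OF assms]]
  by (auto simp: creates_def intro: Y_eqI)

lemma gen_grade:
  assumes "\<alpha> \<in> A" "series_parity N p (F \<alpha>)"
  shows "gen \<alpha> \<in> grade p"
  using vertex_vacuum_grade[OF F_vertex[OF assms], of 0] F_vacuum[OF assms(1)] unfolding creates_def by simp

lemma Y_unique:
  assumes Y': "susy_vertex_algebra N vac T S Y'" and gen: "\<And>\<alpha>. \<alpha> \<in> A \<Longrightarrow> Y' (gen \<alpha>) = F \<alpha>"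
  shows "Y' = Y"
proof -
  have hom: "Y' v = Y v" if v: "v \<in> grade p" for p and v :: 'v
  proof -
    have f: "sfield N (Y' v)" "series_parity N p (Y' v)"
      using Y' v unfolding susy_vertex_algebra_def by blast+
    have "local_pair N (Y' v) (F \<alpha>)" if \<alpha>: "\<alpha> \<in> A" for \<alpha>
    proof -
      obtain q where "gen \<alpha> \<in> grade q"
        using gen_grade[OF \<alpha>] F_homogeneous[OF \<alpha>] by blast
      then have "local_pair N (Y' v) (Y' (gen \<alpha>))"
        using Y' v unfolding susy_vertex_algebra_def by blast
      then show ?thesis
        by (simp add: gen[OF \<alpha>])
    qed
    moreover have "T_covariant T (Y' v)"
      using Y' v bracket_even_iff[OF f T_even(1)] unfolding susy_vertex_algebra_def by blast
    moreover have "S_covariant p i (S i) (Y' v)" if "i \<in> {1..N}" for i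
      using Y' v that bracket_odd_iff[OF f S_odd(1)[OF that]] unfolding susy_vertex_algebra_def by blast
    ultimately have "covariant p (Y' v)"
      using f unfolding covariant_def commutant_def by blast
    then have "covariant p (lincomb 1 (Y' v) (- 1) (Y v))"
      using covariant_lincomb vertexD(1)[OF Y_vertex[OF v]] by blast
    moreover have "creates vac (Y' v) v"
      using Y' unfolding susy_vertex_algebra_def by blast
    then have "lincomb 1 (Y' v) (- 1) (Y v) 0 {} vac = 0"
      by (simp add: lincomb_def creates_def Y_state_field)
    ultimately have "lincomb 1 (Y' v) (- 1) (Y v) = (\<lambda>_ _ _. 0)"
      by (rule goddard)
    then show ?thesis
      by (simp add: lincomb_def fun_eq_iff)
  qed
  have "Y' v n I w = Y v n I w" for v n I w
  proof -
    obtain y z where "y \<in> grade 0" "z \<in> grade 1" "v = y + z"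
      using grade_sum by blast
    moreover have "endo (\<lambda>a. Y' a n I w)"
      using Y' unfolding susy_vertex_algebra_def endo_def by blast
    ultimately show ?thesis
      using endo_add[OF Y_linear[of n I w], of y z] endo_add[of "\<lambda>a. Y' a n I w" y z] hom by simp
  qed
  then show ?thesis
    by blast
qed

end

theorem theorem3p3p25:
  fixes N :: nat
    and vac :: "'v::complex_superspace"
    and T :: "'v \<Rightarrow> 'v"
    and S :: "nat \<Rightarrow> 'v \<Rightarrow> 'v"
    and A :: "'i set"
    and F :: "'i \<Rightarrow> 'v series"
    and gen :: "'i \<Rightarrow> 'v"
  assumes vac_even: "vac \<in> grade 0"
    and T_even: "endo T" "endo_parity 0 T"
    and S_odd: "\<And>i. i \<in> {1..N} \<Longrightarrow> endo (S i)" "\<And>i. i \<in> {1..N} \<Longrightarrow> endo_parity 1 (S i)"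
    and S_anticommute:
      "\<And>i k v. i \<in> {1..N} \<Longrightarrow> k \<in> {1..N} \<Longrightarrow> i \<noteq> k \<Longrightarrow> S i (S k v) + S k (S i v) = 0"
    and T_S_commute: "\<And>i v. i \<in> {1..N} \<Longrightarrow> T (S i v) = S i (T v)"
    and T_vac: "T vac = 0"
    and S_vac: "\<And>i. i \<in> {1..N} \<Longrightarrow> S i vac = 0"
    and F_field: "\<And>\<alpha>. \<alpha> \<in> A \<Longrightarrow> sfield N (F \<alpha>)"
    and F_homogeneous: "\<And>\<alpha>. \<alpha> \<in> A \<Longrightarrow> \<exists>p. series_parity N p (F \<alpha>)"
    and F_vacuum: "\<And>\<alpha>. \<alpha> \<in> A \<Longrightarrow> creates vac (F \<alpha>) (gen \<alpha>)"
    and F_T: "\<And>\<alpha>. \<alpha> \<in> A \<Longrightarrow> bracket N 0 T (F \<alpha>) = d_even (F \<alpha>)"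
    and F_S: "\<And>\<alpha> i. \<alpha> \<in> A \<Longrightarrow> i \<in> {1..N} \<Longrightarrow> bracket N 1 (S i) (F \<alpha>) = d_odd i (F \<alpha>)"
    and F_local: "\<And>\<alpha> \<beta>. \<alpha> \<in> A \<Longrightarrow> \<beta> \<in> A \<Longrightarrow> local_pair N (F \<alpha>) (F \<beta>)"
    and span: "complex_vector.span (word_vector N F vac ` mode_words N A) = UNIV"
  shows "\<exists>Y. susy_vertex_algebra N vac T S Y
           \<and> (\<forall>xs\<in>mode_words N A. \<forall>n I v.
                 Y (word_vector N F vac xs) n I v = word_sign N xs *\<^sub>C word_series N F xs n I v)
           \<and> (\<forall>\<alpha>\<in>A. Y (gen \<alpha>) = F \<alpha>)
           \<and> (\<forall>Y'. susy_vertex_algebra N vac T S Y' \<and> (\<forall>\<alpha>\<in>A. Y' (gen \<alpha>) = F \<alpha>) \<longrightarrow> Y' = Y)"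
proof -
  interpret generating_fields N vac T S A F gen
    by unfold_locales (fact assms)+
  show ?thesis
    using Y_susy_vertex_algebra Y_word Y_gen Y_unique by blast
qed

end
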